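(* Let $G_o$ be a unimodular lcsc group acting jointly continuously on a Polish space $X$, let $Z\subset X$ be a separated cross section with return time set $\Lambda$, let $\mu$ be a $G_o$-invariant Borel probability measure on $X$ with transverse measure $\nu$ on $Z$, and let $r\ge1$. If $\Lambda$ is a uniform approximate lattice in $G_o$, then there exists a unique finite $G_o$-invariant Borel measure $\mu^{[r]}$ on the intersection space $X^{[r]}$ (with the diagonal $G_o$-action) whose transverse measure on $Z^r$ is $\nu^{\otimes r}$. Moreover, if $\mu$ is $G_o$-ergodic, then, up to a multiplicative constant, $\mu^{[r]}$ is an $r$-fold $G_o$-invariant self-joining of $\mu$.
   Context: lcsc = locally compact second countable; $m_{G_o}$ is a fixed Haar measure on $G_o$. For a Borel action of $G_o$ on a standard Borel space $X$, a Borel set $Z\subset X$ is a cross section if $G_o.Z=X$; its return time set is $\Lambda=\Lambda(Z):=\{g\in G_o: g.Z\cap Z\neq\emptyset\}$; $Z$ is separated if $\Lambda(Z)\cap U=\{e\}$ for some identity neighbourhood $U$. For $x\in X$ put $Z_x:=\{g\in G_o: g.x\in Z\}$. If $Z$ is a separated cross section and $\mu$ a finite $G_o$-invariant Borel measure on $X$, its transverse measure on $Z$ is the unique finite Borel measure $\nu$ on $Z$ such that for all bounded non-negative Borel $f:G_o\times Z\to\mathbb R$, $$\int_X\sum_{g\in Z_x}f(g^{-1},g.x)\,d\mu(x)=\int_{G_o}\int_Z f(g,z)\,d\nu(z)\,dm_{G_o}(g).$$ The intersection space is $X^{[r]}:=\{(x_1,\dots,x_r)\in X^r: \exists g\in G_o:\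 g.x_j\in Z\text{ for all }j\}$; it is a Borel subset of $X^r$, invariant under the diagonal $G_o$-action, and $Z^r$ is a separated cross section for this action on $X^{[r]}$. A uniform approximate lattice in $G_o$ is a symmetric subset $\Lambda\ni e$ such that $\Lambda^2\subset\Lambda F$ for some finite $F\subset G_o$, $\Lambda$ is uniformly discrete ($\Lambda\Lambda^{-1}\cap U=\{e\}$ for some identity neighbourhood $U$) and $G_o=K\Lambda$ for some compact $K$. An $r$-fold $G_o$-invariant self-joining of $\mu$ is a Borel probability measure on $X^r$ invariant under the diagonal $G_o$-action, all of whose $r$ coordinate projections equal $\mu$; measures on $X^{[r]}$ are regarded as measures on $X^r$. *)

theory Defs
  imports "HOL-Probability.Probability"
begin

text \<open>
  Groups are written additively because \<^class>\<open>topological_group_add\<close> is the library's class of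
  topological groups; \<^class>\<open>group_add\<close> does not assume commutativity. Thus \<open>g + h\<close>, \<open>0\<close> and \<open>- g\<close>
  stand for \<open>gh\<close>, \<open>e\<close> and the inverse of \<open>g\<close>, and sums of sets are product sets \<open>AB\<close>.
\<close>

section \<open>Haar measures\<close>

text \<open>On a locally compact second countable group the usual regularity conditions on a Haar
  measure follow from finiteness on compact sets.\<close>

definition haar_measure ::
    "'g :: {topological_group_add, second_countable_topology, t2_space} measure \<Rightarrow> bool" where
  "haar_measure m \<longleftrightarrow>
     sets m = sets borel \<and>
     (\<forall>K. compact K \<longrightarrow> emeasure m K < \<infinity>) \<and>
     (\<forall>U. open U \<and> U \<noteq> {} \<longrightarrow> emeasure m U > 0) \<and>
     (\<forall>g. distr m borel (\<lambda>h. g + h) = m)"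

definition unimodular ::
    "'g :: {topological_group_add, second_countable_topology, t2_space} itself \<Rightarrow> bool" where
  "unimodular _ \<longleftrightarrow>
     (\<forall>m :: 'g measure. haar_measure m \<longrightarrow> (\<forall>g. distr m borel (\<lambda>h. h + g) = m))"

section \<open>Uniform approximate lattices\<close>

definition uniformly_discrete :: "'g :: topological_group_add set \<Rightarrow> bool" where
  "uniformly_discrete L \<longleftrightarrow>
     (\<exists>U. open U \<and> 0 \<in> U \<and> (L + uminus ` L) \<inter> U = {0})"

definition uniform_approximate_lattice :: "'g :: topological_group_add set \<Rightarrow> bool" where
  "uniform_approximate_lattice L \<longleftrightarrow>
     0 \<in> L \<and> uminus ` L = L \<and>
     (\<exists>F. finite F \<and> L + L \<subseteq> L + F) \<and>
     uniformly_discrete L \<and>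
     (\<exists>K. compact K \<and> K + L = UNIV)"

section \<open>Actions, cross sections and transverse measures\<close>

definition jointly_continuous_action ::
    "('g :: topological_group_add \<Rightarrow> 'x :: topological_space \<Rightarrow> 'x) \<Rightarrow> bool" where
  "jointly_continuous_action act \<longleftrightarrow>
     (\<forall>x. act 0 x = x) \<and> (\<forall>g h x. act (g + h) x = act g (act h x)) \<and>
     continuous_on UNIV (\<lambda>(g, x). act g x)"

text \<open>The notions below are stated for an arbitrary carrier, so that they apply both to the
  action on \<open>X\<close> and to the diagonal action on the intersection space. The measurable structure
  is that of the measure argument.\<close>

definition invariant_measure :: "('g \<Rightarrow> 'a \<Rightarrow> 'a) \<Rightarrow> 'a measure \<Rightarrow> bool" where
  "invariant_measure act M \<longleftrightarrow> (\<forall>g. act g \<in> M \<rightarrow>\<^sub>M M \<and> distr M M (act g) = M)"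

definition ergodic_measure :: "('g \<Rightarrow> 'a \<Rightarrow> 'a) \<Rightarrow> 'a measure \<Rightarrow> bool" where
  "ergodic_measure act M \<longleftrightarrow>
     (\<forall>A\<in>sets M. (\<forall>g. act g -` A \<inter> space M = A) \<longrightarrow>
        emeasure M A = 0 \<or> emeasure M (space M - A) = 0)"

definition cross_section :: "('g \<Rightarrow> 'a \<Rightarrow> 'a) \<Rightarrow> 'a measure \<Rightarrow> 'a set \<Rightarrow> bool" where
  "cross_section act M Z \<longleftrightarrow> Z \<in> sets M \<and> (\<Union>g. act g ` Z) = space M"

definition return_times :: "('g \<Rightarrow> 'a \<Rightarrow> 'a) \<Rightarrow> 'a set \<Rightarrow> 'g set" where
  "return_times act Z = {g. act g ` Z \<inter> Z \<noteq> {}}"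

definition separated :: "('g :: topological_group_add \<Rightarrow> 'a \<Rightarrow> 'a) \<Rightarrow> 'a set \<Rightarrow> bool" where
  "separated act Z \<longleftrightarrow> (\<exists>U. open U \<and> 0 \<in> U \<and> return_times act Z \<inter> U = {0})"

definition hitting_times :: "('g \<Rightarrow> 'a \<Rightarrow> 'a) \<Rightarrow> 'a set \<Rightarrow> 'a \<Rightarrow> 'g set" where
  "hitting_times act Z x = {g. act g x \<in> Z}"

text \<open>\<open>transverse_measure m act Z M N\<close> says that \<open>N\<close> is the transverse measure on \<open>Z\<close> of \<open>M\<close>, with
  respect to the Haar measure \<open>m\<close>. The sum over the hitting times is the integral with respect
  to counting measure.\<close>

definition transverse_measure ::
    "'g :: topological_group_add measure \<Rightarrow> ('g \<Rightarrow> 'a \<Rightarrow> 'a) \<Rightarrow> 'a set \<Rightarrow>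
     'a measure \<Rightarrow> 'a measure \<Rightarrow> bool" where
  "transverse_measure m act Z M N \<longleftrightarrow>
     finite_measure N \<and> sets N = sets (restrict_space M Z) \<and>
     (\<forall>f :: 'g \<times> 'a \<Rightarrow> real.
        f \<in> borel_measurable (m \<Otimes>\<^sub>M N) \<and>
        (\<exists>B. \<forall>p\<in>space (m \<Otimes>\<^sub>M N). 0 \<le> f p \<and> f p \<le> B) \<longrightarrow>
        (\<integral>\<^sup>+x. (\<integral>\<^sup>+g. ennreal (f (- g, act g x)) \<partial>count_space (hitting_times act Z x)) \<partial>M) =
        (\<integral>\<^sup>+g. (\<integral>\<^sup>+z. ennreal (f (g, z)) \<partial>N) \<partial>m))"

section \<open>Intersection spaces and self-joinings\<close>

text \<open>Points of \<open>X^r\<close> are functions on \<open>{..<r}\<close>, extended by \<open>undefined\<close> elsewhere, as in \<^const>\<open>PiM\<close>.\<close>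

definition diag_act :: "nat \<Rightarrow> ('g \<Rightarrow> 'x \<Rightarrow> 'x) \<Rightarrow> 'g \<Rightarrow> (nat \<Rightarrow> 'x) \<Rightarrow> (nat \<Rightarrow> 'x)" where
  "diag_act r act g x = (\<lambda>j\<in>{..<r}. act g (x j))"

abbreviation borel_power :: "nat \<Rightarrow> (nat \<Rightarrow> 'x :: topological_space) measure" where
  "borel_power r \<equiv> PiM {..<r} (\<lambda>_. borel)"

definition intersection_space ::
    "nat \<Rightarrow> ('g \<Rightarrow> 'x \<Rightarrow> 'x) \<Rightarrow> 'x set \<Rightarrow> (nat \<Rightarrow> 'x) set" where
  "intersection_space r act Z =
     {x \<in> {..<r} \<rightarrow>\<^sub>E UNIV. \<exists>g. \<forall>j<r. act g (x j) \<in> Z}"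

text \<open>\<open>intersection_measure m act Z \<nu> r M\<close> says that \<open>M\<close> is a finite invariant Borel measure on the
  intersection space whose transverse measure on \<open>Z^r\<close> is the \<open>r\<close>-fold product of \<open>\<nu>\<close>.\<close>

definition intersection_measure ::
    "'g :: topological_group_add measure \<Rightarrow> ('g \<Rightarrow> 'x :: topological_space \<Rightarrow> 'x) \<Rightarrow> 'x set \<Rightarrow>
     'x measure \<Rightarrow> nat \<Rightarrow> (nat \<Rightarrow> 'x) measure \<Rightarrow> bool" where
  "intersection_measure m act Z \<nu> r M \<longleftrightarrow>
     sets M = sets (restrict_space (borel_power r) (intersection_space r act Z)) \<and>
     finite_measure M \<and>
     invariant_measure (diag_act r act) M \<and>
     transverse_measure m (diag_act r act) ({..<r} \<rightarrow>\<^sub>E Z) M (PiM {..<r} (\<lambda>_. \<nu>))"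

definition self_joining ::
    "nat \<Rightarrow> ('g \<Rightarrow> 'x :: topological_space \<Rightarrow> 'x) \<Rightarrow> 'x measure \<Rightarrow> (nat \<Rightarrow> 'x) measure \<Rightarrow> bool" where
  "self_joining r act \<mu> J \<longleftrightarrow>
     prob_space J \<and> sets J = sets (borel_power r) \<and>
     invariant_measure (diag_act r act) J \<and>
     (\<forall>j<r. distr J borel (\<lambda>x. x j) = \<mu>)"

end

theory Submission
  imports Defs
begin

text \<open>
  The return times \<open>\<Lambda>\<close> are countable, and a small neighbourhood \<open>V\<close> of \<open>0\<close> satisfies
  \<open>(- V + V) \<inter> (\<Lambda> + \<Lambda> + \<Lambda>) \<subseteq> {0}\<close>. Numbering countably many translates of \<open>V\<close> therefore singles out
  one hitting time of every orbit point, i.e. a fundamental domain \<open>D \<subseteq> G \<times> W\<close>, with \<open>W = Z\<^sup>r\<close>, for the map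
  \<open>(g, w) \<mapsto> gw\<close>. A measure with transverse measure \<open>N\<close> must be the image of \<open>m \<otimes> N\<close> restricted to
  \<open>D\<close>, which gives uniqueness; conversely, if \<open>N\<close> is invariant under return times, mass transport shows
  that this image has transverse measure \<open>N\<close>.

  No descriptive set theory is needed for measurability: \<open>\<mu>\<close> is given by its transverse measure, so the
  lower integrals of complementary pieces of the fundamental domain add up, and hence a hitting
  time can be chosen measurably \<open>\<mu>\<close>-almost everywhere; all others differ from it by elements of \<open>\<Lambda>\<close>.

  Finiteness: the saturation \<open>\<Lambda>Z\<close> is still separated, so the extension \<open>\<nu>'\<close> of \<open>\<nu>\<close> to \<open>\<Lambda>Z\<close> is finite.
  As \<open>X^[r] = K\<Lambda>W\<close> and the extension of \<open>\<nu>\<^sup>r\<close> to \<open>\<Lambda>W\<close> is a restriction of \<open>\<nu>'\<^sup>r\<close>, the total mass is at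
  most \<open>m(K) \<nu>'(X)\<^sup>r\<close>. Finally the marginals are invariant and absolutely continuous with
  respect to \<open>\<mu>\<close>, hence multiples of it by ergodicity.
\<close>

section \<open>Neighbourhoods separating an approximate lattice\<close>

text \<open>The fibres of \<open>(g, w) \<mapsto> gw\<close> are the classes of the relation that
  joins \<open>(g, w)\<close> to \<open>(g - l, lw)\<close> for \<open>l\<close> in
  \<open>\<Lambda>\<close>. Moving along a fibre thus translates the group coordinate on the right:
  right invariance of \<open>m\<close> drives mass transport, while left invariance makes the
  resulting measure invariant under the action. On \<open>G \<times> W\<close> every sum runs over
  the countable \<open>\<Lambda>\<close> and Tonelli applies. On the orbit side the sum runs over
  the whole group, its measurability is unclear, and integrals cannot be added or swapped.
  Computations are therefore moved to \<open>G \<times> W\<close>. For tuples this works through the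
  first coordinate, whose hitting times include those of the tuple. The smallness condition has
  three summands because two points of the saturated section on one orbit are each tied to a base
  point by a return time, and the base points differ by a third. It makes the translates of
  \<open>\<Lambda>Z\<close> by elements of \<open>V\<close> pairwise disjoint; hence
  \<open>m(V) \<nu>'(X)\<close> is at most the total mass 1 of \<open>\<mu>\<close>, which is where
  finiteness of \<open>\<nu>'\<close> comes from.\<close>

lemma small_neighbourhood:
  fixes U :: "'g :: topological_group_add set"
  assumes "open U" "0 \<in> U"
  obtains V where "open V" "0 \<in> V" "\<And>a b. a \<in> V \<Longrightarrow> b \<in> V \<Longrightarrow> - b + a \<in> U"
    "\<And>a b. a \<in> V \<Longrightarrow> b \<in> V \<Longrightarrow> a - b \<in> U"
proof -
  have c1: "continuous_on UNIV (\<lambda>p::'g \<times> 'g. - snd p + fst p)"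
    and c2: "continuous_on UNIV (\<lambda>p::'g \<times> 'g. fst p - snd p)"
    by (intro continuous_intros)+
  define O1 where "O1 = (\<lambda>p::'g \<times> 'g. - snd p + fst p) -` U \<inter> (\<lambda>p. fst p - snd p) -` U"
  have "open O1"
    unfolding O1_def using open_vimage[OF assms(1) c1] open_vimage[OF assms(1) c2] by auto
  moreover have "(0, 0) \<in> O1"
    using assms by (auto simp: O1_def)
  ultimately obtain A B where "open A" "open B" "(0, 0) \<in> A \<times> B" "A \<times> B \<subseteq> O1"
    by (rule open_prod_elim)
  then show thesis
    by (intro that[of "A \<inter> B"]) (auto simp: O1_def)
qed

text \<open>Two applications of \<open>L + L \<subseteq> L + F\<close> put all triple sums into
  \<open>L + (F + F)\<close>, a union of finitely many right translates of \<open>L\<close>. Two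
  points of one translate that lie in \<open>U1\<close> have their difference in \<open>U0\<close>,
  where differences of elements of \<open>L\<close> vanish. So \<open>U1\<close> meets each
  translate at most once, and removing the finitely many non-zero points leaves the
  neighbourhood.\<close>

lemma triple_sums_isolated:
  fixes L :: "'g :: {topological_group_add, t2_space} set"
  assumes L: "uniform_approximate_lattice L"
  obtains U where "open U" "0 \<in> U"
    "\<And>a b c. a \<in> L \<Longrightarrow> b \<in> L \<Longrightarrow> c \<in> L \<Longrightarrow> a + b + c \<in> U \<Longrightarrow> a + b + c = 0"
proof -
  from L obtain F where F: "finite F" "L + L \<subseteq> L + F"
    unfolding uniform_approximate_lattice_def by blast
  have "uniformly_discrete L"
    using L by (simp add: uniform_approximate_lattice_def)
  then obtain U0 where U0: "open U0" "0 \<in> U0" "(L + uminus ` L) \<inter> U0 = {0}"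
    unfolding uniformly_discrete_def by metis
  obtain U1 where U1: "open U1" "0 \<in> U1" "\<And>a b. a \<in> U1 \<Longrightarrow> b \<in> U1 \<Longrightarrow> a - b \<in> U0"
    using small_neighbourhood[OF U0(1,2)] by metis
  define P where "P = (L + (F + F)) \<inter> U1"
  have P: "P = (\<Union>f\<in>F + F. ((\<lambda>a. a + f) ` L) \<inter> U1)"
    unfolding P_def by (auto simp: set_plus_def)
  have "finite (((\<lambda>a. a + f) ` L) \<inter> U1)" for f
  proof (rule finite_subset)
    show "((\<lambda>a. a + f) ` L) \<inter> U1 \<subseteq> {SOME x. x \<in> ((\<lambda>a. a + f) ` L) \<inter> U1}"
    proof
      fix x assume x: "x \<in> ((\<lambda>a. a + f) ` L) \<inter> U1"
      define y where "y = (SOME x. x \<in> ((\<lambda>a. a + f) ` L) \<inter> U1)"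
      have y: "y \<in> ((\<lambda>a. a + f) ` L) \<inter> U1"
        unfolding y_def using x by (rule someI)
      obtain a b where ab: "a \<in> L" "b \<in> L" "x = a + f" "y = b + f" using x y by blast
      have "a - b = x - y"
        by (simp add: ab diff_conv_add_uminus minus_add add.assoc del: add_uminus_conv_diff)
      then have "a - b \<in> U0" using U1(3) x y by auto
      moreover have "a - b \<in> L + uminus ` L"
        using ab by (metis diff_conv_add_uminus imageI set_plus_intro)
      ultimately have "a - b = 0" using U0(3) by blast
      then show "x \<in> {SOME x. x \<in> ((\<lambda>a. a + f) ` L) \<inter> U1}" using ab y_def by simp
    qed
  qed simp
  moreover have "finite (F + F)" using F(1) by (rule finite_set_plus[OF F(1)])
  ultimately have "finite P" unfolding P by blast
  then have "closed (P - {0})" by (intro finite_imp_closed) auto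
  then have op: "open (U1 - (P - {0}))" using U1(1) by (rule open_Diff[rotated])
  have iso: "a + b + c = 0"
    if "a \<in> L" "b \<in> L" "c \<in> L" "a + b + c \<in> U1 - (P - {0})" for a b c
  proof -
    have "b + c \<in> L + F" using that F(2) by (meson set_plus_intro subsetD)
    then obtain d f where d: "d \<in> L" "f \<in> F" "b + c = d + f" by (auto elim: set_plus_elim)
    have "a + d \<in> L + F" using that d F(2) by (meson set_plus_intro subsetD)
    then obtain e h where e: "e \<in> L" "h \<in> F" "a + d = e + h" by (auto elim: set_plus_elim)
    have "a + b + c = e + (h + f)"
      using d(3) e(3) by (metis add.assoc)
    then have "a + b + c \<in> L + (F + F)" using d e by (simp add: set_plus_intro)
    then show ?thesis using that(4) by (auto simp: P_def)
  qed
  show thesis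
    by (rule that[OF op _ iso]) (use U1(2) in simp_all)
qed

lemma open_finite_measure:
  fixes m :: "'g :: {topological_group_add, second_countable_topology, t2_space} measure"
  assumes "locally compact (UNIV :: 'g set)" "haar_measure m"
  obtains Q where "open Q" "0 \<in> Q" "emeasure m Q < \<infinity>"
proof -
  obtain u v where uv: "0 \<in> u" "openin (top_of_set UNIV) u" "u \<subseteq> v" "compact (v :: 'g set)"
    using assms(1) unfolding locally_def
    by (metis UNIV_I openin_subtopology_self subset_UNIV topspace_euclidean_subtopology)
  have "open u" using uv(2) by simp
  have m: "sets m = sets borel" "\<And>K. compact K \<Longrightarrow> emeasure m K < \<infinity>"
    using assms(2) by (auto simp: haar_measure_def)
  have "emeasure m u \<le> emeasure m v"
    using uv compact_imp_closed[OF uv(4)] by (intro emeasure_mono) (auto simp: m)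
  then show thesis using m(2)[OF uv(4)] \<open>open u\<close> uv(1) that[of u] by (auto intro: le_less_trans)
qed

text \<open>One \<open>V\<close> serves every purpose: its finite measure makes \<open>m\<close>
  sigma-finite, sums of one or two elements of \<open>L\<close> (padded by \<open>0\<close>) show
  that translates of \<open>V\<close> separate hitting times and that \<open>L\<close> is countable,
  and genuine triple sums separate the saturated section. The order \<open>- w + v\<close> suits
  left translates, as \<open>- (t + w) + (t + v) = - w + v\<close>.\<close>

lemma separating_neighbourhood:
  fixes m :: "'g :: {topological_group_add, second_countable_topology, t2_space} measure"
  assumes "locally compact (UNIV :: 'g set)" "haar_measure m" "uniform_approximate_lattice L"
  obtains V where "open V" "0 \<in> V" "emeasure m V < \<infinity>"
    "\<And>a b c v w. a \<in> L \<Longrightarrow> b \<in> L \<Longrightarrow> c \<in> L \<Longrightarrow> v \<in> V \<Longrightarrow> w \<in> V \<Longrightarrow> - w + v = a + b + c \<Longrightarrow> v = w"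
proof -
  obtain Q where Q: "open Q" "0 \<in> Q" "emeasure m Q < \<infinity>"
    using open_finite_measure[OF assms(1,2)] .
  obtain U where U: "open U" "0 \<in> U"
    "\<And>a b c. a \<in> L \<Longrightarrow> b \<in> L \<Longrightarrow> c \<in> L \<Longrightarrow> a + b + c \<in> U \<Longrightarrow> a + b + c = 0"
    using triple_sums_isolated[OF assms(3)] by metis
  obtain V where V: "open V" "0 \<in> V" "\<And>a b. a \<in> V \<Longrightarrow> b \<in> V \<Longrightarrow> - b + a \<in> U"
    using small_neighbourhood[OF U(1,2)] by metis
  show thesis
  proof (rule that[of "V \<inter> Q"])
    show "emeasure m (V \<inter> Q) < \<infinity>"
      using Q V assms(2) by (intro le_less_trans[OF emeasure_mono Q(3)]) (auto simp: haar_measure_def)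
    fix a b c v w assume *: "a \<in> L" "b \<in> L" "c \<in> L" "v \<in> V \<inter> Q" "w \<in> V \<inter> Q" "- w + v = a + b + c"
    then have "- w + v = 0" using V(3)[of v w] U(3)[of a b c] by auto
    then show "v = w" using add_minus_cancel[of w v] by simp
  qed (use V Q in auto)
qed

lemma countable_translate_cover:
  fixes V :: "'g :: {topological_group_add, second_countable_topology} set"
  assumes "open V" "0 \<in> V"
  obtains t :: "nat \<Rightarrow> 'g" where "\<And>g. \<exists>n. - t n + g \<in> V"
proof -
  have op: "open ((\<lambda>h. - g + h) -` V)" for g :: 'g
    by (intro open_vimage assms continuous_intros)
  obtain F where F: "F \<subseteq> range (\<lambda>g. (\<lambda>h. - g + h) -` V)" "countable F"
    "\<Union>F = \<Union>(range (\<lambda>g. (\<lambda>h. - g + h) -` V))"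
    using Lindelof[of "range (\<lambda>g. (\<lambda>h. - g + h) -` V)"] op by auto
  obtain T where T: "countable T" "F = (\<lambda>g. (\<lambda>h. - g + h) -` V) ` T"
    using F by (meson countable_subset_image)
  have cov: "\<exists>s\<in>T. - s + g \<in> V" for g
  proof -
    have "g \<in> \<Union>F" unfolding F(3) using assms(2) by (auto intro!: exI[of _ g])
    then show ?thesis unfolding T(2) by auto
  qed
  then have "T \<noteq> {}" by auto
  show thesis
  proof (rule that)
    fix g
    obtain s where "s \<in> T" "- s + g \<in> V" using cov by blast
    then show "\<exists>n. - from_nat_into T n + g \<in> V"
      using from_nat_into_surj[OF T(1)] by force
  qed
qed

section \<open>Measurability\<close>

lemma borel_measurable_nn_integral_count_space:
  fixes f :: "'i \<Rightarrow> 'a \<Rightarrow> ennreal"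
  assumes L: "countable L" and f: "\<And>l. l \<in> L \<Longrightarrow> f l \<in> borel_measurable M"
  shows "(\<lambda>x. \<integral>\<^sup>+l. f l x \<partial>count_space L) \<in> borel_measurable M"
proof -
  interpret sigma_finite_measure "count_space L"
    using L by (rule sigma_finite_measure_count_space_countable)
  have "(\<lambda>p. f (snd p) (fst p)) \<in> borel_measurable (M \<Otimes>\<^sub>M count_space L)"
    by (rule measurable_compose_countable'[where I = L and f = "\<lambda>l p. f l (fst p)" and g = snd])
      (auto intro!: L measurable_compose[OF measurable_fst f])
  then show ?thesis
    by (intro borel_measurable_nn_integral) (simp add: case_prod_beta')
qed

lemma borel_measurable_group_diff [measurable (raw)]:
  fixes f k :: "'a \<Rightarrow> 'b::{second_countable_topology, topological_group_add}"
  assumes f: "f \<in> borel_measurable M" and k: "k \<in> borel_measurable M"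
  shows "(\<lambda>x. f x - k x) \<in> borel_measurable M"
  using f k by (rule borel_measurable_continuous_Pair) (intro continuous_intros)

lemma borel_measurable_group_uminus [measurable (raw)]:
  fixes f :: "'a \<Rightarrow> 'b::{second_countable_topology, topological_group_add}"
  assumes f: "f \<in> borel_measurable M"
  shows "(\<lambda>x. - f x) \<in> borel_measurable M"
  by (rule borel_measurable_continuous_on[OF _ f]) (intro continuous_intros)

text \<open>Nothing is assumed about \<open>f\<close>: its integral is a supremum over simple
  functions below \<open>f\<close>, and a sequence of these approaching the supremum has a
  measurable pointwise supremum that already attains it.\<close>

lemma nn_integral_eq_measurable_minorant:
  obtains s where "s \<in> borel_measurable M" "\<And>x. s x \<le> f x" "(\<integral>\<^sup>+x. s x \<partial>M) = (\<integral>\<^sup>+x. f x \<partial>M)"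
proof -
  let ?S = "{g. simple_function M g \<and> g \<le> f}"
  have "(\<lambda>_. 0) \<in> ?S" by (auto simp: le_fun_def)
  then have "?S \<noteq> {}" by blast
  from ennreal_SUP_countable_SUP[OF this, of "integral\<^sup>S M"]
  obtain F :: "nat \<Rightarrow> ennreal" where F: "range F \<subseteq> integral\<^sup>S M ` ?S" "Sup (integral\<^sup>S M ` ?S) = Sup (range F)"
    by blast
  have "\<exists>g. g \<in> ?S \<and> F i = integral\<^sup>S M g" for i
    using F(1) by blast
  then obtain g where g: "\<And>i. g i \<in> ?S" "\<And>i. F i = integral\<^sup>S M (g i)" by metis
  define s where "s x = (SUP i. g i x)" for x
  have [measurable]: "s \<in> borel_measurable M"
    unfolding s_def using g(1) by (intro borel_measurable_SUP) (auto intro: borel_measurable_simple_function)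
  have s_le: "s x \<le> f x" for x
    unfolding s_def using g(1) by (intro SUP_least) (auto simp: le_fun_def)
  have "(\<integral>\<^sup>+x. f x \<partial>M) = (SUP i. F i)"
    unfolding nn_integral_def F(2) ..
  also have "\<dots> \<le> (\<integral>\<^sup>+x. s x \<partial>M)"
  proof (rule SUP_least)
    fix i
    have "F i = (\<integral>\<^sup>+x. g i x \<partial>M)"
      using g by (simp add: nn_integral_eq_simple_integral)
    also have "\<dots> \<le> (\<integral>\<^sup>+x. s x \<partial>M)"
      unfolding s_def by (intro nn_integral_mono SUP_upper) simp
    finally show "F i \<le> (\<integral>\<^sup>+x. s x \<partial>M)" .
  qed
  finally have "(\<integral>\<^sup>+x. s x \<partial>M) = (\<integral>\<^sup>+x. f x \<partial>M)"
    using nn_integral_mono[of M s f] s_le by (intro antisym) auto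
  then show thesis using that[of s] s_le by auto
qed

text \<open>For a non-measurable integrand the Lebesgue integral is the lower integral. Complementary
  functions whose lower integrals add up to the total mass are therefore measurable up to a null set.\<close>

lemma complementary_imp_AE_measurable:
  assumes "finite_measure M"
    and sum: "\<And>x. x \<in> space M \<Longrightarrow> f x + h x = 1"
    and int: "(\<integral>\<^sup>+x. f x \<partial>M) + (\<integral>\<^sup>+x. h x \<partial>M) = emeasure M (space M)"
  obtains s where "s \<in> borel_measurable M" "AE x in M. f x = s x"
proof -
  interpret finite_measure M by fact
  obtain s where s [measurable]: "s \<in> borel_measurable M" and s_le: "\<And>x. s x \<le> f x"
    and s_int: "(\<integral>\<^sup>+x. s x \<partial>M) = (\<integral>\<^sup>+x. f x \<partial>M)"
    using nn_integral_eq_measurable_minorant by metis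
  obtain t where t [measurable]: "t \<in> borel_measurable M" and t_le: "\<And>x. t x \<le> h x"
    and t_int: "(\<integral>\<^sup>+x. t x \<partial>M) = (\<integral>\<^sup>+x. h x \<partial>M)"
    using nn_integral_eq_measurable_minorant by metis
  have le1: "s x + t x \<le> 1" if "x \<in> space M" for x
    using add_mono[OF s_le t_le, of x x] sum[OF that] by simp
  have st: "(\<integral>\<^sup>+x. s x + t x \<partial>M) = emeasure M (space M)"
    using int s_int t_int by (simp add: nn_integral_add)
  have "(\<integral>\<^sup>+x. 1 - (s x + t x) \<partial>M) = (\<integral>\<^sup>+x. 1 \<partial>M) - (\<integral>\<^sup>+x. s x + t x \<partial>M)"
    using le1 st emeasure_finite by (intro nn_integral_diff) auto
  also have "\<dots> = 0" using st by simp
  finally have "AE x in M. 1 - (s x + t x) = 0"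
    by (subst (asm) nn_integral_0_iff_AE) auto
  then have "AE x in M. f x = s x"
  proof (rule AE_mp, intro AE_I2 impI)
    fix x assume x: "x \<in> space M" and "1 - (s x + t x) = 0"
    then have eq: "s x + t x = 1"
      using le1[OF x] by (metis add.right_neutral diff_add_cancel_ennreal add.commute)
    have "t x \<noteq> \<top>" using eq by (metis ennreal_add_eq_top ennreal_one_neq_top)
    \<comment> \<open>Here \<open>f + t \<le> f + h = 1 = s + t\<close>; cancelling the finite value
      \<open>t x\<close> shows that the minorant \<open>s\<close> reaches \<open>f\<close> off the
      null set.\<close>
    have "f x + t x \<le> s x + t x"
      using add_left_mono[OF t_le[of x], of "f x"] sum[OF x] eq by simp
    then have "f x \<le> s x"
      using \<open>t x \<noteq> \<top>\<close> by (simp add: ennreal_add_left_cancel_le add.commute)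
    then show "f x = s x" using s_le[of x] by (intro antisym)
  qed
  then show thesis using that s by blast
qed

text \<open>Countably many basic open sets control measurability, so a single null set
  \<open>N\<close> absorbs all exceptions. \<open>M\<close> need not be complete; \<open>f\<close>
  itself may then fail to be measurable and is replaced by a constant on \<open>N\<close>.\<close>

lemma AE_eq_borel_measurable:
  fixes f :: "'a \<Rightarrow> 'b :: second_countable_topology"
  assumes ex: "\<And>B. B \<in> sets borel \<Longrightarrow> \<exists>P\<in>sets M. AE x in M. f x \<in> B \<longleftrightarrow> x \<in> P"
  obtains \<sigma> where "\<sigma> \<in> borel_measurable M" "AE x in M. f x = \<sigma> x"
proof -
  obtain \<B> :: "'b set set" where \<B>: "countable \<B>" "topological_basis \<B>"
    using ex_countable_basis by blast
  have "\<forall>b\<in>\<B>. \<exists>P\<in>sets M. AE x in M. f x \<in> b \<longleftrightarrow> x \<in> P"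
    using ex topological_basis_open[OF \<B>(2)] by (meson borel_open)
  then obtain P where P: "\<And>b. b \<in> \<B> \<Longrightarrow> P b \<in> sets M" "\<And>b. b \<in> \<B> \<Longrightarrow> AE x in M. f x \<in> b \<longleftrightarrow> x \<in> P b"
    by metis
  have "AE x in M. \<forall>b\<in>\<B>. f x \<in> b \<longleftrightarrow> x \<in> P b"
    using P(2) \<B>(1) by (simp add: AE_ball_countable)
  then obtain N where N: "{x \<in> space M. \<not> (\<forall>b\<in>\<B>. f x \<in> b \<longleftrightarrow> x \<in> P b)} \<subseteq> N" "emeasure M N = 0" "N \<in> sets M"
    by (rule AE_E)
  define \<sigma> where "\<sigma> x = (if x \<in> N then undefined else f x)" for x
  have "\<sigma> \<in> borel_measurable M"
  proof (rule borel_measurableI)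
    fix U :: "'b set" assume "open U"
    then obtain \<U> where \<U>: "\<U> \<subseteq> \<B>" "\<Union>\<U> = U"
      using \<B>(2) unfolding topological_basis_def by blast
    have "\<sigma> -` U \<inter> space M =
        (\<Union>b\<in>\<U>. P b - N) \<union> (if undefined \<in> U then N else {})"
    proof -
      have "P b \<subseteq> space M" if "b \<in> \<U>" for b
        using P(1)[of b] that \<U>(1) sets.sets_into_space by blast
      moreover have "f x \<in> U \<longleftrightarrow> (\<exists>b\<in>\<U>. x \<in> P b)" if "x \<in> space M" "x \<notin> N" for x
      proof -
        have "\<forall>b\<in>\<B>. f x \<in> b \<longleftrightarrow> x \<in> P b" using N(1) that by blast
        then show ?thesis using \<U> by blast
      qed
      moreover have "N \<subseteq> space M" using N(3) sets.sets_into_space by blast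
      ultimately show ?thesis
        unfolding \<sigma>_def by (auto split: if_split_asm) blast+
    qed
    also have "\<dots> \<in> sets M"
      using P(1) \<U>(1) N(3) countable_subset[OF \<U>(1) \<B>(1)]
      by (intro sets.Un sets.countable_UN') auto
    finally show "\<sigma> -` U \<inter> space M \<in> sets M" .
  qed
  moreover have "AE x in M. f x = \<sigma> x"
    using N by (intro AE_I'[of N]) (auto simp: \<sigma>_def null_sets_def)
  ultimately show thesis by (rule that)
qed

section \<open>Actions with a separated section\<close>

text \<open>Stated abstractly to be instantiated twice with the same \<open>m\<close>,
  \<open>L\<close> and \<open>idx\<close>: for \<open>Z\<close> in \<open>X\<close> and for
  \<open>Z^r\<close> in \<open>X^r\<close>. Hence \<open>L\<close> only has to contain the return
  times, and the action laws are required only on \<open>space S\<close>, since points of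
  \<open>X^r\<close> are extensional functions. By \<open>idx_inj\<close> the index separates the
  inverses of the hitting times of one point, which differ by elements of \<open>L\<close>.\<close>

locale section_action =
  fixes m :: "'g :: {topological_group_add, second_countable_topology, t2_space} measure"
    and S :: "'a measure" and act :: "'g \<Rightarrow> 'a \<Rightarrow> 'a" and W :: "'a set" and L :: "'g set"
    and idx :: "'g \<Rightarrow> nat"
  assumes sigma_finite_m: "sigma_finite_measure m"
    and sets_m [measurable_cong]: "sets m = sets borel"
    and left_inv: "\<And>g. distr m borel (\<lambda>h. g + h) = m"
    and right_inv: "\<And>g. distr m borel (\<lambda>h. h + g) = m"
    and act_measurable: "(\<lambda>p. act (fst p) (snd p)) \<in> borel \<Otimes>\<^sub>M S \<rightarrow>\<^sub>M S"
    and act_0: "\<And>y. y \<in> space S \<Longrightarrow> act 0 y = y"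
    and act_add: "\<And>g h y. y \<in> space S \<Longrightarrow> act (g + h) y = act g (act h y)"
    and W_sets [measurable]: "W \<in> sets S"
    and countable_L: "countable L"
    and uminus_L: "\<And>l. l \<in> L \<Longrightarrow> - l \<in> L"
    and return_L: "\<And>g w. w \<in> W \<Longrightarrow> act g w \<in> W \<Longrightarrow> g \<in> L"
    and idx_measurable [measurable]: "idx \<in> borel_measurable borel"
    and idx_inj: "\<And>a b. idx a = idx b \<Longrightarrow> - b + a \<in> L \<Longrightarrow> a = b"
begin

lemma measurable_act [measurable (raw)]:
  assumes "f \<in> M \<rightarrow>\<^sub>M borel" "k \<in> M \<rightarrow>\<^sub>M S"
  shows "(\<lambda>x. act (f x) (k x)) \<in> M \<rightarrow>\<^sub>M S"
  using measurable_compose[OF measurable_Pair[OF assms] act_measurable] by simp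

lemma space_m [simp]: "space m = UNIV"
  using sets_eq_imp_space_eq[OF sets_m] by simp

lemma act_space: "y \<in> space S \<Longrightarrow> act g y \<in> space S"
  using measurable_space[OF measurable_act[of "\<lambda>_. g" S "\<lambda>y. y"]] by simp

lemma W_space: "w \<in> W \<Longrightarrow> w \<in> space S"
  using sets.sets_into_space[OF W_sets] by auto

lemma act_minus: "y \<in> space S \<Longrightarrow> act (- g) (act g y) = y"
  and act_minus': "y \<in> space S \<Longrightarrow> act g (act (- g) y) = y"
  using act_add[of y "- g" g] act_add[of y g "- g"] by (simp_all add: act_0)

section \<open>Orbits, sums over hitting times and the fundamental domain\<close>

definition orbits :: "'a set" where
  "orbits = (\<Union>g. act g ` W)"

lemma orbits_space: "orbits \<subseteq> space S"
  using W_space act_space by (auto simp: orbits_def)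

lemma act_orbits: "y \<in> orbits \<Longrightarrow> act g y \<in> orbits"
  unfolding orbits_def using act_add[symmetric] W_space by (auto simp del: image_eqI) blast

lemma orbits_iff: "y \<in> space S \<Longrightarrow> y \<in> orbits \<longleftrightarrow> (\<exists>g. act g y \<in> W)"
proof
  assume y: "y \<in> space S"
  { assume "y \<in> orbits"
    then obtain g w where "w \<in> W" "y = act g w" by (auto simp: orbits_def)
    then have "act (- g) y \<in> W" using act_minus W_space by simp
    then show "\<exists>g. act g y \<in> W" by blast }
  { assume "\<exists>g. act g y \<in> W"
    then obtain g where "act g y \<in> W" by blast
    then have "act (- g) (act g y) \<in> orbits" by (auto simp: orbits_def)
    then show "y \<in> orbits" using act_minus[OF y] by simp }
qed

text \<open>The inner sum of the transverse measure formula: the points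
  \<open>(- g, act g y)\<close> with \<open>act g y \<in> W\<close> form the fibre of
  \<open>(g, w) \<mapsto> gw\<close> over \<open>y\<close>. Summing over the whole group with an
  indicator makes reindexing by group translations immediate.\<close>

definition periodization :: "('g \<times> 'a \<Rightarrow> ennreal) \<Rightarrow> 'a \<Rightarrow> ennreal" where
  "periodization f y = (\<integral>\<^sup>+g. f (- g, act g y) * indicator W (act g y) \<partial>count_space UNIV)"

lemma bij_add_right: "bij (\<lambda>h::'g. h + t)"
  by (rule o_bij[of "\<lambda>h. h - t"]) auto

lemma periodization_reindex:
  "periodization f y =
    (\<integral>\<^sup>+g. f (- (g + t), act (g + t) y) * indicator W (act (g + t) y) \<partial>count_space UNIV)"
  unfolding periodization_def
  by (rule nn_integral_bij_count_space[OF bij_add_right[of t], symmetric])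

text \<open>Any single \<open>t\<close> that locates the hitting times up to \<open>L\<close> turns
  the sum over the group into one over a countable index set. If \<open>t\<close> is chosen
  measurably in \<open>y\<close>, a measurable \<open>f\<close> then gives a measurable function of
  \<open>y\<close>.\<close>

lemma periodization_eq_countable_sum:
  assumes "\<And>h. act h y \<in> W \<Longrightarrow> h - t \<in> L"
  shows "periodization f y =
    (\<integral>\<^sup>+l. f (- (l + t), act (l + t) y) * indicator W (act (l + t) y) \<partial>count_space L)"
  unfolding periodization_reindex[of f y t]
proof (rule nn_integral_count_space_eq)
  fix l assume "l \<in> UNIV - L"
  then have "act (l + t) y \<notin> W" using assms[of "l + t"] by auto
  then show "f (- (l + t), act (l + t) y) * indicator W (act (l + t) y) = 0" by simp
qed simp

lemma periodization_act:
  assumes w: "w \<in> W"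
  shows "periodization f (act g w) =
    (\<integral>\<^sup>+l. f (g - l, act l w) * indicator W (act l w) \<partial>count_space L)"
proof -
  have *: "act (h - g) (act g w) = act h w" for h
    using act_add[of w "h - g" g] W_space[OF w] by simp
  have "h - (- g) \<in> L" if "act h (act g w) \<in> W" for h
    using that w act_add[of w h g] W_space[OF w] return_L[of w "h + g"] by simp
  from periodization_eq_countable_sum[OF this]
  have "periodization f (act g w) = (\<integral>\<^sup>+l. f (- (l + - g), act (l + - g) (act g w)) *
      indicator W (act (l + - g) (act g w)) \<partial>count_space L)" by simp
  also have "\<dots> = (\<integral>\<^sup>+l. f (g - l, act l w) * indicator W (act l w) \<partial>count_space L)"
    by (intro nn_integral_cong) (simp add: *)
  finally show ?thesis .
qed

text \<open>The points in the same fibre as \<open>(g, w)\<close> are the \<open>(g - l, lw)\<close>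
  that have \<open>lw\<close> in \<open>W\<close>; the one of least index is kept. Quantifying over
  the countable \<open>L\<close> makes the set measurable.\<close>

definition fundamental :: "('g \<times> 'a) set" where
  "fundamental = {p. snd p \<in> W \<and> (\<forall>l\<in>L. act l (snd p) \<in> W \<longrightarrow> idx (fst p) \<le> idx (fst p - l))}"

lemma fundamental_W: "p \<in> fundamental \<Longrightarrow> snd p \<in> W"
  by (simp add: fundamental_def)

lemma fundamental_sets [measurable]: "fundamental \<in> sets (borel \<Otimes>\<^sub>M S)"
proof -
  have "{p \<in> space (borel \<Otimes>\<^sub>M S). snd p \<in> W \<and>
      (\<forall>l\<in>L. act l (snd p) \<in> W \<longrightarrow> idx (fst p) \<le> idx (fst p - l))} \<in> sets (borel \<Otimes>\<^sub>M S)"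
  proof -
    have *: "Measurable.pred (borel \<Otimes>\<^sub>M S)
        (\<lambda>p. act l (snd p) \<in> W \<longrightarrow> idx (fst p) \<le> idx (fst p - l))" for l
      by measurable
    have [measurable]: "Measurable.pred (borel \<Otimes>\<^sub>M S)
        (\<lambda>p. \<forall>l\<in>L. act l (snd p) \<in> W \<longrightarrow> idx (fst p) \<le> idx (fst p - l))"
      unfolding pred_def by (intro sets.sets_Collect_countable_All' countable_L *[unfolded pred_def])
    have "Measurable.pred (borel \<Otimes>\<^sub>M S) (\<lambda>p. snd p \<in> W \<and>
        (\<forall>l\<in>L. act l (snd p) \<in> W \<longrightarrow> idx (fst p) \<le> idx (fst p - l)))"
      by measurable
    then show ?thesis
      by (simp add: pred_def)
  qed
  moreover have "fundamental \<subseteq> space (borel \<Otimes>\<^sub>M S)"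
    using W_space by (auto simp: fundamental_def space_pair_measure)
  ultimately show ?thesis
    unfolding fundamental_def by (auto simp: Int_absorb2 elim!: back_subst[of "\<lambda>A. A \<in> sets _"])
qed

lemma fundamental_iff:
  assumes y: "y \<in> space S" and h: "act h y \<in> W"
  shows "(- h, act h y) \<in> fundamental \<longleftrightarrow> (\<forall>k. act k y \<in> W \<longrightarrow> idx (- h) \<le> idx (- k))"
proof -
  have act_l: "act l (act h y) = act (l + h) y" for l using act_add[OF y] by simp
  have "(- h, act h y) \<in> fundamental \<longleftrightarrow>
      (\<forall>l\<in>L. act (l + h) y \<in> W \<longrightarrow> idx (- h) \<le> idx (- (l + h)))"
    using h by (simp add: fundamental_def act_l minus_add)
  also have "\<dots> \<longleftrightarrow> (\<forall>k. act k y \<in> W \<longrightarrow> idx (- h) \<le> idx (- k))"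
  proof (intro iffI allI ballI impI)
    fix k assume *: "\<forall>l\<in>L. act (l + h) y \<in> W \<longrightarrow> idx (- h) \<le> idx (- (l + h))" and k: "act k y \<in> W"
    have "k - h \<in> L" using return_L[OF h, of "k - h"] k act_l[of "k - h"] by simp
    then show "idx (- h) \<le> idx (- k)" using *[THEN bspec, of "k - h"] k by simp
  qed auto
  finally show ?thesis .
qed

text \<open>A least index exists because indices are natural numbers. It is attained only once
  because two hitting times of \<open>y\<close> differ by an element of \<open>L\<close>, where
  \<open>idx_inj\<close> applies.\<close>

lemma fundamental_ex1:
  assumes y: "y \<in> orbits"
  shows "\<exists>!h. act h y \<in> W \<and> (- h, act h y) \<in> fundamental"
proof -
  have yS: "y \<in> space S" using y orbits_space by auto
  have "\<exists>h. act h y \<in> W" using y orbits_iff[OF yS] by simp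
  then obtain h where h: "act h y \<in> W" "\<And>k. act k y \<in> W \<Longrightarrow> idx (- h) \<le> idx (- k)"
    using ex_has_least_nat[of "\<lambda>h. act h y \<in> W" _ "\<lambda>h. idx (- h)"] by blast
  show ?thesis
  proof (rule ex1I[of _ h])
    show "act h y \<in> W \<and> (- h, act h y) \<in> fundamental"
      using h fundamental_iff[OF yS h(1)] by blast
    fix k assume k: "act k y \<in> W \<and> (- k, act k y) \<in> fundamental"
    then have "idx (- k) = idx (- h)"
      using h fundamental_iff[OF yS, of k] by (intro antisym) auto
    moreover have "act (h - k) (act k y) = act h y" using act_add[OF yS, of "h - k" k] by simp
    then have "h - k \<in> L" using return_L[of "act k y" "h - k"] k h(1) by simp
    ultimately have "- k = - h" by (intro idx_inj) auto
    then show "k = h" by simp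
  qed
qed

definition rep :: "'a \<Rightarrow> 'g" where
  "rep y = (THE h. act h y \<in> W \<and> (- h, act h y) \<in> fundamental)"

lemma rep:
  assumes "y \<in> orbits"
  shows "act (rep y) y \<in> W" "(- rep y, act (rep y) y) \<in> fundamental"
    "act h y \<in> W \<Longrightarrow> (- h, act h y) \<in> fundamental \<Longrightarrow> h = rep y"
  using theI'[OF fundamental_ex1[OF assms]] fundamental_ex1[OF assms]
  unfolding rep_def[symmetric] by auto

lemma periodization_fundamental:
  assumes y: "y \<in> orbits"
  shows "periodization (\<lambda>p. indicator fundamental p * f p) y = f (- rep y, act (rep y) y)"
proof -
  have "periodization (\<lambda>p. indicator fundamental p * f p) y =
      (\<Sum>g\<in>{rep y}. indicator fundamental (- g, act g y) * f (- g, act g y) * indicator W (act g y))"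
    unfolding periodization_def
    by (rule nn_integral_count_space') (use rep(3)[OF y] in \<open>auto split: split_indicator\<close>)
  also have "\<dots> = f (- rep y, act (rep y) y)"
    using rep(1,2)[OF y] by simp
  finally show ?thesis .
qed

text \<open>Every function on the orbits is the periodization of its pullback cut to the fundamental
  domain; this is how a transverse measure determines the measure above it.\<close>

lemma periodization_fundamental':
  assumes "y \<in> orbits"
  shows "periodization (\<lambda>p. indicator fundamental p * k (act (fst p) (snd p))) y = k y"
  using periodization_fundamental[OF assms, of "\<lambda>p. k (act (fst p) (snd p))"]
    act_minus[of y "rep y"] orbits_space assms by auto

lemma periodization_indicator_fundamental:
  assumes "y \<in> orbits"
  shows "periodization (indicator fundamental) y = 1"
  using periodization_fundamental[OF assms, of "\<lambda>_. 1"] by simp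

text \<open>Invariance of \<open>N\<close> under the equivalence relation that the orbits cut out on
  \<open>W\<close>, expressed one partial map \<open>w \<mapsto> lw\<close> at a time; for
  \<open>l\<close> outside \<open>L\<close> both sets are empty. The property holds for transverse
  measures and passes to the power, which is why existence is derived from it.\<close>

definition partially_invariant :: "'a measure \<Rightarrow> bool" where
  "partially_invariant N \<longleftrightarrow> (\<forall>l. \<forall>A\<in>sets S. A \<subseteq> W \<longrightarrow>
     emeasure N {w \<in> W. act l w \<in> A} = emeasure N {w \<in> A. act (- l) w \<in> W})"

lemma return_set_sets [measurable]: "{w \<in> W. act l w \<in> A} \<in> sets S" if [measurable]: "A \<in> sets S"
proof -
  have "{w \<in> space S. w \<in> W \<and> act l w \<in> A} \<in> sets S" by measurable
  also have "{w \<in> space S. w \<in> W \<and> act l w \<in> A} = {w \<in> W. act l w \<in> A}"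
    using W_space by auto
  finally show ?thesis .
qed

lemma partially_invariant_nn_integral:
  assumes N: "partially_invariant N" and sets_N [measurable_cong]: "sets N = sets S"
    and [measurable]: "k \<in> borel_measurable S"
  shows "(\<integral>\<^sup>+w. k (act l w) * indicator {w \<in> W. act l w \<in> W} w \<partial>N) =
    (\<integral>\<^sup>+w. k w * indicator {w \<in> W. act (- l) w \<in> W} w \<partial>N)"
proof -
  define P where "P = {w \<in> W. act l w \<in> W}"
  define Q where "Q = {w \<in> W. act (- l) w \<in> W}"
  have [measurable]: "P \<in> sets S" "Q \<in> sets S" unfolding P_def Q_def by measurable
  have PN: "P \<in> sets N" "Q \<in> sets N" by (simp_all add: sets_N)
  have eq: "distr (density N (indicator P)) S (act l) = density N (indicator Q)"
  proof (rule measure_eqI)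
    fix A assume "A \<in> sets (distr (density N (indicator P)) S (act l))"
    then have A [measurable]: "A \<in> sets S" by simp
    have "emeasure (distr (density N (indicator P)) S (act l)) A =
        emeasure N (P \<inter> (act l -` A \<inter> space S))"
      using sets_eq_imp_space_eq[OF sets_N]
      by (subst emeasure_distr) (auto simp: PN emeasure_restricted sets_N)
    also have "P \<inter> (act l -` A \<inter> space S) = {w \<in> W. act l w \<in> A \<inter> W}"
      using W_space by (auto simp: P_def)
    also have "emeasure N \<dots> = emeasure N {w \<in> A \<inter> W. act (- l) w \<in> W}"
      using N[unfolded partially_invariant_def, rule_format, of "A \<inter> W" l] A by simp
    also have "{w \<in> A \<inter> W. act (- l) w \<in> W} = Q \<inter> A" by (auto simp: Q_def)
    also have "emeasure N (Q \<inter> A) = emeasure (density N (indicator Q)) A"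
      by (simp add: PN emeasure_restricted sets_N)
    finally show "emeasure (distr (density N (indicator P)) S (act l)) A =
      emeasure (density N (indicator Q)) A" .
  qed (simp add: sets_N)
  have "(\<integral>\<^sup>+w. k (act l w) * indicator P w \<partial>N) =
      (\<integral>\<^sup>+w. k w \<partial>distr (density N (indicator P)) S (act l))"
    by (subst nn_integral_distr) (auto simp: nn_integral_density mult.commute)
  also have "\<dots> = (\<integral>\<^sup>+w. k w * indicator Q w \<partial>N)"
    unfolding eq by (simp add: nn_integral_density mult.commute)
  finally show ?thesis unfolding P_def Q_def .
qed

text \<open>Expands the periodization along \<open>L\<close>, so that mass transport can be checked
  for each \<open>l\<close> separately; countability of \<open>L\<close> lets the sum leave both
  integrals.\<close>

lemma nn_integral_periodization_act:
  assumes N: "finite_measure N" and sets_N [measurable_cong]: "sets N = sets S"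
    and [measurable]: "f \<in> borel_measurable (borel \<Otimes>\<^sub>M S)" "k \<in> borel_measurable (borel \<Otimes>\<^sub>M S)"
  shows "(\<integral>\<^sup>+g. \<integral>\<^sup>+w. k (g, w) * (indicator W w * periodization f (act g w)) \<partial>N \<partial>m) =
    (\<integral>\<^sup>+l. (\<integral>\<^sup>+g. \<integral>\<^sup>+w. k (g, w) * f (g - l, act l w) * indicator {w \<in> W. act l w \<in> W} w \<partial>N \<partial>m)
      \<partial>count_space L)"
proof -
  interpret N: finite_measure N by fact
  have "(\<integral>\<^sup>+g. \<integral>\<^sup>+w. k (g, w) * (indicator W w * periodization f (act g w)) \<partial>N \<partial>m) =
      (\<integral>\<^sup>+g. \<integral>\<^sup>+w. \<integral>\<^sup>+l. k (g, w) * f (g - l, act l w) * indicator {w \<in> W. act l w \<in> W} w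
        \<partial>count_space L \<partial>N \<partial>m)"
  proof (intro nn_integral_cong)
    fix g w
    show "k (g, w) * (indicator W w * periodization f (act g w)) =
      (\<integral>\<^sup>+l. k (g, w) * f (g - l, act l w) * indicator {w \<in> W. act l w \<in> W} w \<partial>count_space L)"
    proof (cases "w \<in> W")
      case True
      then show ?thesis
        by (simp add: periodization_act nn_integral_cmult[symmetric] mult.assoc indicator_def
            cong: if_cong)
    qed (simp add: indicator_def)
  qed
  also have "\<dots> = (\<integral>\<^sup>+g. \<integral>\<^sup>+l. \<integral>\<^sup>+w. k (g, w) * f (g - l, act l w) *
      indicator {w \<in> W. act l w \<in> W} w \<partial>N \<partial>count_space L \<partial>m)"
    by (intro nn_integral_cong nn_integral_count_space_nn_integral countable_L) measurable
  also have "\<dots> = (\<integral>\<^sup>+l. \<integral>\<^sup>+g. \<integral>\<^sup>+w. k (g, w) * f (g - l, act l w) *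
      indicator {w \<in> W. act l w \<in> W} w \<partial>N \<partial>m \<partial>count_space L)"
    by (intro nn_integral_count_space_nn_integral countable_L) measurable
  finally show ?thesis .
qed

lemma nn_integral_add_right:
  assumes [measurable]: "h \<in> borel_measurable borel"
  shows "(\<integral>\<^sup>+g. h (g + l) \<partial>m) = (\<integral>\<^sup>+g. h g \<partial>m)"
proof -
  have "(\<integral>\<^sup>+g. h g \<partial>m) = (\<integral>\<^sup>+g. h g \<partial>distr m borel (\<lambda>h. h + l))"
    by (simp add: right_inv)
  then show ?thesis by (simp add: nn_integral_distr)
qed

lemma nn_integral_add_left:
  assumes [measurable]: "h \<in> borel_measurable borel"
  shows "(\<integral>\<^sup>+g. h (l + g) \<partial>m) = (\<integral>\<^sup>+g. h g \<partial>m)"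
proof -
  have "(\<integral>\<^sup>+g. h g \<partial>m) = (\<integral>\<^sup>+g. h g \<partial>distr m borel (\<lambda>h. l + h))"
    by (simp add: left_inv)
  then show ?thesis by (simp add: nn_integral_distr)
qed

text \<open>The mass transport principle for the orbit equivalence relation on \<open>G \<times> W\<close>; this is where
  unimodularity enters.\<close>

lemma mass_transport:
  assumes N: "finite_measure N" "partially_invariant N" and sets_N [measurable_cong]: "sets N = sets S"
    and [measurable]: "f \<in> borel_measurable (borel \<Otimes>\<^sub>M S)" "k \<in> borel_measurable (borel \<Otimes>\<^sub>M S)"
  shows "(\<integral>\<^sup>+g. \<integral>\<^sup>+w. k (g, w) * (indicator W w * periodization f (act g w)) \<partial>N \<partial>m) =
    (\<integral>\<^sup>+g. \<integral>\<^sup>+w. f (g, w) * (indicator W w * periodization k (act g w)) \<partial>N \<partial>m)"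
proof -
  interpret N: finite_measure N by fact
  define T where "T f k l = (\<integral>\<^sup>+g. \<integral>\<^sup>+w. k (g, w) * f (g - l, act l w) *
    indicator {w \<in> W. act l w \<in> W} w \<partial>N \<partial>m)" for f k :: "'g \<times> 'a \<Rightarrow> ennreal" and l
  \<comment> \<open>Substituting \<open>g + l\<close> for \<open>g\<close> uses right invariance of
    \<open>m\<close>; replacing \<open>act l w\<close> by \<open>w\<close> uses partial invariance
    of \<open>N\<close>. Together they exchange the roles of \<open>f\<close> and \<open>k\<close>
    and turn \<open>l\<close> into \<open>- l\<close>.\<close>
  have swap: "T f k l = T k f (- l)" for l
  proof -
    have "T f k l = (\<integral>\<^sup>+g. \<integral>\<^sup>+w. k (g + l, w) * f (g, act l w) *
        indicator {w \<in> W. act l w \<in> W} w \<partial>N \<partial>m)"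
      unfolding T_def by (subst nn_integral_add_right[symmetric, where l = l]) (simp_all, measurable)
    also have "\<dots> = (\<integral>\<^sup>+g. \<integral>\<^sup>+w. k (g + l, act (- l) (act l w)) * f (g, act l w) *
        indicator {w \<in> W. act l w \<in> W} w \<partial>N \<partial>m)"
      by (intro nn_integral_cong) (auto simp: act_minus W_space split: split_indicator)
    also have "\<dots> = (\<integral>\<^sup>+g. \<integral>\<^sup>+w. k (g + l, act (- l) w) * f (g, w) *
        indicator {w \<in> W. act (- l) w \<in> W} w \<partial>N \<partial>m)"
      by (intro nn_integral_cong
          partially_invariant_nn_integral[OF N(2) sets_N, where k = "\<lambda>w. k (_ + l, act (- l) w) * f (_, w)"])
        measurable
    also have "\<dots> = T k f (- l)"
      unfolding T_def by (simp add: mult.commute[of "f _"])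
    finally show ?thesis .
  qed
  have bij: "bij_betw uminus L L"
    by (rule bij_betw_byWitness[where f' = uminus]) (auto intro: uminus_L)
  have "(\<integral>\<^sup>+l. T f k l \<partial>count_space L) = (\<integral>\<^sup>+l. T k f l \<partial>count_space L)"
    unfolding swap by (rule nn_integral_bij_count_space[OF bij])
  then show ?thesis
    unfolding T_def using nn_integral_periodization_act[OF N(1) sets_N] by simp
qed

lemma act_W_orbits: "w \<in> W \<Longrightarrow> act g w \<in> orbits"
  by (auto simp: orbits_def)

text \<open>Mass transport with the indicator of the fundamental domain as \<open>k\<close>: its
  periodization is 1 on the orbits, so only \<open>f\<close> remains.\<close>

lemma nn_integral_fundamental_periodization:
  assumes N: "finite_measure N" "partially_invariant N" and sets_N [measurable_cong]: "sets N = sets S"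
    and [measurable]: "f \<in> borel_measurable (borel \<Otimes>\<^sub>M S)"
  shows "(\<integral>\<^sup>+g. \<integral>\<^sup>+w. indicator fundamental (g, w) * periodization f (act g w) \<partial>N \<partial>m) =
    (\<integral>\<^sup>+g. \<integral>\<^sup>+w. f (g, w) * indicator W w \<partial>N \<partial>m)"
proof -
  have "(\<integral>\<^sup>+g. \<integral>\<^sup>+w. indicator fundamental (g, w) * periodization f (act g w) \<partial>N \<partial>m) =
      (\<integral>\<^sup>+g. \<integral>\<^sup>+w. indicator fundamental (g, w) *
        (indicator W w * periodization f (act g w)) \<partial>N \<partial>m)"
    using fundamental_W by (intro nn_integral_cong) (force split: split_indicator)
  also have "\<dots> = (\<integral>\<^sup>+g. \<integral>\<^sup>+w. f (g, w) *
      (indicator W w * periodization (indicator fundamental) (act g w)) \<partial>N \<partial>m)"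
    by (intro mass_transport assms) measurable
  also have "\<dots> = (\<integral>\<^sup>+g. \<integral>\<^sup>+w. f (g, w) * indicator W w \<partial>N \<partial>m)"
    by (intro nn_integral_cong)
      (auto simp: periodization_indicator_fundamental act_W_orbits split: split_indicator)
  finally show ?thesis .
qed

section \<open>The induced measure on the orbit space, its transverse formula and uniqueness\<close>

definition induced_measure :: "'a measure \<Rightarrow> 'a measure" where
  "induced_measure N = distr (restrict_space (m \<Otimes>\<^sub>M N) fundamental) (restrict_space S orbits)
     (\<lambda>p. act (fst p) (snd p))"

lemma space_induced_measure [simp]: "space (induced_measure N) = orbits"
  using orbits_space by (auto simp: induced_measure_def space_restrict_space)

lemma sets_induced_measure [simp]: "sets (induced_measure N) = sets (restrict_space S orbits)"
  by (simp add: induced_measure_def)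

lemma act_fundamental_measurable:
  assumes sets_N [measurable_cong]: "sets N = sets S"
  shows "(\<lambda>p. act (fst p) (snd p)) \<in> restrict_space (m \<Otimes>\<^sub>M N) fundamental \<rightarrow>\<^sub>M restrict_space S orbits"
proof (rule measurable_restrict_space3)
  show "(\<lambda>p. act (fst p) (snd p)) \<in> m \<Otimes>\<^sub>M N \<rightarrow>\<^sub>M S" by measurable
  show "(\<lambda>p. act (fst p) (snd p)) \<in> fundamental \<rightarrow> orbits"
    using fundamental_W act_W_orbits by auto
qed

lemma nn_integral_induced_measure:
  assumes N: "finite_measure N" and sets_N [measurable_cong]: "sets N = sets S"
    and F: "F \<in> borel_measurable (restrict_space S orbits)"
  shows "(\<integral>\<^sup>+y. F y \<partial>induced_measure N) =
    (\<integral>\<^sup>+g. \<integral>\<^sup>+w. indicator fundamental (g, w) * F (act g w) \<partial>N \<partial>m)"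
proof -
  interpret N: finite_measure N by fact
  have D: "fundamental \<in> sets (m \<Otimes>\<^sub>M N)" by measurable
  then have D': "fundamental \<inter> space (m \<Otimes>\<^sub>M N) \<in> sets (m \<Otimes>\<^sub>M N)" by auto
  have "(\<lambda>p. F (act (fst p) (snd p))) \<in> borel_measurable (restrict_space (m \<Otimes>\<^sub>M N) fundamental)"
    by (rule measurable_compose[OF act_fundamental_measurable[OF sets_N] F])
  then have meas: "(\<lambda>p. F (act (fst p) (snd p)) * indicator fundamental p) \<in> borel_measurable (m \<Otimes>\<^sub>M N)"
    using borel_measurable_restrict_space_iff_ennreal[OF D'] by simp
  have "(\<integral>\<^sup>+y. F y \<partial>induced_measure N) =
      (\<integral>\<^sup>+p. F (act (fst p) (snd p)) * indicator fundamental p \<partial>(m \<Otimes>\<^sub>M N))"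
    unfolding induced_measure_def using F
    by (subst nn_integral_distr[OF act_fundamental_measurable[OF sets_N]])
      (simp_all add: nn_integral_restrict_space[OF D'])
  also have "\<dots> = (\<integral>\<^sup>+g. \<integral>\<^sup>+w. F (act g w) * indicator fundamental (g, w) \<partial>N \<partial>m)"
    by (subst N.nn_integral_fst[OF meas, symmetric]) simp
  finally show ?thesis by (simp add: mult.commute)
qed

text \<open>The transverse formula tested on sets only, with \<open>N\<close> living on all of
  \<open>S\<close> and cut down to \<open>W\<close>. The left integrand is not assumed measurable,
  so its integral may be merely a lower integral.\<close>

definition transversal :: "'a measure \<Rightarrow> 'a measure \<Rightarrow> bool" where
  "transversal M N \<longleftrightarrow> (\<forall>E\<in>sets (borel \<Otimes>\<^sub>M S).
     (\<integral>\<^sup>+y. periodization (indicator E) y \<partial>M) =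
     (\<integral>\<^sup>+g. \<integral>\<^sup>+w. indicator E (g, w) * indicator W w \<partial>N \<partial>m))"

text \<open>The orbit space need not be measurable, and periodizations are only known to be measurable
  where a measurable \<open>\<tau>\<close> locates the hitting times up to \<open>L\<close>.\<close>

lemma nn_integral_periodization_induced_measure:
  assumes N: "finite_measure N" "partially_invariant N" and sets_N [measurable_cong]: "sets N = sets S"
    and [measurable]: "\<tau> \<in> S \<rightarrow>\<^sub>M borel" and C [measurable]: "C \<in> sets S"
    and \<tau>: "\<And>y h. y \<in> C \<Longrightarrow> act h y \<in> W \<Longrightarrow> h - \<tau> y \<in> L"
    and AE: "AE g in m. AE w in N. w \<in> W \<longrightarrow> act g w \<in> C"
    and [measurable]: "f \<in> borel_measurable (borel \<Otimes>\<^sub>M S)"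
  shows "(\<integral>\<^sup>+y. periodization f y \<partial>induced_measure N) =
    (\<integral>\<^sup>+g. \<integral>\<^sup>+w. f (g, w) * indicator W w \<partial>N \<partial>m)"
proof -
  \<comment> \<open>A measurable stand-in for \<open>periodization f\<close>: the two agree on
    \<open>C\<close>, and \<open>orbits - C\<close> turns out to be null for the induced measure.
    The change of variables along the action is applied to \<open>F\<close>, as it asks for a
    measurable integrand.\<close>
  define F where "F y = (\<integral>\<^sup>+l. f (- (l + \<tau> y), act (l + \<tau> y) y) * indicator W (act (l + \<tau> y) y)
    \<partial>count_space L)" for y
  have [measurable]: "F \<in> borel_measurable S"
    unfolding F_def by (intro borel_measurable_nn_integral_count_space countable_L) measurable
  then have F': "F \<in> borel_measurable (restrict_space S orbits)"
    by (rule measurable_restrict_space1)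
  have F_eq: "periodization f y = F y" if "y \<in> C" for y
    unfolding F_def using \<tau>[OF that] by (rule periodization_eq_countable_sum)
  have Cs: "orbits - C \<in> sets (restrict_space S orbits)"
  proof -
    have "orbits \<inter> (space S - C) \<in> sets (restrict_space S orbits)"
      unfolding sets_restrict_space by (intro imageI) measurable
    also have "orbits \<inter> (space S - C) = orbits - C" using orbits_space by blast
    finally show ?thesis .
  qed
  have "emeasure (induced_measure N) (orbits - C) = (\<integral>\<^sup>+y. indicator (orbits - C) y \<partial>induced_measure N)"
    using Cs by simp
  also have "\<dots> = (\<integral>\<^sup>+g. \<integral>\<^sup>+w. indicator fundamental (g, w) * indicator (orbits - C) (act g w) \<partial>N \<partial>m)"
    using Cs by (intro nn_integral_induced_measure N sets_N) simp
  also have "\<dots> = (\<integral>\<^sup>+g. \<integral>\<^sup>+w. 0 \<partial>N \<partial>m)"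
  proof (intro nn_integral_cong_AE, use AE in eventually_elim, intro nn_integral_cong_AE,
      elim eventually_mono)
    fix g w assume "w \<in> W \<longrightarrow> act g w \<in> C"
    then show "indicator fundamental (g, w) * indicator (orbits - C) (act g w) = (0 :: ennreal)"
      using fundamental_W[of "(g, w)"] by (auto split: split_indicator)
  qed
  finally have "emeasure (induced_measure N) (orbits - C) = 0" by simp
  then have "AE y in induced_measure N. periodization f y = F y"
    using Cs by (intro AE_I[where N = "orbits - C"]) (auto simp: F_eq)
  then have "(\<integral>\<^sup>+y. periodization f y \<partial>induced_measure N) = (\<integral>\<^sup>+y. F y \<partial>induced_measure N)"
    by (rule nn_integral_cong_AE)
  also have "\<dots> = (\<integral>\<^sup>+g. \<integral>\<^sup>+w. indicator fundamental (g, w) * F (act g w) \<partial>N \<partial>m)"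
    by (intro nn_integral_induced_measure N sets_N F')
  also have "\<dots> = (\<integral>\<^sup>+g. \<integral>\<^sup>+w. indicator fundamental (g, w) * periodization f (act g w) \<partial>N \<partial>m)"
  proof (intro nn_integral_cong_AE, use AE in eventually_elim, intro nn_integral_cong_AE,
      elim eventually_mono)
    fix g w assume "w \<in> W \<longrightarrow> act g w \<in> C"
    then show "indicator fundamental (g, w) * F (act g w) =
        indicator fundamental (g, w) * periodization f (act g w)"
      using fundamental_W[of "(g, w)"] by (auto simp: F_eq split: split_indicator)
  qed
  also have "\<dots> = (\<integral>\<^sup>+g. \<integral>\<^sup>+w. f (g, w) * indicator W w \<partial>N \<partial>m)"
    by (intro nn_integral_fundamental_periodization N sets_N) measurable
  finally show ?thesis .
qed

text \<open>The formula is applied to the part \<open>E\<close> of the fundamental domain that the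
  action carries into \<open>A\<close>; its periodization is the indicator of \<open>A\<close> on
  the orbits. The resulting right-hand side does not involve \<open>M\<close>, whence
  uniqueness.\<close>

lemma transversal_emeasure:
  assumes M: "transversal M N" and sets_M: "sets M = sets (restrict_space S orbits)"
    and A: "A \<in> sets S"
  shows "emeasure M (A \<inter> orbits) =
    (\<integral>\<^sup>+g. \<integral>\<^sup>+w. indicator fundamental (g, w) * indicator A (act g w) \<partial>N \<partial>m)"
proof -
  have space_M: "space M = orbits"
    using sets_eq_imp_space_eq[OF sets_M] orbits_space by (auto simp: space_restrict_space)
  define E where "E = {p \<in> space (borel \<Otimes>\<^sub>M S). p \<in> fundamental \<and> act (fst p) (snd p) \<in> A}"
  have E: "E \<in> sets (borel \<Otimes>\<^sub>M S)" unfolding E_def using A by measurable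
  have fund_space: "p \<in> fundamental \<Longrightarrow> p \<in> space (borel \<Otimes>\<^sub>M S)" for p
    using sets.sets_into_space[OF fundamental_sets] by auto
  have ind: "indicator E = (\<lambda>p. indicator fundamental p * indicator A (act (fst p) (snd p)) :: ennreal)"
    using fund_space by (auto simp: E_def fun_eq_iff split: split_indicator)
  have "emeasure M (A \<inter> orbits) = (\<integral>\<^sup>+y. indicator (A \<inter> orbits) y \<partial>M)"
    using A sets_M by (subst nn_integral_indicator) (auto simp: sets_restrict_space)
  also have "\<dots> = (\<integral>\<^sup>+y. periodization (indicator E) y \<partial>M)"
    unfolding ind
    by (intro nn_integral_cong) (auto simp: space_M periodization_fundamental' split: split_indicator)
  also have "\<dots> = (\<integral>\<^sup>+g. \<integral>\<^sup>+w. indicator E (g, w) * indicator W w \<partial>N \<partial>m)"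
    using M E by (simp add: transversal_def)
  also have "\<dots> = (\<integral>\<^sup>+g. \<integral>\<^sup>+w. indicator fundamental (g, w) * indicator A (act g w) \<partial>N \<partial>m)"
    unfolding ind using fundamental_W by (intro nn_integral_cong) (force split: split_indicator)
  finally show ?thesis .
qed

lemma transversal_unique:
  assumes "transversal M N" "sets M = sets (restrict_space S orbits)"
    and "transversal M' N" "sets M' = sets (restrict_space S orbits)"
  shows "M = M'"
proof (rule measure_eqI)
  fix A assume "A \<in> sets M"
  then obtain B where "B \<in> sets S" "A = B \<inter> orbits"
    using assms(2) by (auto simp: sets_restrict_space)
  then show "emeasure M A = emeasure M' A"
    using transversal_emeasure[of M N B] transversal_emeasure[of M' N B] assms by simp
qed (use assms in simp)

lemma act_measurable_orbits: "act g \<in> restrict_space S orbits \<rightarrow>\<^sub>M restrict_space S orbits"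
  by (rule measurable_restrict_space3) (auto intro: act_orbits)

text \<open>The fundamental domain shifted on the left by \<open>h\<close> again meets every fibre
  once. Computing the mass of \<open>A\<close> with the shifted domain (the set \<open>E\<close>)
  and shifting back by left invariance of \<open>m\<close> gives the mass of the preimage of
  \<open>A\<close> under \<open>act h\<close>, computed with the original domain.\<close>

lemma transversal_invariant:
  assumes M: "transversal M N" and sets_M: "sets M = sets (restrict_space S orbits)"
    and N: "finite_measure N" and sets_N [measurable_cong]: "sets N = sets S"
  shows "invariant_measure act M"
  unfolding invariant_measure_def
proof (intro allI conjI)
  interpret N: finite_measure N by fact
  fix h
  have space_M: "space M = orbits"
    using sets_eq_imp_space_eq[OF sets_M] orbits_space by (auto simp: space_restrict_space)
  show act_M: "act h \<in> M \<rightarrow>\<^sub>M M"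
    using act_measurable_orbits by (simp cong: measurable_cong_sets add: sets_M)
  show "distr M M (act h) = M"
  proof (rule measure_eqI)
    fix A assume "A \<in> sets (distr M M (act h))"
    then have AM: "A \<in> sets M" by simp
    then obtain B where B [measurable]: "B \<in> sets S" and AB: "A = B \<inter> orbits"
      using sets_M by (auto simp: sets_restrict_space)
    define B' where "B' = act h -` B \<inter> space S"
    have B' [measurable]: "B' \<in> sets S" unfolding B'_def by measurable
    have act_h: "act (h + g) w \<in> B \<longleftrightarrow> act g w \<in> B'" if "w \<in> W" for g w
      using act_space[of w g] W_space[OF that] by (simp add: B'_def act_add)
    define E where "E = {p \<in> space (borel \<Otimes>\<^sub>M S). (- h + fst p, snd p) \<in> fundamental \<and> act (fst p) (snd p) \<in> B}"
    have E [measurable]: "E \<in> sets (borel \<Otimes>\<^sub>M S)" unfolding E_def by measurable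
    have ind: "indicator E p = (indicator fundamental (- h + fst p, snd p) * indicator B (act (fst p) (snd p)) :: ennreal)"
      for p
      using fundamental_W[of "(- h + fst p, snd p)"] W_space
      by (auto simp: E_def space_pair_measure mem_Times_iff split: split_indicator)
    have per: "periodization (indicator E) y = indicator A y" if y: "y \<in> orbits" for y
    proof -
      define z where "z = act (- h) y"
      have yS: "y \<in> space S" and z: "z \<in> orbits"
        using y orbits_space act_orbits by (auto simp: z_def)
      have act_z: "act (g + h) z = act g y" for g
        using act_add[of z g h] orbits_space z act_minus'[OF yS] by (auto simp: z_def)
      have "periodization (indicator E) y =
          (\<integral>\<^sup>+g. indicator B y * (indicator fundamental (- (g + h), act (g + h) z) *
            indicator W (act (g + h) z)) \<partial>count_space UNIV)"
        unfolding periodization_def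
        by (intro nn_integral_cong) (simp add: ind act_z minus_add act_minus[OF yS] mult_ac)
      also have "\<dots> = indicator B y * periodization (indicator fundamental) z"
        by (subst periodization_reindex[where t = h]) (simp add: nn_integral_cmult)
      also have "\<dots> = indicator A y"
        using y by (simp add: periodization_indicator_fundamental[OF z] AB indicator_def)
      finally show ?thesis .
    qed
    have "emeasure M A = (\<integral>\<^sup>+y. periodization (indicator E) y \<partial>M)"
      using per nn_integral_indicator[OF AM] by (simp add: space_M cong: nn_integral_cong_simp)
    also have "\<dots> = (\<integral>\<^sup>+g. \<integral>\<^sup>+w. indicator E (g, w) * indicator W w \<partial>N \<partial>m)"
      using M E by (simp add: transversal_def)
    also have "\<dots> = (\<integral>\<^sup>+g. \<integral>\<^sup>+w. indicator E (h + g, w) * indicator W w \<partial>N \<partial>m)"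
      by (rule nn_integral_add_left[symmetric]) measurable
    also have "\<dots> = (\<integral>\<^sup>+g. \<integral>\<^sup>+w. indicator fundamental (g, w) * indicator B' (act g w) \<partial>N \<partial>m)"
      using fundamental_W act_h by (intro nn_integral_cong) (force simp: ind split: split_indicator)
    also have "\<dots> = emeasure M (B' \<inter> orbits)"
      using transversal_emeasure[OF M sets_M B'] by simp
    also have "B' \<inter> orbits = act h -` A \<inter> space M"
      using orbits_space act_orbits by (auto simp: B'_def AB space_M)
    also have "emeasure M \<dots> = emeasure (distr M M (act h)) A"
      using AM act_M by (simp add: emeasure_distr)
    finally show "emeasure (distr M M (act h)) A = emeasure M A" by simp
  qed simp
qed

section \<open>Consequences of the formula: partial invariance, null sets, almost measurable hitting
  times\<close>

lemma translate_right_sets [measurable]: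
  assumes "V \<in> sets borel" shows "(\<lambda>a. a - l) -` V \<in> sets (borel :: 'g measure)"
  using measurable_sets_borel[OF _ assms, of "\<lambda>a. a - l"] by simp

lemma emeasure_translate_right:
  assumes "V \<in> sets borel" shows "emeasure m ((\<lambda>a. a - l) -` V) = emeasure m V"
proof -
  have "emeasure m ((\<lambda>a. a - l) -` V) = emeasure (distr m borel (\<lambda>h. h + l)) ((\<lambda>a. a - l) -` V)"
    by (simp add: right_inv)
  also have "\<dots> = emeasure m V"
    using translate_right_sets[OF assms] by (subst emeasure_distr) (auto simp: vimage_def)
  finally show ?thesis .
qed

text \<open>The map \<open>(a, w) \<mapsto> (a - l, lw)\<close> carries \<open>V' \<times> B\<close>
  onto \<open>V \<times> A'\<close> and stays within each fibre, so both sets have the same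
  periodization. \<open>V'\<close> is a right translate of \<open>V\<close> and has the same
  measure, a factor that cancels because it is neither zero nor infinite.\<close>

lemma transversal_partially_invariant:
  assumes M: "transversal M N" and space_M: "space M \<subseteq> space S"
    and N: "finite_measure N" and sets_N [measurable_cong]: "sets N = sets S"
    and V [measurable]: "V \<in> sets borel" "emeasure m V \<noteq> 0" "emeasure m V \<noteq> \<infinity>"
  shows "partially_invariant N"
  unfolding partially_invariant_def
proof (intro allI ballI impI)
  interpret N: finite_measure N by fact
  fix l A assume A [measurable]: "A \<in> sets S" and AW: "A \<subseteq> W"
  define A' where "A' = {w \<in> A. act (- l) w \<in> W}"
  define B where "B = {w \<in> W. act l w \<in> A}"
  have "A' = A \<inter> {w \<in> W. act (- l) w \<in> W}" using AW by (auto simp: A'_def)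
  then have A' [measurable]: "A' \<in> sets S" and "A' \<subseteq> W" by auto
  have B [measurable]: "B \<in> sets S" unfolding B_def by measurable
  have "B \<subseteq> W" by (auto simp: B_def)
  define V' where "V' = (\<lambda>a. a - l) -` V"
  have V' [measurable]: "V' \<in> sets borel"
    unfolding V'_def by measurable
  have int: "(\<integral>\<^sup>+g. \<integral>\<^sup>+w. indicator (C \<times> D) (g, w) * indicator W w \<partial>N \<partial>m) = emeasure m C * emeasure N D"
    if [measurable]: "C \<in> sets borel" "D \<in> sets S" and "D \<subseteq> W" for C D
  proof -
    have "(\<integral>\<^sup>+g. \<integral>\<^sup>+w. indicator (C \<times> D) (g, w) * indicator W w \<partial>N \<partial>m) =
        (\<integral>\<^sup>+g. \<integral>\<^sup>+w. indicator C g * indicator D w \<partial>N \<partial>m)"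
      using \<open>D \<subseteq> W\<close> by (intro nn_integral_cong) (auto split: split_indicator)
    also have "\<dots> = emeasure m C * emeasure N D"
      by (simp add: nn_integral_cmult nn_integral_multc sets_N sets_m)
    finally show ?thesis .
  qed
  have mV': "emeasure m V' = emeasure m V"
    unfolding V'_def by (rule emeasure_translate_right) (rule V(1))
  have "emeasure m V * emeasure N A' = (\<integral>\<^sup>+y. periodization (indicator (V \<times> A')) y \<partial>M)"
    using M int[of V A'] \<open>A' \<subseteq> W\<close> by (simp add: transversal_def)
  also have "\<dots> = (\<integral>\<^sup>+y. periodization (indicator (V' \<times> B)) y \<partial>M)"
  proof (rule nn_integral_cong)
    fix y assume "y \<in> space M"
    then have y: "y \<in> space S" using space_M by auto
    have bij: "bij (\<lambda>g::'g. l + g)"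
      by (rule o_bij[of "\<lambda>g. - l + g"]) auto
    have "periodization (indicator (V \<times> A')) y = (\<integral>\<^sup>+g. indicator (V \<times> A') (- (l + g), act (l + g) y) *
        indicator W (act (l + g) y) \<partial>count_space UNIV)"
      unfolding periodization_def by (rule nn_integral_bij_count_space[OF bij, symmetric])
    also have "\<dots> = periodization (indicator (V' \<times> B)) y"
      unfolding periodization_def
    proof (rule nn_integral_cong)
      fix g
      have u: "act g y \<in> space S" using act_space[OF y] .
      have "act (l + g) y \<in> A' \<longleftrightarrow> act g y \<in> B"
        using AW by (auto simp: A'_def B_def act_add[OF y] act_minus[OF u])
      moreover have "- (l + g) \<in> V \<longleftrightarrow> - g \<in> V'" by (simp add: V'_def minus_add)
      ultimately show "(indicator (V \<times> A') (- (l + g), act (l + g) y) * indicator W (act (l + g) y) :: ennreal) =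
          indicator (V' \<times> B) (- g, act g y) * indicator W (act g y)"
        using AW by (auto simp: A'_def B_def split: split_indicator)
    qed
    finally show "periodization (indicator (V \<times> A')) y = periodization (indicator (V' \<times> B)) y" .
  qed
  also have "\<dots> = emeasure m V' * emeasure N B"
    using M int[of V' B] \<open>B \<subseteq> W\<close> by (simp add: transversal_def)
  finally show "emeasure N B = emeasure N A'"
    unfolding mV' using V(2,3) by (simp add: ennreal_mult_cancel_left)
qed

text \<open>The set \<open>E\<close> of pairs that the action carries into \<open>A\<close> has no
  point in the fibre over a \<open>y\<close> outside \<open>A\<close>. The left side of the formula
  for \<open>E\<close> therefore vanishes, and so does the right.\<close>

lemma transversal_null:
  assumes M: "transversal M N" and space_M: "space M \<subseteq> space S"
    and N: "finite_measure N" and sets_N [measurable_cong]: "sets N = sets S"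
    and A [measurable]: "A \<in> sets S" and null: "AE y in M. y \<notin> A"
  shows "AE g in m. AE w in N. w \<in> W \<longrightarrow> act g w \<notin> A"
proof -
  interpret N: finite_measure N by fact
  define E where "E = {p \<in> space (borel \<Otimes>\<^sub>M S). act (fst p) (snd p) \<in> A}"
  have E [measurable]: "E \<in> sets (borel \<Otimes>\<^sub>M S)" unfolding E_def by measurable
  have "AE y in M. periodization (indicator E) y = 0"
    using null
  proof (rule AE_mp, intro AE_I2 impI)
    fix y assume "y \<in> space M" "y \<notin> A"
    then have "(- g, act g y) \<notin> E" for g
      using space_M by (auto simp: E_def act_minus)
    then show "periodization (indicator E) y = 0"
      by (simp add: periodization_def)
  qed
  then have "(\<integral>\<^sup>+y. periodization (indicator E) y \<partial>M) = (\<integral>\<^sup>+y. 0 \<partial>M)"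
    by (rule nn_integral_cong_AE)
  then have "(\<integral>\<^sup>+g. \<integral>\<^sup>+w. indicator E (g, w) * indicator W w \<partial>N \<partial>m) = 0"
    using M E by (simp add: transversal_def)
  then have "AE g in m. (\<integral>\<^sup>+w. indicator E (g, w) * indicator W w \<partial>N) = 0"
    by (subst (asm) nn_integral_0_iff_AE) measurable
  then show ?thesis
  proof eventually_elim
    fix g assume "(\<integral>\<^sup>+w. indicator E (g, w) * indicator W w \<partial>N) = 0"
    then have "AE w in N. (indicator E (g, w) * indicator W w :: ennreal) = 0"
      by (subst (asm) nn_integral_0_iff_AE) measurable
    then show "AE w in N. w \<in> W \<longrightarrow> act g w \<notin> A"
      by eventually_elim (use W_space in \<open>auto simp: E_def space_pair_measure split: split_indicator_asm\<close>)
  qed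
qed

text \<open>\<open>rep\<close> selects a minimum over all hitting times, so its measurability cannot
  be read off. Cutting the fundamental domain by \<open>- g \<in> B\<close> and
  \<open>- g \<notin> B\<close> gives two sets with complementary periodizations; the formula turns
  their lower integrals into integrals against \<open>m\<close> and \<open>N\<close>, where
  everything is measurable and additivity holds.\<close>

lemma rep_AE_measurable:
  assumes M: "transversal M N" and fin: "finite_measure M" and space_M: "space M \<subseteq> orbits"
    and N: "finite_measure N" and sets_N [measurable_cong]: "sets N = sets S"
  obtains \<sigma> where "\<sigma> \<in> borel_measurable M" "AE y in M. rep y = \<sigma> y"
proof -
  interpret N: finite_measure N by fact
  have "\<exists>P\<in>sets M. AE y in M. rep y \<in> B \<longleftrightarrow> y \<in> P" if B: "B \<in> sets borel" for B
  proof -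
    define D where "D C = {p \<in> space (borel \<Otimes>\<^sub>M S). p \<in> fundamental \<and> - fst p \<in> C}" for C
    have D [measurable]: "D C \<in> sets (borel \<Otimes>\<^sub>M S)" if [measurable]: "C \<in> sets borel" for C
      unfolding D_def by measurable
    have indD: "indicator (D C) = (\<lambda>p. indicator fundamental p * indicator C (- fst p) :: ennreal)" for C
      using sets.sets_into_space[OF fundamental_sets]
      by (auto simp: D_def fun_eq_iff split: split_indicator)
    have per: "periodization (indicator (D C)) y = indicator C (rep y)" if "y \<in> space M" for y C
      using that space_M unfolding indD by (subst periodization_fundamental) auto
    have tr: "(\<integral>\<^sup>+y. periodization (indicator (D C)) y \<partial>M) =
        (\<integral>\<^sup>+g. \<integral>\<^sup>+w. indicator (D C) (g, w) \<partial>N \<partial>m)" if "C \<in> sets borel" for C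
    proof -
      have "(\<integral>\<^sup>+y. periodization (indicator (D C)) y \<partial>M) =
          (\<integral>\<^sup>+g. \<integral>\<^sup>+w. indicator (D C) (g, w) * indicator W w \<partial>N \<partial>m)"
        using M D[OF that] by (simp add: transversal_def)
      also have "\<dots> = (\<integral>\<^sup>+g. \<integral>\<^sup>+w. indicator (D C) (g, w) \<partial>N \<partial>m)"
        using fundamental_W by (intro nn_integral_cong) (force simp: D_def split: split_indicator)
      finally show ?thesis .
    qed
    have B' [measurable]: "B \<in> sets borel" "- B \<in> sets borel" "UNIV \<in> sets (borel :: 'g measure)"
      using B by auto
    have "(\<integral>\<^sup>+y. periodization (indicator (D B)) y \<partial>M) + (\<integral>\<^sup>+y. periodization (indicator (D (- B))) y \<partial>M) =
        (\<integral>\<^sup>+g. (\<integral>\<^sup>+w. indicator (D B) (g, w) \<partial>N) + (\<integral>\<^sup>+w. indicator (D (- B)) (g, w) \<partial>N) \<partial>m)"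
      unfolding tr[OF B'(1)] tr[OF B'(2)] by (rule nn_integral_add[symmetric]) measurable
    also have "\<dots> = (\<integral>\<^sup>+g. \<integral>\<^sup>+w. indicator (D B) (g, w) + indicator (D (- B)) (g, w) \<partial>N \<partial>m)"
      by (intro nn_integral_cong nn_integral_add[symmetric]) measurable
    also have "\<dots> = (\<integral>\<^sup>+g. \<integral>\<^sup>+w. indicator (D UNIV) (g, w) \<partial>N \<partial>m)"
      by (intro nn_integral_cong) (auto simp: indD split: split_indicator)
    also have "\<dots> = (\<integral>\<^sup>+y. 1 \<partial>M)"
      unfolding tr[OF B'(3), symmetric] by (intro nn_integral_cong) (simp add: per)
    finally have sum: "(\<integral>\<^sup>+y. periodization (indicator (D B)) y \<partial>M) +
      (\<integral>\<^sup>+y. periodization (indicator (D (- B))) y \<partial>M) = emeasure M (space M)"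
      by simp
    have "periodization (indicator (D B)) y + periodization (indicator (D (- B))) y = 1" if "y \<in> space M" for y
      using that by (auto simp: per split: split_indicator)
    then obtain s where s [measurable]: "s \<in> borel_measurable M" and
      s_eq: "AE y in M. periodization (indicator (D B)) y = s y"
      by (rule complementary_imp_AE_measurable[OF fin _ sum])
    have "{y \<in> space M. s y = 1} \<in> sets M" by measurable
    moreover have "AE y in M. rep y \<in> B \<longleftrightarrow> y \<in> {y \<in> space M. s y = 1}"
      using s_eq by (rule AE_mp) (intro AE_I2 impI, auto simp: per split: split_indicator_asm)
    ultimately show ?thesis by blast
  qed
  then show thesis
    by (rule AE_eq_borel_measurable[of M rep]) (assumption, rule that)
qed

section \<open>Finiteness through the saturated section\<close>

text \<open>When \<open>lam\<close> enumerates \<open>L\<close>, the images of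
  \<open>layer lam n\<close> under \<open>act (lam n)\<close> partition the saturation of
  \<open>W\<close>: \<open>n\<close> is the first index for which \<open>- lam n\<close> brings the
  point back to \<open>W\<close>. Recording the pieces by their preimages in \<open>W\<close> lets
  \<open>N\<close> measure them.\<close>

definition layer :: "(nat \<Rightarrow> 'g) \<Rightarrow> nat \<Rightarrow> 'a set" where
  "layer lam n = {w \<in> W. \<forall>i<n. act (- lam i) (act (lam n) w) \<notin> W}"

lemma layer_W: "layer lam n \<subseteq> W"
  by (auto simp: layer_def)

lemma layer_sets [measurable]: "layer lam n \<in> sets S"
proof -
  have [measurable]: "Measurable.pred S (\<lambda>w. act (- lam i) (act (lam n) w) \<in> W)" for i
    by measurable
  have "{w \<in> space S. w \<in> W \<and> (\<forall>i. i < n \<longrightarrow> act (- lam i) (act (lam n) w) \<notin> W)} \<in> sets S"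
    by measurable
  also have "{w \<in> space S. w \<in> W \<and> (\<forall>i. i < n \<longrightarrow> act (- lam i) (act (lam n) w) \<notin> W)} = layer lam n"
    using W_space by (auto simp: layer_def)
  finally show ?thesis .
qed

lemma layer_unique:
  assumes "y \<in> space S" "act (- lam n) y \<in> layer lam n" "act (- lam k) y \<in> layer lam k"
  shows "n = k"
proof -
  have False if "i < j" "act (- lam i) y \<in> layer lam i" "act (- lam j) y \<in> layer lam j" for i j
    using that act_minus'[OF assms(1), of "lam j"] by (auto simp: layer_def)
  then show ?thesis using assms by (cases n k rule: linorder_cases) auto
qed

lemma layer_exists:
  assumes y: "y \<in> space S" and k: "act (- lam k) y \<in> W"
  shows "\<exists>n. act (- lam n) y \<in> layer lam n"
proof -
  define n where "n = (LEAST n. act (- lam n) y \<in> W)"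
  have "act (- lam n) y \<in> W" unfolding n_def by (rule LeastI[of _ k]) (rule k)
  moreover have "act (- lam i) y \<notin> W" if "i < n" for i
    using not_less_Least[of i "\<lambda>n. act (- lam n) y \<in> W"] that by (auto simp: n_def)
  ultimately have "act (- lam n) y \<in> layer lam n"
    by (auto simp: layer_def act_minus'[OF y])
  then show ?thesis ..
qed

lemma nn_integral_indicator_section:
  assumes N: "finite_measure N" and sets_N [measurable_cong]: "sets N = sets S"
    and E [measurable]: "E \<in> sets (borel \<Otimes>\<^sub>M S)" and W: "\<And>p. p \<in> E \<Longrightarrow> snd p \<in> W"
  shows "(\<integral>\<^sup>+g. \<integral>\<^sup>+w. indicator E (g, w) * indicator W w \<partial>N \<partial>m) = emeasure (m \<Otimes>\<^sub>M N) E"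
proof -
  interpret N: finite_measure N by fact
  have "emeasure (m \<Otimes>\<^sub>M N) E = (\<integral>\<^sup>+g. \<integral>\<^sup>+w. indicator E (g, w) \<partial>N \<partial>m)"
    by (rule N.emeasure_pair_measure) measurable
  also have "\<dots> = (\<integral>\<^sup>+g. \<integral>\<^sup>+w. indicator E (g, w) * indicator W w \<partial>N \<partial>m)"
    using W by (intro nn_integral_cong) (force split: split_indicator)
  finally show ?thesis ..
qed

text \<open>Writing \<open>- h = k + l\<close> for a hitting time \<open>h\<close> of
  \<open>y\<close> gives \<open>y = ku\<close> with \<open>u\<close> in the saturated section, and
  \<open>u\<close> comes from some layer. So the union of the sets \<open>E n\<close> has
  periodization at least 1, and right invariance gives each \<open>E n\<close> the measure of
  \<open>K\<close> times that of its layer.\<close>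

lemma transversal_mass_le:
  assumes M: "transversal M N" and space_M: "space M \<subseteq> orbits"
    and N: "finite_measure N" and sets_N [measurable_cong]: "sets N = sets S"
    and lam: "L \<subseteq> range lam" and K [measurable]: "K \<in> sets borel"
    and cover: "\<And>g. \<exists>k\<in>K. \<exists>l\<in>L. g = k + l"
  shows "emeasure M (space M) \<le> emeasure m K * (\<Sum>n. emeasure N (layer lam n))"
proof -
  interpret N: finite_measure N by fact
  define E where "E n = ((\<lambda>a. a - lam n) -` K) \<times> layer lam n" for n
  have E [measurable]: "E n \<in> sets (borel \<Otimes>\<^sub>M S)" for n
    unfolding E_def by measurable
  have "emeasure M (space M) = (\<integral>\<^sup>+y. 1 \<partial>M)" by simp
  also have "\<dots> \<le> (\<integral>\<^sup>+y. periodization (indicator (\<Union>n. E n)) y \<partial>M)"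
  proof (intro nn_integral_mono)
    fix y assume "y \<in> space M"
    then have yO: "y \<in> orbits" and y: "y \<in> space S" using space_M orbits_space by auto
    obtain h where h: "act h y \<in> W" using yO orbits_iff[OF y] by auto
    obtain k l where kl: "k \<in> K" "l \<in> L" "- h = k + l" using cover by blast
    have hkl: "h = - l - k"
      using kl(3) by (metis minus_add minus_minus diff_conv_add_uminus)
    define u where "u = act (- k) y"
    have u: "u \<in> space S" unfolding u_def by (rule act_space[OF y])
    have "act (- l) u \<in> W" using h unfolding u_def hkl
      by (simp add: act_add[OF y, symmetric] diff_conv_add_uminus del: add_uminus_conv_diff)
    moreover obtain j where "l = lam j" using lam kl(2) by auto
    ultimately obtain n where n: "act (- lam n) u \<in> layer lam n"
      using layer_exists[OF u] by blast
    define g where "g = - lam n + - k"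
    have g: "act g y \<in> layer lam n"
      using n unfolding g_def u_def by (simp add: act_add[OF y] del: add_uminus_conv_diff)
    have "- g - lam n = k"
      unfolding g_def by (simp add: minus_add del: add_uminus_conv_diff)
    then have "(- g, act g y) \<in> E n" using g kl(1) by (simp add: E_def)
    then have "1 = (indicator (\<Union>n. E n) (- g, act g y) * indicator W (act g y) :: ennreal)"
      using layer_W g by (auto simp: indicator_def)
    also have "\<dots> \<le> periodization (indicator (\<Union>n. E n)) y"
      unfolding periodization_def by (rule nn_integral_ge_point) simp
    finally show "1 \<le> periodization (indicator (\<Union>n. E n)) y" .
  qed
  also have "\<dots> = emeasure (m \<Otimes>\<^sub>M N) (\<Union>n. E n)"
    using M layer_W[THEN subsetD] by (subst nn_integral_indicator_section[symmetric, OF N sets_N])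
      (auto simp: transversal_def E_def)
  also have "\<dots> \<le> (\<Sum>n. emeasure (m \<Otimes>\<^sub>M N) (E n))"
    by (rule emeasure_subadditive_countably) (use sets_N sets_m E in \<open>auto cong: sets_pair_measure_cong\<close>)
  also have "\<dots> = (\<Sum>n. emeasure m K * emeasure N (layer lam n))"
    unfolding E_def
    by (intro suminf_cong, subst N.emeasure_pair_measure_Times)
      (auto simp: sets_m sets_N emeasure_translate_right)
  also have "\<dots> = emeasure m K * (\<Sum>n. emeasure N (layer lam n))" by simp
  finally show ?thesis .
qed

text \<open>The opposite estimate, for a small set: \<open>y\<close> has at most one expression
  \<open>vu\<close> with \<open>v\<close> in \<open>V\<close> and \<open>u\<close> in the saturated
  section. Hence the sets \<open>E n\<close> are disjoint and their union has periodization at most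
  1.\<close>

lemma transversal_layers_le:
  assumes M: "transversal M N" and space_M: "space M \<subseteq> space S"
    and N: "finite_measure N" and sets_N [measurable_cong]: "sets N = sets S"
    and lam: "range lam \<subseteq> L" and V [measurable]: "V \<in> sets borel"
    and sep: "\<And>a b c v w. a \<in> L \<Longrightarrow> b \<in> L \<Longrightarrow> c \<in> L \<Longrightarrow> v \<in> V \<Longrightarrow> w \<in> V \<Longrightarrow> - w + v = a + b + c \<Longrightarrow> v = w"
  shows "emeasure m V * (\<Sum>n. emeasure N (layer lam n)) \<le> emeasure M (space M)"
proof -
  interpret N: finite_measure N by fact
  define E where "E n = ((\<lambda>a. a - lam n) -` V) \<times> layer lam n" for n
  have E [measurable]: "E n \<in> sets (borel \<Otimes>\<^sub>M S)" for n
    unfolding E_def by measurable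
  have uniq: "n = k \<and> g = h"
    if y: "y \<in> space S" and g: "(- g, act g y) \<in> E n" and h: "(- h, act h y) \<in> E k" for y g h n k
  proof -
    have gW: "act g y \<in> W" "act h y \<in> W" using g h layer_W by (auto simp: E_def)
    have "act (h - g) (act g y) = act h y" by (simp add: act_add[OF y, symmetric])
    then have "h - g \<in> L" using return_L[OF gW(1), of "h - g"] gW(2) by simp
    moreover have "lam k \<in> L" "- lam n \<in> L" using lam uminus_L by auto
    \<comment> \<open>Here the triple sum arises: \<open>lam k\<close> and \<open>- lam n\<close>
      pass between the saturated section and \<open>W\<close>, and \<open>h - g\<close> is the
      return time between the two points of \<open>W\<close>.\<close>
    moreover have "- (- h - lam k) + (- g - lam n) = lam k + (h - g) + - lam n"
      by (simp add: minus_add add.assoc diff_conv_add_uminus del: add_uminus_conv_diff)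
    moreover have "- g - lam n \<in> V" "- h - lam k \<in> V" using g h by (auto simp: E_def)
    ultimately have eq: "- g - lam n = - h - lam k" using sep by blast
    define v where "v = - g - lam n"
    have gn: "- g = v + lam n" "- h = v + lam k"
      by (simp add: v_def, simp add: v_def eq)
    define u where "u = act (- v) y"
    have u: "u \<in> space S" unfolding u_def by (rule act_space[OF y])
    have gg: "g = - lam n + - v" "h = - lam k + - v"
      using gn by (metis minus_add minus_minus)+
    have "act (- lam n) u = act g y" "act (- lam k) u = act h y"
      unfolding u_def gg by (simp_all only: act_add[OF y])
    then have "n = k"
      using g h by (intro layer_unique[OF u, of lam]) (auto simp: E_def)
    then show ?thesis using gg by simp
  qed
  have disj: "disjoint_family E"
    unfolding disjoint_family_on_def
  proof safe
    fix n k a w assume "n \<noteq> k" and a: "(a, w) \<in> E n" "(a, w) \<in> E k"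
    have w: "w \<in> space S" using a layer_W W_space by (auto simp: E_def)
    have "n = k"
      using uniq[of "act a w" "- a" n "- a" k] a act_minus[OF w] act_space[OF w] by simp
    with \<open>n \<noteq> k\<close> show "(a, w) \<in> {}" by simp
  qed
  have "emeasure m V * (\<Sum>n. emeasure N (layer lam n)) = (\<Sum>n. emeasure m V * emeasure N (layer lam n))"
    by simp
  also have "\<dots> = (\<Sum>n. emeasure (m \<Otimes>\<^sub>M N) (E n))"
    unfolding E_def
    by (intro suminf_cong, subst N.emeasure_pair_measure_Times)
      (auto simp: sets_m sets_N emeasure_translate_right)
  also have "\<dots> = emeasure (m \<Otimes>\<^sub>M N) (\<Union>n. E n)"
    using disj by (intro suminf_emeasure) (use sets_N sets_m E in \<open>auto cong: sets_pair_measure_cong\<close>)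
  also have "\<dots> = (\<integral>\<^sup>+y. periodization (indicator (\<Union>n. E n)) y \<partial>M)"
    using M layer_W[THEN subsetD] by (subst nn_integral_indicator_section[symmetric, OF N sets_N])
      (auto simp: transversal_def E_def)
  also have "\<dots> \<le> (\<integral>\<^sup>+y. 1 \<partial>M)"
  proof (intro nn_integral_mono)
    fix y assume "y \<in> space M"
    then have y: "y \<in> space S" using space_M by auto
    show "periodization (indicator (\<Union>n. E n)) y \<le> 1"
    proof (cases "\<exists>g n. (- g, act g y) \<in> E n")
      case True
      then obtain g n where g: "(- g, act g y) \<in> E n" by blast
      define F :: "'g \<Rightarrow> ennreal"
        where "F h = indicator (\<Union>n. E n) (- h, act h y) * indicator W (act h y)" for h
      have "periodization (indicator (\<Union>n. E n)) y = (\<Sum>h\<in>{g}. F h)"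
        unfolding periodization_def F_def[symmetric]
        by (rule nn_integral_count_space')
          (use uniq[OF y g] in \<open>auto simp: F_def split: split_indicator\<close>)
      also have "\<dots> = F g" by simp
      also have "F g \<le> 1" by (simp add: F_def indicator_def)
      finally show ?thesis .
    next
      case False
      then have "periodization (indicator (\<Union>n. E n)) y = 0"
        by (auto simp: periodization_def)
      then show ?thesis by simp
    qed
  qed
  also have "\<dots> = emeasure M (space M)" by simp
  finally show ?thesis .
qed

text \<open>The pieces \<open>B n\<close> of the saturated section are disjoint, and
  \<open>Q\<close> gives each of them the mass of its layer. An inequality results because
  \<open>Q\<close> may charge more than the saturation of \<open>W\<close>, as a power of a spread
  measure may.\<close>

lemma sum_layers_le:
  assumes sets_Q: "sets Q = sets S" and sets_N: "sets N = sets S"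
    and Q: "\<And>n A. A \<in> sets S \<Longrightarrow>
      emeasure N {w \<in> W. act (lam n) w \<in> A} = emeasure Q {y \<in> A. act (- lam n) y \<in> W}"
  shows "(\<Sum>n. emeasure N (layer lam n)) \<le> emeasure Q (space Q)"
proof -
  define B where "B n = {y \<in> space S. act (- lam n) y \<in> layer lam n}" for n
  have B [measurable]: "B n \<in> sets S" for n
    unfolding B_def by measurable
  have "emeasure N (layer lam n) = emeasure Q (B n)" for n
  proof -
    have "layer lam n = {w \<in> W. act (lam n) w \<in> B n}"
      using layer_W[THEN subsetD] W_space by (auto simp: B_def act_minus act_space)
    moreover have "{y \<in> B n. act (- lam n) y \<in> W} = B n"
      using layer_W by (auto simp: B_def)
    ultimately show ?thesis using Q[OF B, of n n] by simp
  qed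
  then have "(\<Sum>n. emeasure N (layer lam n)) = (\<Sum>n. emeasure Q (B n))" by simp
  also have "\<dots> = emeasure Q (\<Union>n. B n)"
    using layer_unique by (intro suminf_emeasure) (auto simp: sets_Q disjoint_family_on_def B_def)
  also have "\<dots> \<le> emeasure Q (space Q)" by (rule emeasure_space)
  finally show ?thesis .
qed

text \<open>The extension of \<open>N\<close> to the saturated section \<open>LW\<close>.\<close>

definition spread :: "(nat \<Rightarrow> 'g) \<Rightarrow> 'a measure \<Rightarrow> 'a measure" where
  "spread lam N = distr (density (count_space UNIV \<Otimes>\<^sub>M N) (\<lambda>p. indicator (layer lam (fst p)) (snd p)))
     S (\<lambda>p. act (lam (fst p)) (snd p))"

lemma sets_spread [simp, measurable_cong]: "sets (spread lam N) = sets S"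
  by (simp add: spread_def)

lemma emeasure_spread:
  assumes N: "finite_measure N" and sets_N [measurable_cong]: "sets N = sets S"
    and A [measurable]: "A \<in> sets S"
  shows "emeasure (spread lam N) A = (\<Sum>n. emeasure N {w \<in> layer lam n. act (lam n) w \<in> A})"
proof -
  interpret N: finite_measure N by fact
  have space_N: "space N = space S" using sets_eq_imp_space_eq[OF sets_N] .
  have [measurable]: "(\<lambda>p. act (lam (fst p)) (snd p)) \<in> count_space UNIV \<Otimes>\<^sub>M N \<rightarrow>\<^sub>M S"
    by (rule measurable_pair_measure_countable1) (auto, measurable)
  have [measurable]: "(\<lambda>p. indicator (layer lam (fst p)) (snd p) :: ennreal) \<in>
      borel_measurable (count_space UNIV \<Otimes>\<^sub>M N)"
    by (rule measurable_pair_measure_countable1) (auto, measurable)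
  have "emeasure (spread lam N) A = (\<integral>\<^sup>+y. indicator A y \<partial>spread lam N)" by simp
  also have "\<dots> = (\<integral>\<^sup>+p. indicator (layer lam (fst p)) (snd p) * indicator A (act (lam (fst p)) (snd p))
      \<partial>(count_space UNIV \<Otimes>\<^sub>M N))"
    unfolding spread_def by (subst nn_integral_distr) (auto simp: nn_integral_density)
  also have "\<dots> = (\<integral>\<^sup>+n. \<integral>\<^sup>+w. indicator (layer lam n) w * indicator A (act (lam n) w)
      \<partial>N \<partial>count_space UNIV)"
    by (subst N.nn_integral_fst[symmetric]) auto
  also have "\<dots> = (\<integral>\<^sup>+n. emeasure N {w \<in> layer lam n. act (lam n) w \<in> A} \<partial>count_space UNIV)"
  proof (intro nn_integral_cong)
    fix n
    have "{w \<in> layer lam n. act (lam n) w \<in> A} = layer lam n \<inter> {w \<in> W. act (lam n) w \<in> A}"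
      using layer_W by auto
    then have "{w \<in> layer lam n. act (lam n) w \<in> A} \<in> sets N" by (simp add: sets_N)
    then have "emeasure N {w \<in> layer lam n. act (lam n) w \<in> A} =
        (\<integral>\<^sup>+w. indicator {w \<in> layer lam n. act (lam n) w \<in> A} w \<partial>N)" by simp
    also have "\<dots> = (\<integral>\<^sup>+w. indicator (layer lam n) w * indicator A (act (lam n) w) \<partial>N)"
      by (intro nn_integral_cong) (auto split: split_indicator)
    finally show "(\<integral>\<^sup>+w. indicator (layer lam n) w * indicator A (act (lam n) w) \<partial>N) =
        emeasure N {w \<in> layer lam n. act (lam n) w \<in> A}" ..
  qed
  finally show ?thesis by (simp add: nn_integral_count_space_nat)
qed

text \<open>\<open>spread\<close> moves points by the first suitable \<open>lam n\<close>; partial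
  invariance makes the outcome independent of this choice, so on the translate of \<open>W\<close>
  by \<open>lam k\<close> it is the image of \<open>N\<close> under \<open>act (lam k)\<close>. The
  set is cut according to the first index \<open>n\<close>, and \<open>l n\<close> moves each piece
  from its layer to the corresponding part of \<open>A0\<close>.\<close>

lemma spread_translate:
  assumes N: "finite_measure N" "partially_invariant N" and sets_N [measurable_cong]: "sets N = sets S"
    and A [measurable]: "A \<in> sets S"
  shows "emeasure N {w \<in> W. act (lam k) w \<in> A} = emeasure (spread lam N) {y \<in> A. act (- lam k) y \<in> W}"
proof -
  define A0 where "A0 = {w \<in> W. act (lam k) w \<in> A}"
  have A0 [measurable]: "A0 \<in> sets S" unfolding A0_def by measurable
  define l where "l n = - lam k + lam n" for n
  have AS: "A \<subseteq> space S" using sets.sets_into_space[OF A] .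
  define C where "C n = {a \<in> A0. act (- l n) a \<in> layer lam n}" for n
  have CS: "a \<in> space S" if "a \<in> A0" for a using that W_space by (auto simp: A0_def)
  have C_alt: "a \<in> C n \<longleftrightarrow> a \<in> A0 \<and> act (- lam n) (act (lam k) a) \<in> layer lam n" for a n
    using CS by (auto simp: C_def l_def minus_add act_add)
  have C [measurable]: "C n \<in> sets S" for n
  proof -
    have "C n = {w \<in> W. act (- l n) w \<in> layer lam n} \<inter> A0" by (auto simp: C_def A0_def)
    then show ?thesis by simp
  qed
  have CW: "C n \<subseteq> W" for n by (auto simp: C_def A0_def)
  have "{y \<in> A. act (- lam k) y \<in> W} = {y \<in> space S. y \<in> A \<and> act (- lam k) y \<in> W}" using AS by auto
  then have [measurable]: "{y \<in> A. act (- lam k) y \<in> W} \<in> sets S" by simp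
  have "emeasure (spread lam N) {y \<in> A. act (- lam k) y \<in> W} =
      (\<Sum>n. emeasure N {w \<in> layer lam n. act (lam n) w \<in> {y \<in> A. act (- lam k) y \<in> W}})"
    by (intro emeasure_spread N sets_N) measurable
  also have "\<dots> = (\<Sum>n. emeasure N {w \<in> W. act (l n) w \<in> C n})"
  proof (intro suminf_cong arg_cong[where f = "emeasure N"])
    fix n
    show "{w \<in> layer lam n. act (lam n) w \<in> {y \<in> A. act (- lam k) y \<in> W}} = {w \<in> W. act (l n) w \<in> C n}"
    proof (intro Collect_cong)
      fix w
      have "w \<in> layer lam n \<and> act (lam n) w \<in> A \<and> act (- lam k) (act (lam n) w) \<in> W \<longleftrightarrow> act (l n) w \<in> C n"
        if w: "w \<in> W"
      proof -
        have wS: "w \<in> space S" using w W_space by auto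
        have e1: "act (l n) w = act (- lam k) (act (lam n) w)"
          unfolding l_def by (simp only: act_add[OF wS])
        have e2: "act (lam k) (act (l n) w) = act (lam n) w"
          unfolding e1 by (intro act_minus' act_space wS)
        show ?thesis
          by (auto simp: C_def A0_def e2 act_minus[OF wS] e1[symmetric])
      qed
      then show "w \<in> layer lam n \<and> act (lam n) w \<in> {y \<in> A. act (- lam k) y \<in> W} \<longleftrightarrow>
          w \<in> W \<and> act (l n) w \<in> C n"
        using layer_W[of lam n] by blast
    qed
  qed
  also have "\<dots> = (\<Sum>n. emeasure N (C n))"
  proof (intro suminf_cong)
    fix n
    have "{w \<in> C n. act (- l n) w \<in> W} = C n" using layer_W by (auto simp: C_def)
    then show "emeasure N {w \<in> W. act (l n) w \<in> C n} = emeasure N (C n)"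
      using N(2)[unfolded partially_invariant_def, rule_format, OF C CW, of "l n" n] by simp
  qed
  also have "\<dots> = emeasure N (\<Union>n. C n)"
  proof (intro suminf_emeasure)
    show "range C \<subseteq> sets N" by (auto simp: sets_N)
    have False if "n \<noteq> j" "a \<in> C n" "a \<in> C j" for n j a
      using that layer_unique[OF act_space[OF CS], of a lam n "lam k" j] by (auto simp: C_alt)
    then show "disjoint_family C" unfolding disjoint_family_on_def by blast
  qed
  also have "(\<Union>n. C n) = A0"
  proof (intro equalityI subsetI)
    fix a assume a: "a \<in> A0"
    have "act (- lam k) (act (lam k) a) \<in> W" using a CS[OF a] by (simp add: act_minus A0_def)
    then have "\<exists>n. act (- lam n) (act (lam k) a) \<in> layer lam n"
      by (rule layer_exists[OF act_space[OF CS[OF a]]])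
    then show "a \<in> (\<Union>n. C n)" using a by (auto simp: C_alt)
  qed (auto simp: C_alt)
  finally show ?thesis by (simp add: A0_def)
qed

section \<open>Ergodic actions\<close>

text \<open>The points whose orbit lies in \<open>A\<close> up to a Haar null set form a strictly invariant version of \<open>A\<close>.\<close>

lemma ergodic_AE_invariant_set:
  assumes fin: "finite_measure M" and sets_M [measurable_cong]: "sets M = sets S"
    and erg: "ergodic_measure act M" and m_nonzero: "emeasure m UNIV \<noteq> 0"
    and A [measurable]: "A \<in> sets S"
    and inv: "\<And>g. AE x in M. act g x \<in> A \<longleftrightarrow> x \<in> A"
  shows "(AE x in M. x \<notin> A) \<or> (AE x in M. x \<in> A)"
proof -
  interpret M: finite_measure M by fact
  interpret m: sigma_finite_measure m by (rule sigma_finite_m)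
  interpret P: pair_sigma_finite m M ..
  have space_M: "space M = space S" using sets_eq_imp_space_eq[OF sets_M] .
  have orbit_sets [measurable]: "{g. act g x \<in> A} \<in> sets borel" if x: "x \<in> space S" for x
  proof -
    have "(\<lambda>g. act g x) \<in> borel \<rightarrow>\<^sub>M S" using x by measurable
    from measurable_sets[OF this A] show ?thesis by (simp add: vimage_def)
  qed
  define A' where "A' = {x \<in> space S. AE g in m. act g x \<in> A}"
  have A' [measurable]: "A' \<in> sets S"
  proof -
    define Q where "Q = {p \<in> space (S \<Otimes>\<^sub>M m). act (snd p) (fst p) \<notin> A}"
    have [measurable]: "Q \<in> sets (S \<Otimes>\<^sub>M m)" unfolding Q_def by measurable
    have [measurable]: "(\<lambda>x. emeasure m (Pair x -` Q)) \<in> borel_measurable S"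
      by (rule m.measurable_emeasure_Pair) measurable
    have "A' = {x \<in> space S. emeasure m (Pair x -` Q) = 0}"
      unfolding A'_def
    proof (intro Collect_cong conj_cong refl)
      fix x assume x: "x \<in> space S"
      have "Pair x -` Q = {g \<in> space m. act g x \<notin> A}"
        using x by (auto simp: Q_def space_pair_measure)
      moreover have "{g \<in> space m. act g x \<notin> A} \<in> sets m"
        using sets.compl_sets[of "{g. act g x \<in> A}" borel] orbit_sets[OF x]
        by (simp add: sets_m Compl_eq[symmetric] Collect_neg_eq)
      ultimately show "(AE g in m. act g x \<in> A) \<longleftrightarrow> emeasure m (Pair x -` Q) = 0"
        by (simp add: AE_iff_measurable)
    qed
    also have "\<dots> \<in> sets S" by measurable
    finally show ?thesis .
  qed
  have A'_inv: "act h -` A' \<inter> space M = A'" for h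
  proof -
    \<comment> \<open>Replacing \<open>x\<close> by \<open>act h x\<close> translates the group
      variable on the right, which preserves null sets by right invariance of \<open>m\<close>. So
      \<open>A'\<close> is invariant at every point, as \<open>ergodic_measure\<close>
      demands.\<close>
    have shift: "(AE g in m. act g (act h x) \<in> A) \<longleftrightarrow> (AE g in m. act g x \<in> A)" if x: "x \<in> space S" for x
    proof -
      have "(AE g in m. act g x \<in> A) \<longleftrightarrow> (AE g in distr m borel (\<lambda>g. g + h). act g x \<in> A)"
        by (simp only: right_inv)
      also have "\<dots> \<longleftrightarrow> (AE g in m. act (g + h) x \<in> A)"
        using orbit_sets[OF x] by (subst AE_distr_iff) auto
      finally show ?thesis by (simp add: act_add[OF x])
    qed
    show ?thesis
    proof (rule set_eqI)
      fix x show "x \<in> act h -` A' \<inter> space M \<longleftrightarrow> x \<in> A'"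
        by (cases "x \<in> space S") (simp_all add: A'_def space_M act_space shift)
    qed
  qed
  have "AE x in M. AE g in m. act g x \<in> A \<longleftrightarrow> x \<in> A"
  proof -
    have "{p \<in> space (m \<Otimes>\<^sub>M M). act (fst p) (snd p) \<in> A \<longleftrightarrow> snd p \<in> A} \<in> sets (m \<Otimes>\<^sub>M M)"
      by measurable
    from P.AE_commute[OF this] show ?thesis using inv by simp
  qed
  then have eq: "AE x in M. x \<in> A' \<longleftrightarrow> x \<in> A"
  proof (rule AE_mp, intro AE_I2 impI)
    fix x assume x: "x \<in> space M" and ae: "AE g in m. act g x \<in> A \<longleftrightarrow> x \<in> A"
    \<comment> \<open>A condition that does not mention \<open>g\<close> and holds for almost every
      \<open>g\<close> holds outright, because \<open>m\<close> is non-zero.\<close>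
    have nonnull: "\<not> (AE g in m. False)"
      using m_nonzero by (auto simp: AE_iff_measurable[OF _ refl])
    have "(AE g in m. act g x \<in> A) \<longleftrightarrow> x \<in> A"
    proof
      assume "AE g in m. act g x \<in> A"
      with ae have "AE g in m. x \<in> A" by eventually_elim simp
      then show "x \<in> A" using nonnull by (cases "x \<in> A") auto
    next
      assume "x \<in> A"
      with ae show "AE g in m. act g x \<in> A" by simp
    qed
    then show "x \<in> A' \<longleftrightarrow> x \<in> A" using x by (simp add: A'_def space_M)
  qed
  have "emeasure M A' = 0 \<or> emeasure M (space M - A') = 0"
    using erg A' A'_inv by (simp add: ergodic_measure_def sets_M)
  then have "(AE x in M. x \<notin> A') \<or> (AE x in M. x \<in> A')"
  proof
    assume "emeasure M A' = 0"
    then show ?thesis using A' by (intro disjI1 AE_I[where N = A']) (auto simp: sets_M)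
  next
    assume "emeasure M (space M - A') = 0"
    then show ?thesis using A' by (intro disjI2 AE_I[where N = "space M - A'"]) (auto simp: sets_M space_M)
  qed
  then show ?thesis
  proof
    assume "AE x in M. x \<notin> A'"
    with eq have "AE x in M. x \<notin> A" by eventually_elim simp
    then show ?thesis ..
  next
    assume "AE x in M. x \<in> A'"
    with eq have "AE x in M. x \<in> A" by eventually_elim simp
    then show ?thesis ..
  qed
qed

text \<open>One level set decides, the one at the mean \<open>c\<close>: by ergodicity
  \<open>h\<close> is almost everywhere at most \<open>c\<close> or almost everywhere at least
  \<open>c\<close>, and a one-sided bound with equal integrals is an equality almost
  everywhere.\<close>

lemma ergodic_AE_invariant_function:
  fixes h :: "'a \<Rightarrow> ennreal"
  assumes prob: "prob_space M" and sets_M [measurable_cong]: "sets M = sets S"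
    and erg: "ergodic_measure act M" and m_nonzero: "emeasure m UNIV \<noteq> 0"
    and h [measurable]: "h \<in> borel_measurable S" and fin: "(\<integral>\<^sup>+x. h x \<partial>M) \<noteq> \<top>"
    and inv: "\<And>g. AE x in M. h (act g x) = h x"
  shows "AE x in M. h x = (\<integral>\<^sup>+x. h x \<partial>M)"
proof -
  interpret M: prob_space M by fact
  have space_M: "space M = space S" using sets_eq_imp_space_eq[OF sets_M] .
  define c where "c = (\<integral>\<^sup>+x. h x \<partial>M)"
  have int_c: "(\<integral>\<^sup>+x. c \<partial>M) = c" by (simp add: M.emeasure_space_1)
  have c: "c \<noteq> \<top>" using fin by (simp add: c_def)
  define A where "A = {x \<in> space S. c < h x}"
  have A [measurable]: "A \<in> sets S" unfolding A_def by measurable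
  have "AE x in M. act g x \<in> A \<longleftrightarrow> x \<in> A" for g
    using inv[of g] by (rule AE_mp) (intro AE_I2 impI, simp add: A_def space_M act_space)
  from ergodic_AE_invariant_set[OF M.finite_measure_axioms sets_M erg m_nonzero A this]
  have "(AE x in M. h x \<le> c) \<or> (AE x in M. c \<le> h x)"
  proof
    assume "AE x in M. x \<notin> A"
    then have "AE x in M. h x \<le> c"
      by (rule AE_mp) (intro AE_I2 impI, auto simp: A_def space_M)
    then show ?thesis ..
  next
    assume "AE x in M. x \<in> A"
    then have "AE x in M. c \<le> h x"
      by (rule AE_mp) (intro AE_I2 impI, auto simp: A_def space_M)
    then show ?thesis ..
  qed
  then show ?thesis
    unfolding c_def[symmetric]
  proof
    assume le: "AE x in M. h x \<le> c"
    have "(\<integral>\<^sup>+x. c - h x \<partial>M) = 0"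
      using le fin int_c by (subst nn_integral_diff) (simp_all add: c_def)
    then have "AE x in M. c - h x = 0"
      by (subst (asm) nn_integral_0_iff_AE) auto
    with le show "AE x in M. h x = c"
      by eventually_elim (use c in \<open>auto simp: diff_eq_0_iff_ennreal less_top intro: antisym\<close>)
  next
    assume le: "AE x in M. c \<le> h x"
    have "(\<integral>\<^sup>+x. h x - c \<partial>M) = 0"
      using le c int_c by (subst nn_integral_diff) (simp_all add: c_def[symmetric])
    then have "AE x in M. h x - c = 0"
      by (subst (asm) nn_integral_0_iff_AE) auto
    moreover have "AE x in M. h x \<noteq> \<infinity>"
      using fin by (intro nn_integral_noteq_infinite) auto
    ultimately show "AE x in M. h x = c"
      using le by eventually_elim (auto simp: diff_eq_0_iff_ennreal less_top intro: antisym)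
  qed
qed

text \<open>As \<open>M\<close> and \<open>Q\<close> are both invariant, translating a Radon-Nikodym
  density of \<open>Q\<close> gives another one. Uniqueness of densities makes the density invariant
  almost everywhere, hence constant.\<close>

lemma ergodic_absolutely_continuous:
  assumes prob: "prob_space M" and sets_M [measurable_cong]: "sets M = sets S"
    and erg: "ergodic_measure act M" and m_nonzero: "emeasure m UNIV \<noteq> 0"
    and inv_M: "\<And>g. distr M M (act g) = M"
    and fin: "finite_measure Q" and sets_Q [measurable_cong]: "sets Q = sets S"
    and inv_Q: "\<And>g A. A \<in> sets S \<Longrightarrow> emeasure Q (act g -` A \<inter> space S) = emeasure Q A"
    and ac: "absolutely_continuous M Q" and A: "A \<in> sets S"
  shows "emeasure Q A = emeasure Q (space S) * emeasure M A"
proof -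
  interpret M: prob_space M by fact
  interpret Q: finite_measure Q by fact
  have space_M: "space M = space S" using sets_eq_imp_space_eq[OF sets_M] .
  have space_Q: "space Q = space S" using sets_eq_imp_space_eq[OF sets_Q] .
  obtain h where h': "h \<in> borel_measurable M" and dens: "density M h = Q"
    using M.Radon_Nikodym[OF ac] sets_Q sets_M by auto
  have h [measurable]: "h \<in> borel_measurable S" using h' by (simp cong: measurable_cong_sets add: sets_M)
  have Q_eq: "emeasure Q B = (\<integral>\<^sup>+x. h x * indicator B x \<partial>M)" if "B \<in> sets S" for B
    using that dens h' emeasure_density[of h M B] by (simp add: sets_M)
  have int_h: "(\<integral>\<^sup>+x. h x \<partial>M) = emeasure Q (space S)"
    unfolding Q_eq[OF sets.top] by (intro nn_integral_cong) (simp add: space_M)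
  have inv: "AE x in M. h (act g x) = h x" for g
  proof -
    have meas [measurable]: "(\<lambda>x. h (act g x)) \<in> borel_measurable M" by measurable
    have "density M (\<lambda>x. h (act g x)) = Q"
    proof (rule measure_eqI)
      fix B assume "B \<in> sets (density M (\<lambda>x. h (act g x)))"
      then have B [measurable]: "B \<in> sets S" by (simp add: sets_M)
      define B' where "B' = act (- g) -` B \<inter> space S"
      have B' [measurable]: "B' \<in> sets S" unfolding B'_def by measurable
      have "emeasure (density M (\<lambda>x. h (act g x))) B = (\<integral>\<^sup>+x. h (act g x) * indicator B x \<partial>M)"
        using B by (intro emeasure_density meas) (simp add: sets_M)
      also have "\<dots> = (\<integral>\<^sup>+x. h (act g x) * indicator B' (act g x) \<partial>M)"
        by (intro nn_integral_cong)
          (simp add: B'_def space_M act_minus act_space indicator_def)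
      also have "\<dots> = (\<integral>\<^sup>+x. h x * indicator B' x \<partial>distr M M (act g))"
        by (rule nn_integral_distr[symmetric]) measurable
      also have "\<dots> = emeasure Q B'" unfolding inv_M Q_eq[OF B'] ..
      also have "\<dots> = emeasure Q B" unfolding B'_def by (rule inv_Q) (rule B)
      finally show "emeasure (density M (\<lambda>x. h (act g x))) B = emeasure Q B" .
    qed (simp add: sets_M sets_Q)
    then show ?thesis
      using dens by (intro M.density_unique meas h') simp
  qed
  have "AE x in M. h x = emeasure Q (space S)"
    using ergodic_AE_invariant_function[OF prob sets_M erg m_nonzero h _ inv] Q.emeasure_finite
    by (simp add: int_h)
  then have "emeasure Q A = (\<integral>\<^sup>+x. emeasure Q (space S) * indicator A x \<partial>M)"
    unfolding Q_eq[OF A] by (intro nn_integral_cong_AE) (elim eventually_mono, simp)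
  also have "\<dots> = emeasure Q (space S) * emeasure M A"
    using A by (simp add: nn_integral_cmult sets_M)
  finally show ?thesis .
qed

section \<open>Comparison with transverse measures\<close>

lemma transversal_of_transverse_measure:
  assumes T: "transverse_measure m act W M N" and sets_N: "sets N = sets (restrict_space S W)"
    and space_M: "space M \<subseteq> space S"
  shows "transversal M (distr N S (\<lambda>x. x))"
  unfolding transversal_def
proof
  interpret N: finite_measure N using T by (simp add: transverse_measure_def)
  have space_N: "space N = W"
    using sets_eq_imp_space_eq[OF sets_N] W_space by (auto simp: space_restrict_space)
  have id_N: "(\<lambda>x. x) \<in> N \<rightarrow>\<^sub>M S"
    using measurable_restrict_space1[of "\<lambda>x. x" S S W]
    by (simp cong: measurable_cong_sets add: sets_N)
  fix E :: "('g \<times> 'a) set" assume E [measurable]: "E \<in> sets (borel \<Otimes>\<^sub>M S)"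
  have "fst \<in> m \<Otimes>\<^sub>M N \<rightarrow>\<^sub>M borel" by measurable
  then have pair: "(\<lambda>p. (fst p, snd p)) \<in> m \<Otimes>\<^sub>M N \<rightarrow>\<^sub>M borel \<Otimes>\<^sub>M S"
    by (rule measurable_Pair) (rule measurable_compose[OF measurable_snd id_N])
  have "(\<lambda>p. indicator E (fst p, snd p) :: real) \<in> borel_measurable (m \<Otimes>\<^sub>M N)"
    by (rule measurable_compose[OF pair]) measurable
  then have bm: "(indicator E :: _ \<Rightarrow> real) \<in> borel_measurable (m \<Otimes>\<^sub>M N)"
    by simp
  have "(\<integral>\<^sup>+y. periodization (indicator E) y \<partial>M) =
      (\<integral>\<^sup>+x. (\<integral>\<^sup>+g. ennreal (indicator E (- g, act g x)) \<partial>count_space (hitting_times act W x)) \<partial>M)"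
    unfolding periodization_def
    by (intro nn_integral_cong)
      (auto simp: nn_integral_count_space_indicator hitting_times_def ennreal_indicator
        intro!: nn_integral_cong split: split_indicator)
  also have "\<dots> = (\<integral>\<^sup>+g. (\<integral>\<^sup>+z. ennreal (indicator E (g, z)) \<partial>N) \<partial>m)"
    using T unfolding transverse_measure_def
    by (elim conjE allE[where x = "indicator E :: _ \<Rightarrow> real"], elim mp)
      (auto intro!: exI[of _ 1] bm split: split_indicator)
  also have "\<dots> = (\<integral>\<^sup>+g. \<integral>\<^sup>+w. indicator E (g, w) * indicator W w \<partial>distr N S (\<lambda>x. x) \<partial>m)"
  proof (intro nn_integral_cong)
    fix g
    have "(\<lambda>w. indicator E (g, w) * indicator W w :: ennreal) \<in> borel_measurable S"
      by measurable
    then have "(\<integral>\<^sup>+w. indicator E (g, w) * indicator W w \<partial>distr N S (\<lambda>x. x)) =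
        (\<integral>\<^sup>+w. indicator E (g, w) * indicator W w \<partial>N)"
      by (intro nn_integral_distr[OF id_N]) simp
    also have "\<dots> = (\<integral>\<^sup>+z. ennreal (indicator E (g, z)) \<partial>N)"
      by (intro nn_integral_cong) (simp add: space_N ennreal_indicator)
    finally show "(\<integral>\<^sup>+z. ennreal (indicator E (g, z)) \<partial>N) =
      (\<integral>\<^sup>+w. indicator E (g, w) * indicator W w \<partial>distr N S (\<lambda>x. x))" ..
  qed
  finally show "(\<integral>\<^sup>+y. periodization (indicator E) y \<partial>M) =
    (\<integral>\<^sup>+g. \<integral>\<^sup>+w. indicator E (g, w) * indicator W w \<partial>distr N S (\<lambda>x. x) \<partial>m)" .
qed

lemma transverse_measureI:
  assumes fin: "finite_measure N" and sets_N: "sets N = sets (restrict_space S W)"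
    and sets_N': "sets N = sets (restrict_space M W)"
    and eq: "\<And>f. f \<in> borel_measurable (borel \<Otimes>\<^sub>M S) \<Longrightarrow> (\<integral>\<^sup>+y. periodization f y \<partial>M) =
      (\<integral>\<^sup>+g. \<integral>\<^sup>+w. f (g, w) * indicator W w \<partial>distr N S (\<lambda>x. x) \<partial>m)"
  shows "transverse_measure m act W M N"
  unfolding transverse_measure_def
proof (intro conjI allI impI)
  have space_N: "space N = W"
    using sets_eq_imp_space_eq[OF sets_N] W_space by (auto simp: space_restrict_space)
  have id_N: "(\<lambda>x. x) \<in> N \<rightarrow>\<^sub>M S"
    using measurable_restrict_space1[of "\<lambda>x. x" S S W]
    by (simp cong: measurable_cong_sets add: sets_N)
  fix f :: "'g \<times> 'a \<Rightarrow> real"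
  assume f: "f \<in> borel_measurable (m \<Otimes>\<^sub>M N) \<and>
    (\<exists>B. \<forall>p\<in>space (m \<Otimes>\<^sub>M N). 0 \<le> f p \<and> f p \<le> B)"
  \<comment> \<open>\<open>f\<close> is measurable only over \<open>W\<close>. Extended by zero it
    becomes measurable on the full product, and neither side of the formula changes.\<close>
  define f' :: "'g \<times> 'a \<Rightarrow> ennreal" where "f' p = ennreal (f p) * indicator (UNIV \<times> W) p" for p
  have UW: "UNIV \<times> W \<in> sets (borel \<Otimes>\<^sub>M S)" by measurable
  have 1: "fst \<in> restrict_space (borel \<Otimes>\<^sub>M S) (UNIV \<times> W) \<rightarrow>\<^sub>M m"
    using measurable_restrict_space1[OF measurable_fst, of borel S "UNIV \<times> W"]
    by (simp cong: measurable_cong_sets add: sets_m)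
  have 2: "snd \<in> restrict_space (borel \<Otimes>\<^sub>M S) (UNIV \<times> W) \<rightarrow>\<^sub>M N"
  proof -
    have "snd \<in> restrict_space (borel \<Otimes>\<^sub>M S) (UNIV \<times> W) \<rightarrow>\<^sub>M restrict_space S W"
      by (rule measurable_restrict_space3[OF measurable_snd]) auto
    then show ?thesis by (simp cong: measurable_cong_sets add: sets_N)
  qed
  have pair: "(\<lambda>p. (fst p, snd p)) \<in> restrict_space (borel \<Otimes>\<^sub>M S) (UNIV \<times> W) \<rightarrow>\<^sub>M m \<Otimes>\<^sub>M N"
    using 1 2 by (rule measurable_Pair)
  have "(\<lambda>p. f (fst p, snd p)) \<in> borel_measurable (restrict_space (borel \<Otimes>\<^sub>M S) (UNIV \<times> W))"
    by (rule measurable_compose[OF pair]) (rule conjunct1[OF f])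
  then have "f \<in> borel_measurable (restrict_space (borel \<Otimes>\<^sub>M S) (UNIV \<times> W))"
    by simp
  from measurable_compose[OF this measurable_ennreal]
  have "(\<lambda>p. ennreal (f p)) \<in> borel_measurable (restrict_space (borel \<Otimes>\<^sub>M S) (UNIV \<times> W))" .
  then have f' [measurable]: "f' \<in> borel_measurable (borel \<Otimes>\<^sub>M S)"
    unfolding f'_def using UW by (subst (asm) borel_measurable_restrict_space_iff_ennreal) auto
  have "(\<integral>\<^sup>+x. (\<integral>\<^sup>+g. ennreal (f (- g, act g x)) \<partial>count_space (hitting_times act W x)) \<partial>M) =
      (\<integral>\<^sup>+y. periodization f' y \<partial>M)"
    unfolding periodization_def
    by (intro nn_integral_cong)
      (auto simp: nn_integral_count_space_indicator hitting_times_def f'_def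
        intro!: nn_integral_cong split: split_indicator)
  also have "\<dots> = (\<integral>\<^sup>+g. \<integral>\<^sup>+w. f' (g, w) * indicator W w \<partial>distr N S (\<lambda>x. x) \<partial>m)"
    by (rule eq) (rule f')
  also have "\<dots> = (\<integral>\<^sup>+g. (\<integral>\<^sup>+z. ennreal (f (g, z)) \<partial>N) \<partial>m)"
  proof (intro nn_integral_cong)
    fix g
    have "(\<lambda>w. f' (g, w) * indicator W w) \<in> borel_measurable S"
      by measurable
    then have "(\<integral>\<^sup>+w. f' (g, w) * indicator W w \<partial>distr N S (\<lambda>x. x)) = (\<integral>\<^sup>+w. f' (g, w) * indicator W w \<partial>N)"
      by (intro nn_integral_distr[OF id_N]) simp
    also have "\<dots> = (\<integral>\<^sup>+z. ennreal (f (g, z)) \<partial>N)"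
      by (intro nn_integral_cong) (simp add: space_N f'_def)
    finally show "(\<integral>\<^sup>+w. f' (g, w) * indicator W w \<partial>distr N S (\<lambda>x. x)) = (\<integral>\<^sup>+z. ennreal (f (g, z)) \<partial>N)" .
  qed
  finally show "(\<integral>\<^sup>+x. (\<integral>\<^sup>+g. ennreal (f (- g, act g x)) \<partial>count_space (hitting_times act W x)) \<partial>M) =
    (\<integral>\<^sup>+g. (\<integral>\<^sup>+z. ennreal (f (g, z)) \<partial>N) \<partial>m)" .
qed (fact fin sets_N')+

end

section \<open>Finite powers of measures\<close>

lemma emeasure_PiM_power:
  assumes "finite_measure \<alpha>" "finite I" "\<And>i. i \<in> I \<Longrightarrow> A i \<in> sets \<alpha>"
  shows "emeasure (PiM I (\<lambda>_. \<alpha>)) (Pi\<^sub>E I A) = (\<Prod>i\<in>I. emeasure \<alpha> (A i))"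
proof -
  interpret finite_measure \<alpha> by fact
  interpret product_sigma_finite "\<lambda>_. \<alpha>" by unfold_locales
  show ?thesis using assms(2,3) by (rule emeasure_PiM)
qed

lemma finite_measure_PiM_power:
  assumes "finite_measure \<alpha>" "finite I"
  shows "finite_measure (PiM I (\<lambda>_. \<alpha>))"
proof
  interpret finite_measure \<alpha> by fact
  have "emeasure (PiM I (\<lambda>_. \<alpha>)) (space (PiM I (\<lambda>_. \<alpha>))) = (\<Prod>i\<in>I. emeasure \<alpha> (space \<alpha>))"
    unfolding space_PiM by (intro emeasure_PiM_power assms) auto
  also have "\<dots> \<noteq> \<infinity>"
    using emeasure_finite by (simp add: power_eq_top_ennreal)
  finally show "emeasure (PiM I (\<lambda>_. \<alpha>)) (space (PiM I (\<lambda>_. \<alpha>))) \<noteq> \<infinity>" .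
qed

lemma PiM_power_eqI:
  assumes "finite_measure P" "finite I" "sets P = sets (PiM I (\<lambda>_. \<alpha>))" "sets Q = sets (PiM I (\<lambda>_. \<alpha>))"
    and "\<And>A. (\<And>i. i \<in> I \<Longrightarrow> A i \<in> sets \<alpha>) \<Longrightarrow> emeasure P (Pi\<^sub>E I A) = emeasure Q (Pi\<^sub>E I A)"
  shows "P = Q"
proof (rule measure_eqI_PiM_finite[OF assms(2-5)])
  interpret finite_measure P by fact
  show "range (\<lambda>_::nat. Pi\<^sub>E I (\<lambda>_. space \<alpha>)) \<subseteq> prod_algebra I (\<lambda>_. \<alpha>)"
    using prod_algebraI_finite[OF assms(2), of "\<lambda>_. space \<alpha>" "\<lambda>_. \<alpha>"] by auto
  show "(\<Union>i::nat. Pi\<^sub>E I (\<lambda>_. space \<alpha>)) = space (PiM I (\<lambda>_. \<alpha>))"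
    by (simp add: space_PiM)
  show "emeasure P (Pi\<^sub>E I (\<lambda>_. space \<alpha>)) \<noteq> \<infinity>" for i :: nat
    using emeasure_finite by simp
qed

text \<open>As functions of \<open>A\<close> both sides are finite measures, and on boxes the
  identity is the product of the coordinate identities \<open>eq\<close>. It is used with
  \<open>\<beta>\<close> equal to \<open>\<alpha>\<close> for partial invariance of the power, and
  with \<open>\<beta>\<close> the spread of \<open>\<alpha>\<close> for the saturated
  section.\<close>

lemma PiM_power_translate:
  fixes I :: "'i set" and t :: "'b :: topological_space \<Rightarrow> 'b"
  assumes \<alpha>: "finite_measure \<alpha>" "sets \<alpha> = sets borel" and \<beta>: "finite_measure \<beta>" "sets \<beta> = sets borel"
    and I: "finite I" and P: "P \<in> sets borel" and Q: "Q \<in> sets borel" and t: "t \<in> borel \<rightarrow>\<^sub>M borel"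
    and eq: "\<And>A. A \<in> sets borel \<Longrightarrow> emeasure \<alpha> {x \<in> P. t x \<in> A} = emeasure \<beta> (A \<inter> Q)"
    and A: "A \<in> sets (PiM I (\<lambda>_. borel))"
  shows "emeasure (PiM I (\<lambda>_. \<alpha>)) {x \<in> Pi\<^sub>E I (\<lambda>_. P). (\<lambda>i\<in>I. t (x i)) \<in> A} =
    emeasure (PiM I (\<lambda>_. \<beta>)) (A \<inter> Pi\<^sub>E I (\<lambda>_. Q))"
proof -
  let ?B = "PiM I (\<lambda>_. borel)"
  let ?T = "\<lambda>x. \<lambda>i\<in>I. t (x i)"
  have sa: "sets (PiM I (\<lambda>_. \<alpha>)) = sets ?B" and sb: "sets (PiM I (\<lambda>_. \<beta>)) = sets ?B"
    using \<alpha>(2) \<beta>(2) by (auto intro!: sets_PiM_cong)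
  have spa: "space (PiM I (\<lambda>_. \<alpha>)) = Pi\<^sub>E I (\<lambda>_. UNIV)"
    using sets_eq_imp_space_eq[OF sa] by (simp add: space_PiM)
  have T: "?T \<in> ?B \<rightarrow>\<^sub>M ?B"
    by (rule measurable_restrict, rule measurable_compose[OF _ t], rule measurable_component_singleton)
  have PP: "Pi\<^sub>E I (\<lambda>_. P) \<in> sets ?B" and QQ: "Pi\<^sub>E I (\<lambda>_. Q) \<in> sets ?B"
    using I P Q by (auto intro: sets_PiM_I_finite)
  define \<mu>1 where "\<mu>1 = distr (density (PiM I (\<lambda>_. \<alpha>)) (indicator (Pi\<^sub>E I (\<lambda>_. P)))) ?B ?T"
  define \<mu>2 where "\<mu>2 = density (PiM I (\<lambda>_. \<beta>)) (indicator (Pi\<^sub>E I (\<lambda>_. Q)))"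
  have 1: "emeasure \<mu>1 C = emeasure (PiM I (\<lambda>_. \<alpha>)) {x \<in> Pi\<^sub>E I (\<lambda>_. P). ?T x \<in> C}"
    if C: "C \<in> sets ?B" for C
  proof -
    have TC: "?T -` C \<inter> space ?B \<in> sets ?B" using T C by (rule measurable_sets)
    have "emeasure \<mu>1 C = emeasure (PiM I (\<lambda>_. \<alpha>)) (Pi\<^sub>E I (\<lambda>_. P) \<inter> (?T -` C \<inter> space ?B))"
      unfolding \<mu>1_def using T C TC PP sets_eq_imp_space_eq[OF sa]
      by (subst emeasure_distr) (simp_all add: emeasure_restricted sa cong: measurable_cong_sets)
    also have "Pi\<^sub>E I (\<lambda>_. P) \<inter> (?T -` C \<inter> space ?B) = {x \<in> Pi\<^sub>E I (\<lambda>_. P). ?T x \<in> C}"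
      using sets.sets_into_space[OF PP] by auto
    finally show ?thesis .
  qed
  have 2: "emeasure \<mu>2 C = emeasure (PiM I (\<lambda>_. \<beta>)) (C \<inter> Pi\<^sub>E I (\<lambda>_. Q))" if C: "C \<in> sets ?B" for C
    unfolding \<mu>2_def using C QQ by (simp add: emeasure_restricted sb Int_commute)
  have "\<mu>1 = \<mu>2"
  proof (rule PiM_power_eqI[where \<alpha> = borel and I = I])
    interpret finite_measure "PiM I (\<lambda>_. \<alpha>)" using \<alpha>(1) I by (rule finite_measure_PiM_power)
    have "emeasure \<mu>1 (space \<mu>1) \<noteq> \<infinity>"
      using emeasure_finite by (subst 1) (auto simp: \<mu>1_def)
    then show "finite_measure \<mu>1" by (rule finite_measureI)
    fix A :: "'i \<Rightarrow> 'b set" assume A: "\<And>i. i \<in> I \<Longrightarrow> A i \<in> sets borel"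
    have AA: "Pi\<^sub>E I A \<in> sets ?B" using I A by (auto intro: sets_PiM_I_finite)
    have Ci: "{x \<in> P. t x \<in> A i} \<in> sets borel" if "i \<in> I" for i
    proof -
      have "{x \<in> P. t x \<in> A i} = P \<inter> t -` A i" by auto
      then show ?thesis using P measurable_sets_borel[OF t A[OF that]] by simp
    qed
    have "emeasure \<mu>1 (Pi\<^sub>E I A) = emeasure (PiM I (\<lambda>_. \<alpha>)) (\<Pi>\<^sub>E i\<in>I. {x \<in> P. t x \<in> A i})"
      unfolding 1[OF AA] by (intro arg_cong[where f = "emeasure _"]) (auto simp: PiE_iff extensional_def)
    also have "\<dots> = (\<Prod>i\<in>I. emeasure \<beta> (A i \<inter> Q))"
      using Ci A by (subst emeasure_PiM_power[OF \<alpha>(1) I]) (auto simp: \<alpha>(2) eq intro!: prod.cong)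
    also have "\<dots> = emeasure (PiM I (\<lambda>_. \<beta>)) (\<Pi>\<^sub>E i\<in>I. A i \<inter> Q)"
      using A Q by (subst emeasure_PiM_power[OF \<beta>(1) I]) (auto simp: \<beta>(2))
    also have "\<dots> = emeasure \<mu>2 (Pi\<^sub>E I A)"
      unfolding 2[OF AA] by (simp add: PiE_Int)
    finally show "emeasure \<mu>1 (Pi\<^sub>E I A) = emeasure \<mu>2 (Pi\<^sub>E I A)" .
  qed (use I in \<open>simp_all add: \<mu>1_def \<mu>2_def sb\<close>)
  then show ?thesis using 1[OF A] 2[OF A] by simp
qed

text \<open>The identity map is measurable in both directions. Each direction is checked by
  coordinates, after writing \<open>x\<close> as its own restriction to \<open>I\<close>.\<close>

lemma sets_PiM_restrict_space:
  assumes I: "finite I" and Z: "Z \<in> sets S" and \<nu>: "sets \<nu> = sets (restrict_space S Z)"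
  shows "sets (PiM I (\<lambda>_. \<nu>)) = sets (restrict_space (PiM I (\<lambda>_. S)) (Pi\<^sub>E I (\<lambda>_. Z)))"
proof -
  have ZS: "Z \<subseteq> space S" using sets.sets_into_space[OF Z] .
  have space_\<nu>: "space \<nu> = Z"
    using sets_eq_imp_space_eq[OF \<nu>] ZS by (auto simp: space_restrict_space)
  let ?P = "PiM I (\<lambda>_. \<nu>)" and ?R = "restrict_space (PiM I (\<lambda>_. S)) (Pi\<^sub>E I (\<lambda>_. Z))"
  have spP: "space ?P = Pi\<^sub>E I (\<lambda>_. Z)" by (simp add: space_PiM space_\<nu>)
  have spR: "space ?R = Pi\<^sub>E I (\<lambda>_. Z)"
    using ZS by (auto simp: space_restrict_space space_PiM PiE_iff)
  have comp: "(\<lambda>x. x i) \<in> ?R \<rightarrow>\<^sub>M \<nu>" if "i \<in> I" for i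
  proof -
    have "(\<lambda>x. x i) \<in> ?R \<rightarrow>\<^sub>M restrict_space S Z"
      using that by (intro measurable_restrict_space3 measurable_component_singleton) auto
    then show ?thesis by (simp cong: measurable_cong_sets add: \<nu>)
  qed
  have eta: "(\<lambda>i\<in>I. x i) = x" if "x \<in> Pi\<^sub>E I (\<lambda>_. Z)" for x
    using that by (auto simp: PiE_iff intro: extensional_restrict)
  have "(\<lambda>x. x) \<in> ?R \<rightarrow>\<^sub>M ?P \<longleftrightarrow> (\<lambda>x. \<lambda>i\<in>I. x i) \<in> ?R \<rightarrow>\<^sub>M ?P"
    by (rule measurable_cong) (simp only: spR eta)
  then have id1: "(\<lambda>x. x) \<in> ?R \<rightarrow>\<^sub>M ?P"
    using measurable_restrict[of I "\<lambda>i x. x i" ?R "\<lambda>_. \<nu>", OF comp] by simp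
  have comp2: "(\<lambda>x. x i) \<in> ?P \<rightarrow>\<^sub>M S" if "i \<in> I" for i
  proof -
    have "(\<lambda>z. z) \<in> \<nu> \<rightarrow>\<^sub>M S"
      using measurable_restrict_space1[of "\<lambda>x. x" S S Z] by (simp cong: measurable_cong_sets add: \<nu>)
    from measurable_compose[OF measurable_component_singleton[OF that] this] show ?thesis .
  qed
  have "(\<lambda>x. x) \<in> ?P \<rightarrow>\<^sub>M PiM I (\<lambda>_. S) \<longleftrightarrow> (\<lambda>x. \<lambda>i\<in>I. x i) \<in> ?P \<rightarrow>\<^sub>M PiM I (\<lambda>_. S)"
    by (rule measurable_cong) (simp only: spP eta)
  then have "(\<lambda>x. x) \<in> ?P \<rightarrow>\<^sub>M PiM I (\<lambda>_. S)"
    using measurable_restrict[of I "\<lambda>i x. x i" ?P "\<lambda>_. S", OF comp2] by simp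
  then have id2: "(\<lambda>x. x) \<in> ?P \<rightarrow>\<^sub>M ?R"
    using spP by (intro measurable_restrict_space2) auto
  show ?thesis
  proof (intro equalityI subsetI)
    fix A assume "A \<in> sets ?P"
    from measurable_sets[OF id1 this] sets.sets_into_space[OF this] show "A \<in> sets ?R"
      by (simp add: spR spP Int_absorb2)
  next
    fix A assume "A \<in> sets ?R"
    from measurable_sets[OF id2 this] sets.sets_into_space[OF this] show "A \<in> sets ?P"
      by (simp add: spR spP Int_absorb2)
  qed
qed

lemma distr_PiM_restrict_space:
  assumes I: "finite I" and Z: "Z \<in> sets S" and \<nu>: "sets \<nu> = sets (restrict_space S Z)" "finite_measure \<nu>"
  shows "distr (PiM I (\<lambda>_. \<nu>)) (PiM I (\<lambda>_. S)) (\<lambda>x. x) = PiM I (\<lambda>_. distr \<nu> S (\<lambda>x. x))"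
proof -
  interpret finite_measure \<nu> by fact
  have ZS: "Z \<subseteq> space S" using sets.sets_into_space[OF Z] .
  have space_\<nu>: "space \<nu> = Z"
    using sets_eq_imp_space_eq[OF \<nu>(1)] ZS by (auto simp: space_restrict_space)
  have id\<nu>: "(\<lambda>z. z) \<in> \<nu> \<rightarrow>\<^sub>M S"
    using measurable_restrict_space1[of "\<lambda>x. x" S S Z] by (simp cong: measurable_cong_sets add: \<nu>(1))
  have idP: "(\<lambda>x. x) \<in> PiM I (\<lambda>_. \<nu>) \<rightarrow>\<^sub>M PiM I (\<lambda>_. S)"
    using measurable_restrict_space1[of "\<lambda>x. x" "PiM I (\<lambda>_. S)" "PiM I (\<lambda>_. S)" "Pi\<^sub>E I (\<lambda>_. Z)"]
    by (simp cong: measurable_cong_sets add: sets_PiM_restrict_space[OF I Z \<nu>(1)])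
  have fin: "finite_measure (distr \<nu> S (\<lambda>x. x))" by (rule finite_measure_distr[OF id\<nu>])
  interpret P: finite_measure "PiM I (\<lambda>_. \<nu>)" by (rule finite_measure_PiM_power[OF \<nu>(2) I])
  show ?thesis
  proof (rule PiM_power_eqI[where \<alpha> = S and I = I])
    show "finite_measure (distr (PiM I (\<lambda>_. \<nu>)) (PiM I (\<lambda>_. S)) (\<lambda>x. x))"
      by (rule P.finite_measure_distr[OF idP])
    fix A assume A: "\<And>i. i \<in> I \<Longrightarrow> A i \<in> sets S"
    have AA: "Pi\<^sub>E I A \<in> sets (PiM I (\<lambda>_. S))" using I A by (auto intro: sets_PiM_I_finite)
    have AZ: "A i \<inter> Z \<in> sets \<nu>" if "i \<in> I" for i
      using A[OF that] unfolding \<nu>(1) sets_restrict_space by auto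
    have "emeasure (distr (PiM I (\<lambda>_. \<nu>)) (PiM I (\<lambda>_. S)) (\<lambda>x. x)) (Pi\<^sub>E I A) =
        emeasure (PiM I (\<lambda>_. \<nu>)) (\<Pi>\<^sub>E i\<in>I. A i \<inter> Z)"
      using idP AA by (subst emeasure_distr) (auto simp: space_PiM space_\<nu> PiE_Int)
    also have "\<dots> = (\<Prod>i\<in>I. emeasure (distr \<nu> S (\<lambda>x. x)) (A i))"
      using AZ A id\<nu> by (subst emeasure_PiM_power[OF \<nu>(2) I])
        (auto simp: emeasure_distr space_\<nu> intro!: prod.cong)
    also have "\<dots> = emeasure (PiM I (\<lambda>_. distr \<nu> S (\<lambda>x. x))) (Pi\<^sub>E I A)"
      using A by (subst emeasure_PiM_power[OF fin I]) auto
    finally show "emeasure (distr (PiM I (\<lambda>_. \<nu>)) (PiM I (\<lambda>_. S)) (\<lambda>x. x)) (Pi\<^sub>E I A) =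
      emeasure (PiM I (\<lambda>_. distr \<nu> S (\<lambda>x. x))) (Pi\<^sub>E I A)" .
  qed (use I in \<open>auto intro!: sets_PiM_cong\<close>)
qed

lemma AE_PiM_power_component:
  assumes \<alpha>: "finite_measure \<alpha>" "sets \<alpha> = sets borel" and I: "finite I" "j \<in> I"
    and B: "AE z in \<alpha>. P z"
  shows "AE w in PiM I (\<lambda>_. \<alpha>). P (w j)"
proof -
  obtain N where N: "{z \<in> space \<alpha>. \<not> P z} \<subseteq> N" "emeasure \<alpha> N = 0" "N \<in> sets \<alpha>"
    using B by (rule AE_E)
  define A where "A i = (if i = j then N else space \<alpha>)" for i
  have A: "A i \<in> sets \<alpha>" for i using N(3) by (simp add: A_def)
  have "emeasure (PiM I (\<lambda>_. \<alpha>)) (Pi\<^sub>E I A) = (\<Prod>i\<in>I. emeasure \<alpha> (A i))"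
    using A by (intro emeasure_PiM_power \<alpha> I)
  also have "\<dots> = 0" using I N(2) by (intro prod_zero) (auto simp: A_def intro!: bexI[of _ j])
  finally have "emeasure (PiM I (\<lambda>_. \<alpha>)) (Pi\<^sub>E I A) = 0" .
  moreover have "Pi\<^sub>E I A \<in> sets (PiM I (\<lambda>_. \<alpha>))" using A I by (auto intro: sets_PiM_I_finite)
  moreover have "{w \<in> space (PiM I (\<lambda>_. \<alpha>)). \<not> P (w j)} \<subseteq> Pi\<^sub>E I A"
  proof
    fix w assume "w \<in> {w \<in> space (PiM I (\<lambda>_. \<alpha>)). \<not> P (w j)}"
    then have w: "w \<in> Pi\<^sub>E I (\<lambda>_. space \<alpha>)" "\<not> P (w j)" by (simp_all add: space_PiM)
    then have "w j \<in> N" using N(1) I(2) by (auto simp: PiE_iff)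
    then show "w \<in> Pi\<^sub>E I A" using w(1) by (simp add: PiE_iff A_def)
  qed
  ultimately show ?thesis by (intro AE_I[where N = "Pi\<^sub>E I A"])
qed

section \<open>Intersection measures\<close>

text \<open>Points of equal index lie in one translate \<open>t n + V\<close>, so
  \<open>- b + a\<close> lies in \<open>- V + V\<close>; for a separating \<open>V\<close> this
  makes the index injective modulo \<open>L\<close>.\<close>

lemma borel_index_of_translates:
  fixes V :: "'g :: {topological_group_add, second_countable_topology, t2_space} set"
  assumes V: "open V" "0 \<in> V"
  obtains idx :: "'g \<Rightarrow> nat" and t :: "nat \<Rightarrow> 'g" where "idx \<in> borel_measurable borel"
    "\<And>g. - t (idx g) + g \<in> V" "\<And>g. \<exists>n. - t n + g \<in> V"
proof -
  obtain t :: "nat \<Rightarrow> 'g" where t: "\<And>g. \<exists>n. - t n + g \<in> V"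
    using countable_translate_cover[OF V] by blast
  define idx where "idx g = (LEAST n. - t n + g \<in> V)" for g
  have P: "Measurable.pred borel (\<lambda>g. - t n + g \<in> V)" for n
  proof -
    have "V \<in> sets borel" using V(1) by simp
    then show ?thesis by measurable
  qed
  have "idx \<in> borel \<rightarrow>\<^sub>M count_space UNIV"
    unfolding idx_def using P by (rule measurable_Least)
  then have "idx \<in> borel_measurable borel"
    by (rule measurable_compose) simp
  moreover have "- t (idx g) + g \<in> V" for g
    unfolding idx_def by (rule LeastI_ex[OF t])
  ultimately show thesis using t by (rule that)
qed

lemma haar_sigma_finite:
  fixes m :: "'g :: {topological_group_add, second_countable_topology, t2_space} measure"
  assumes m: "haar_measure m" and V: "open V" "emeasure m V < \<infinity>"
    and cover: "\<And>g. \<exists>n::nat. - t n + g \<in> V"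
  shows "sigma_finite_measure m"
proof
  have sets_m: "sets m = sets borel" using m by (simp add: haar_measure_def)
  have space_m: "space m = UNIV" using sets_eq_imp_space_eq[OF sets_m] by simp
  have Vb: "V \<in> sets borel" using V(1) by simp
  define A where "A n = (\<lambda>g. - t n + g) -` V" for n
  have meas: "(\<lambda>g. h + g) \<in> m \<rightarrow>\<^sub>M borel" for h
    by (simp cong: measurable_cong_sets add: sets_m)
  have A: "A n \<in> sets m" "emeasure m (A n) = emeasure m V" for n
  proof -
    show "A n \<in> sets m"
      unfolding A_def using measurable_sets[OF meas Vb, of "- t n"] by (simp add: space_m)
    have "emeasure m V = emeasure (distr m borel (\<lambda>g. - t n + g)) V"
      using m by (simp add: haar_measure_def)
    also have "\<dots> = emeasure m (A n)"
      using Vb by (simp add: emeasure_distr[OF meas] A_def space_m)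
    finally show "emeasure m (A n) = emeasure m V" ..
  qed
  have "\<Union>(range A) = space m" using cover by (auto simp: A_def space_m)
  then show "\<exists>A. countable A \<and> A \<subseteq> sets m \<and> \<Union>A = space m \<and> (\<forall>a\<in>A. emeasure m a \<noteq> \<infinity>)"
    using A V(2) by (intro exI[of _ "range A"]) auto
qed

lemma diag_act_measurable:
  assumes "(\<lambda>p. act (fst p) (snd p)) \<in> borel \<Otimes>\<^sub>M borel \<rightarrow>\<^sub>M borel"
  shows "(\<lambda>p. diag_act r act (fst p) (snd p)) \<in> borel \<Otimes>\<^sub>M borel_power r \<rightarrow>\<^sub>M borel_power r"
  unfolding diag_act_def
proof (rule measurable_restrict)
  fix j assume j: "j \<in> {..<r}"
  have "(\<lambda>p. (fst p, snd p j)) \<in> borel \<Otimes>\<^sub>M borel_power r \<rightarrow>\<^sub>M borel \<Otimes>\<^sub>M borel"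
    using j by (intro measurable_Pair measurable_fst
        measurable_compose[OF measurable_snd measurable_component_singleton])
  from measurable_compose[OF this assms]
  show "(\<lambda>p. act (fst p) (snd p j)) \<in> borel \<Otimes>\<^sub>M borel_power r \<rightarrow>\<^sub>M borel" by simp
qed

theorem theorem1p4:
  fixes m :: "'g :: {topological_group_add, second_countable_topology, t2_space} measure"
    and act :: "'g \<Rightarrow> 'x :: polish_space \<Rightarrow> 'x"
    and Z :: "'x set"
    and \<mu> \<nu> :: "'x measure"
    and r :: nat
  assumes "locally compact (UNIV :: 'g set)"
    and "haar_measure m"
    and "unimodular TYPE('g)"
    and "jointly_continuous_action act"
    and "cross_section act borel Z" and "separated act Z"
    and "sets \<mu> = sets borel" and "prob_space \<mu>" and "invariant_measure act \<mu>"
    and "transverse_measure m act Z \<mu> \<nu>"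
    and "r \<ge> 1"
    and "uniform_approximate_lattice (return_times act Z)"
  shows "(\<exists>!M. intersection_measure m act Z \<nu> r M) \<and>
    (ergodic_measure act \<mu> \<longrightarrow>
      (\<forall>M. intersection_measure m act Z \<nu> r M \<longrightarrow>
        (\<exists>c::real. c > 0 \<and>
          self_joining r act \<mu>
            (scale_measure (ennreal c) (distr M (borel_power r) (\<lambda>x. x))))))"
proof -

  \<comment> \<open>Return times, a separating neighbourhood and the index\<close>
  define L where "L = return_times act Z"
  have lattice: "uniform_approximate_lattice L" using assms(12) by (simp add: L_def)
  have L0: "0 \<in> L" and Lm: "\<And>l. l \<in> L \<Longrightarrow> - l \<in> L"
    using lattice by (auto simp: uniform_approximate_lattice_def)
  obtain V where V: "open V" "0 \<in> V" "emeasure m V < \<infinity>"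
    and sep: "\<And>a b c v w. a \<in> L \<Longrightarrow> b \<in> L \<Longrightarrow> c \<in> L \<Longrightarrow> v \<in> V \<Longrightarrow> w \<in> V \<Longrightarrow> - w + v = a + b + c \<Longrightarrow> v = w"
    using separating_neighbourhood[OF assms(1,2) lattice] by metis
  obtain idx :: "'g \<Rightarrow> nat" and t where idx: "idx \<in> borel_measurable borel"
    "\<And>g. - t (idx g) + g \<in> V" "\<And>g. \<exists>n. - t n + g \<in> V"
    using borel_index_of_translates[OF V(1,2)] by metis
  have sets_m: "sets m = sets borel" using assms(2) by (simp add: haar_measure_def)
  \<comment> \<open>The third summand of \<open>sep\<close> is \<open>0\<close>. Two return times,
    with \<open>l1 = - b\<close> and \<open>l2 = a\<close>, give countability of \<open>L\<close>; a
    single one, with \<open>l2 = 0\<close>, gives \<open>idx_inj\<close>.\<close>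
  have idx_L: "a = b" if "idx a = idx b" "- b + a = l1 + l2" "l1 \<in> L" "l2 \<in> L" for a b l1 l2
  proof -
    have "- (- t (idx a) + b) + (- t (idx a) + a) = - b + a"
      by (simp add: minus_add add.assoc)
    also have "\<dots> = l1 + l2 + 0" using that(2) by simp
    finally have "- t (idx a) + a = - t (idx a) + b"
      using sep[OF that(3,4) L0] idx(2)[of a] idx(2)[of b] that(1) by metis
    then show ?thesis by simp
  qed
  have "countable L"
  proof (rule countableI')
    show "inj_on idx L"
    proof (rule inj_onI)
      fix a b assume "a \<in> L" "b \<in> L" "idx a = idx b"
      then show "a = b" using idx_L[of a b "- b" a] Lm by simp
    qed
  qed

  \<comment> \<open>The two section actions, on \<open>X\<close> and on \<open>X^r\<close>\<close>
  have act_cont: "continuous_on UNIV (\<lambda>p. act (fst p) (snd p))"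
    using assms(4) by (simp add: jointly_continuous_action_def case_prod_beta')
  have act0: "act 0 x = x" and act_add: "act (g + h) x = act g (act h x)" for g h x
    using assms(4) by (auto simp: jointly_continuous_action_def)
  have act_meas: "(\<lambda>p. act (fst p) (snd p)) \<in> borel \<Otimes>\<^sub>M borel \<rightarrow>\<^sub>M borel"
    using borel_measurable_continuous_onI[OF act_cont] by (simp add: borel_prod)
  have Z: "Z \<in> sets borel" "(\<Union>g. act g ` Z) = UNIV"
    using assms(5) by (auto simp: cross_section_def)
  define S where "S = (borel_power r :: (nat \<Rightarrow> 'x) measure)"
  define W where "W = ({..<r} \<rightarrow>\<^sub>E Z)"
  have space_S: "space S = {..<r} \<rightarrow>\<^sub>E UNIV" by (simp add: S_def space_PiM)
  have W_sets: "W \<in> sets S" unfolding W_def S_def using Z(1) by (intro sets_PiM_I_finite) auto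
  have r0: "0 \<in> {..<r}" using assms(11) by simp
  have left: "distr m borel (\<lambda>h. g + h) = m" and right: "distr m borel (\<lambda>h. h + g) = m" for g
    using assms(2,3) by (auto simp: haar_measure_def unimodular_def)
  have sf: "sigma_finite_measure m"
    by (rule haar_sigma_finite[OF assms(2) V(1,3) idx(3)])
  have idx_inj: "a = b" if "idx a = idx b" "- b + a \<in> L" for a b
    using idx_L[OF that(1) _ that(2) L0] by simp
  interpret X: section_action m borel act Z L idx
  proof (rule section_action.intro)
    fix g w assume "w \<in> Z" "act g w \<in> Z"
    then show "g \<in> L" by (auto simp: L_def return_times_def)
  qed (fact sf sets_m left right act_meas act0 act_add Z(1) \<open>countable L\<close> Lm idx(1) idx_inj | simp add: act0 act_add)+
  \<comment> \<open>A return to \<open>W\<close> under the diagonal action is in particular a return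
    of coordinate 0 to \<open>Z\<close>, a coordinate that exists because \<open>r \<ge> 1\<close>.
    So \<open>L\<close> and \<open>idx\<close> of the first instance serve again.\<close>
  interpret R: section_action m S "diag_act r act" W L idx
  proof (rule section_action.intro)
    show "(\<lambda>p. diag_act r act (fst p) (snd p)) \<in> borel \<Otimes>\<^sub>M S \<rightarrow>\<^sub>M S"
      unfolding S_def by (rule diag_act_measurable[OF act_meas])
    fix g w assume "w \<in> W" "diag_act r act g w \<in> W"
    then have "w 0 \<in> Z" "act g (w 0) \<in> Z"
      using r0 by (auto simp: W_def diag_act_def PiE_iff)
    then show "g \<in> L" by (auto simp: L_def return_times_def)
  next
    fix y assume "y \<in> space S"
    then show "diag_act r act 0 y = y"
      by (simp add: diag_act_def act0 space_S PiE_iff extensional_restrict)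
  next
    fix g h y show "diag_act r act (g + h) y = diag_act r act g (diag_act r act h y)"
      by (auto simp: diag_act_def act_add fun_eq_iff)
  qed (fact sf sets_m left right W_sets \<open>countable L\<close> Lm idx(1) idx_inj)+
  have orbits_X: "X.orbits = UNIV" using Z(2) by (simp add: X.orbits_def)
  have diag_W: "diag_act r act g y \<in> W \<longleftrightarrow> (\<forall>j<r. act g (y j) \<in> Z)" for g y
    by (auto simp: diag_act_def W_def PiE_iff)
  have orbits_R: "R.orbits = intersection_space r act Z"
  proof (rule set_eqI)
    fix y show "y \<in> R.orbits \<longleftrightarrow> y \<in> intersection_space r act Z"
      using R.orbits_space R.orbits_iff[of y] by (auto simp: intersection_space_def space_S diag_W)
  qed
  have Vb: "V \<in> sets borel" using V(1) by simp
  have mV: "emeasure m V \<noteq> 0" "emeasure m V \<noteq> \<infinity>"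
    using V assms(2) by (auto simp: haar_measure_def less_top[symmetric] dest: gr_implies_not_zero)
  have m_nonzero: "emeasure m UNIV \<noteq> 0"
    using mV(1) emeasure_mono[of V UNIV m] by (auto simp: sets_m)

  \<comment> \<open>Transverse measures as measures on the whole space\<close>
  interpret mu: prob_space \<mu> by (rule assms(8))
  have space_\<mu>: "space \<mu> = UNIV" using sets_eq_imp_space_eq[OF assms(7)] by simp
  have fin_\<nu>: "finite_measure \<nu>" and "sets \<nu> = sets (restrict_space \<mu> Z)"
    using assms(10) by (auto simp: transverse_measure_def)
  then have sets_\<nu>: "sets \<nu> = sets (restrict_space borel Z)"
    using assms(7) by (simp add: sets_restrict_space)
  have space_\<nu>: "space \<nu> = Z"
    using sets_eq_imp_space_eq[OF sets_\<nu>] by (simp add: space_restrict_space)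
  define \<nu>0 where "\<nu>0 = distr \<nu> borel (\<lambda>x. x)"
  have id\<nu>: "(\<lambda>x. x) \<in> \<nu> \<rightarrow>\<^sub>M borel"
    using measurable_restrict_space1[of "\<lambda>x. x" borel borel Z] by (simp cong: measurable_cong_sets add: sets_\<nu>)
  have fin_\<nu>0: "finite_measure \<nu>0"
    unfolding \<nu>0_def by (rule finite_measure.finite_measure_distr[OF fin_\<nu> id\<nu>])
  have sets_\<nu>0: "sets \<nu>0 = sets borel" by (simp add: \<nu>0_def)
  have tr_X: "X.transversal \<mu> \<nu>0"
    unfolding \<nu>0_def by (rule X.transversal_of_transverse_measure[OF assms(10) sets_\<nu>]) simp
  have pinv_X: "X.partially_invariant \<nu>0"
    by (rule X.transversal_partially_invariant[OF tr_X _ fin_\<nu>0 sets_\<nu>0 Vb mV]) simp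
  define N where "N = PiM {..<r} (\<lambda>_. \<nu>)"
  define N0 where "N0 = PiM {..<r} (\<lambda>_. \<nu>0)"
  have sets_N: "sets N = sets (restrict_space S W)"
    unfolding N_def S_def W_def by (rule sets_PiM_restrict_space[OF _ Z(1) sets_\<nu>]) simp
  have fin_N: "finite_measure N" unfolding N_def by (rule finite_measure_PiM_power[OF fin_\<nu>]) simp
  have distr_N: "distr N S (\<lambda>x. x) = N0"
    unfolding N_def N0_def S_def \<nu>0_def
    by (rule distr_PiM_restrict_space[OF _ Z(1) sets_\<nu> fin_\<nu>]) simp
  have fin_N0: "finite_measure N0" unfolding N0_def by (rule finite_measure_PiM_power[OF fin_\<nu>0]) simp
  have sets_N0: "sets N0 = sets S" unfolding distr_N[symmetric] by simp
  have act1: "act g \<in> borel_measurable borel" for g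
    using X.measurable_act[of "\<lambda>_. g" borel "\<lambda>x. x"] by simp
  have diag_eq: "diag_act r act g y = (\<lambda>i\<in>{..<r}. act g (y i))" for g y
    by (simp add: diag_act_def)

  \<comment> \<open>Partial invariance of the power\<close>
  have pinv_R: "R.partially_invariant N0"
    unfolding R.partially_invariant_def
  proof (intro allI ballI impI)
    fix l A assume A: "A \<in> sets S" "A \<subseteq> W"
    \<comment> \<open>Partial invariance on \<open>X\<close> controls only points that
      \<open>l\<close> keeps in \<open>Z\<close>, so each coordinate is cut to such points before
      taking powers. Since \<open>A \<subseteq> W\<close>, the cut loses nothing.\<close>
    let ?P = "{z \<in> Z. act l z \<in> Z}" and ?Q = "{z \<in> Z. act (- l) z \<in> Z}"
    have "emeasure N0 {x \<in> {..<r} \<rightarrow>\<^sub>E ?P. (\<lambda>i\<in>{..<r}. act l (x i)) \<in> A} =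
        emeasure N0 (A \<inter> ({..<r} \<rightarrow>\<^sub>E ?Q))"
      unfolding N0_def
    proof (rule PiM_power_translate[OF fin_\<nu>0 sets_\<nu>0 fin_\<nu>0 sets_\<nu>0 _ _ _ act1])
      fix B :: "'x set" assume B: "B \<in> sets borel"
      then have BZ: "B \<inter> Z \<in> sets borel" using Z(1) by simp
      have "{x \<in> ?P. act l x \<in> B} = {w \<in> Z. act l w \<in> B \<inter> Z}" by auto
      moreover have "{w \<in> B \<inter> Z. act (- l) w \<in> Z} = B \<inter> ?Q" by auto
      ultimately show "emeasure \<nu>0 {x \<in> ?P. act l x \<in> B} = emeasure \<nu>0 (B \<inter> ?Q)"
        using pinv_X[unfolded X.partially_invariant_def, rule_format, OF BZ, of l] by simp
    next
      show "A \<in> sets (borel_power r)" using A by (simp add: S_def)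
    qed (use X.return_set_sets[OF Z(1)] in simp_all)
    moreover have "{x \<in> {..<r} \<rightarrow>\<^sub>E ?P. (\<lambda>i\<in>{..<r}. act l (x i)) \<in> A} = {w \<in> W. diag_act r act l w \<in> A}"
    proof -
      have "x \<in> {..<r} \<rightarrow>\<^sub>E ?P \<longleftrightarrow> x \<in> W" if "diag_act r act l x \<in> A" for x
      proof -
        have "\<forall>j<r. act l (x j) \<in> Z" using that A(2) diag_W by blast
        then show ?thesis by (auto simp: W_def PiE_iff)
      qed
      then show ?thesis by (auto simp: diag_eq)
    qed
    moreover have "A \<inter> ({..<r} \<rightarrow>\<^sub>E ?Q) = {w \<in> A. diag_act r act (- l) w \<in> W}"
    proof -
      have "x \<in> ({..<r} \<rightarrow>\<^sub>E ?Q) \<longleftrightarrow> diag_act r act (- l) x \<in> W" if "x \<in> A" for x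
        unfolding diag_W using that A(2) by (auto simp: W_def PiE_iff)
      then show ?thesis by auto
    qed
    ultimately show "emeasure N0 {w \<in> W. diag_act r act l w \<in> A} =
      emeasure N0 {w \<in> A. diag_act r act (- l) w \<in> W}" by simp
  qed

  \<comment> \<open>Measurable location of hitting times\<close>
  obtain \<sigma>' where \<sigma>': "\<sigma>' \<in> borel_measurable \<mu>" "AE y in \<mu>. X.rep y = \<sigma>' y"
    by (rule X.rep_AE_measurable[OF tr_X mu.finite_measure_axioms _ fin_\<nu>0 sets_\<nu>0])
      (simp add: orbits_X)
  have \<sigma>: "\<sigma>' \<in> borel \<rightarrow>\<^sub>M borel"
    using \<sigma>'(1) by (simp cong: measurable_cong_sets add: assms(7))
  \<comment> \<open>\<open>\<sigma>'\<close> equals \<open>rep\<close> only almost everywhere;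
    \<open>C1\<close> collects the points where its value is a hitting time, and its complement is
    null.\<close>
  define C1 where "C1 = {x. act (\<sigma>' x) x \<in> Z}"
  have C1: "C1 \<in> sets borel"
    using measurable_sets_borel[OF X.measurable_act[OF \<sigma> measurable_ident] Z(1)]
    by (simp add: C1_def vimage_def)
  have "AE x in \<mu>. x \<notin> - C1"
    using \<sigma>'(2)
  proof eventually_elim
    fix x assume x: "X.rep x = \<sigma>' x"
    have "x \<in> X.orbits" by (simp add: orbits_X)
    from X.rep(1)[OF this] show "x \<notin> - C1" by (simp add: C1_def x)
  qed
  have proj: "AE g in m. AE w in N0. w \<in> W \<longrightarrow> act g (w j) \<notin> B"
    if B: "B \<in> sets borel" "AE x in \<mu>. x \<notin> B" and j: "j < r" for B j
  proof -
    have "AE g in m. AE z in \<nu>0. z \<in> Z \<longrightarrow> act g z \<notin> B"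
      by (rule X.transversal_null[OF tr_X _ fin_\<nu>0 sets_\<nu>0 B]) simp
    then show ?thesis
    proof eventually_elim
      fix g assume "AE z in \<nu>0. z \<in> Z \<longrightarrow> act g z \<notin> B"
      then have "AE w in N0. w j \<in> Z \<longrightarrow> act g (w j) \<notin> B"
        unfolding N0_def using j by (intro AE_PiM_power_component[OF fin_\<nu>0 sets_\<nu>0]) auto
      then show "AE w in N0. w \<in> W \<longrightarrow> act g (w j) \<notin> B"
        by eventually_elim (use j in \<open>auto simp: W_def PiE_iff\<close>)
    qed
  qed
  have comp: "(\<lambda>y. y j) \<in> S \<rightarrow>\<^sub>M borel" if "j < r" for j
    unfolding S_def using that by (intro measurable_component_singleton) simp
  \<comment> \<open>Only coordinate 0 is consulted: \<open>\<sigma>' (y 0)\<close> need not be a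
    hitting time of the tuple \<open>y\<close>, but every hitting time of \<open>y\<close> is one of
    \<open>y 0\<close> and thus differs from it by an element of \<open>L\<close>.\<close>
  define C where "C = {y \<in> space S. y 0 \<in> C1}"
  have C: "C \<in> sets S"
    using measurable_sets[OF comp C1, of 0] r0 by (simp add: C_def vimage_def Int_def conj_commute)
  have C_near: "h - \<sigma>' (y 0) \<in> L" if "y \<in> C" "diag_act r act h y \<in> W" for y h
  proof -
    have "act h (y 0) \<in> Z" using that r0 by (simp add: diag_W)
    moreover have "act (\<sigma>' (y 0)) (y 0) \<in> Z" using that by (simp add: C_def C1_def)
    moreover have "act (h - \<sigma>' (y 0)) (act (\<sigma>' (y 0)) (y 0)) = act h (y 0)"
      by (simp add: act_add[symmetric])
    ultimately show ?thesis using X.return_L[of "act (\<sigma>' (y 0)) (y 0)" "h - \<sigma>' (y 0)"] by simp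
  qed
  have C_AE: "AE g in m. AE w in N0. w \<in> W \<longrightarrow> diag_act r act g w \<in> C"
  proof -
    have "AE g in m. AE w in N0. w \<in> W \<longrightarrow> act g (w 0) \<notin> - C1"
      using proj[of "- C1" 0] C1 \<open>AE x in \<mu>. x \<notin> - C1\<close> r0 by auto
    then show ?thesis
    proof eventually_elim
      fix g assume "AE w in N0. w \<in> W \<longrightarrow> act g (w 0) \<notin> - C1"
      then show "AE w in N0. w \<in> W \<longrightarrow> diag_act r act g w \<in> C"
        by eventually_elim (use r0 in \<open>auto simp: C_def space_S diag_act_def\<close>)
    qed
  qed

  \<comment> \<open>Construction of the measure on the intersection space\<close>
  define M0 where "M0 = R.induced_measure N0"
  have sets_M0: "sets M0 = sets (restrict_space S R.orbits)" by (simp add: M0_def)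
  have formula: "(\<integral>\<^sup>+y. R.periodization f y \<partial>M0) = (\<integral>\<^sup>+g. \<integral>\<^sup>+w. f (g, w) * indicator W w \<partial>N0 \<partial>m)"
    if "f \<in> borel_measurable (borel \<Otimes>\<^sub>M S)" for f
    unfolding M0_def
    by (rule R.nn_integral_periodization_induced_measure[OF fin_N0 pinv_R sets_N0 _ C C_near C_AE that])
      (use measurable_compose[OF comp \<sigma>] r0 in auto)
  have tr_M0: "R.transversal M0 N0"
    unfolding R.transversal_def by (intro ballI formula) simp
  have W_orbits: "W \<subseteq> R.orbits"
    using R.act_W_orbits[of _ 0] R.act_0 R.W_space by force
  have restrict_M: "sets (restrict_space M W) = sets (restrict_space S W)"
    if "sets M = sets (restrict_space S R.orbits)" for M
  proof -
    have "sets (restrict_space M W) = sets (restrict_space (restrict_space S R.orbits) W)"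
      using that by (simp add: sets_restrict_space)
    also have "\<dots> = sets (restrict_space S W)"
      using W_orbits by (simp add: restrict_restrict_space sets_restrict_restrict_space Int_absorb1)
    finally show ?thesis .
  qed

  \<comment> \<open>Finiteness\<close>
  have "finite_measure M0"
  proof (rule finite_measureI)
    define lam where "lam = from_nat_into L"
    have lam: "range lam = L"
      unfolding lam_def using L0 \<open>countable L\<close> by (intro range_from_nat_into) auto
    \<comment> \<open>The estimate on \<open>X\<close> itself, where the total mass is known to be
      1; this bounds the mass of the spread of \<open>\<nu>0\<close>.\<close>
    have "emeasure m V * (\<Sum>n. emeasure \<nu>0 (X.layer lam n)) \<le> emeasure \<mu> (space \<mu>)"
      by (rule X.transversal_layers_le[OF tr_X _ fin_\<nu>0 sets_\<nu>0 _ Vb sep]) (auto simp: lam)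
    then have layers: "(\<Sum>n. emeasure \<nu>0 (X.layer lam n)) \<noteq> \<top>"
      using mV mu.emeasure_space_1 by (auto simp: ennreal_mult_top top_unique)
    have fin_spread: "finite_measure (X.spread lam \<nu>0)"
    proof (rule finite_measureI)
      have "emeasure (X.spread lam \<nu>0) UNIV = (\<Sum>n. emeasure \<nu>0 (X.layer lam n))"
        by (subst X.emeasure_spread[OF fin_\<nu>0 sets_\<nu>0]) auto
      then show "emeasure (X.spread lam \<nu>0) (space (X.spread lam \<nu>0)) \<noteq> \<infinity>"
        using layers sets_eq_imp_space_eq[OF X.sets_spread, of lam \<nu>0] by simp
    qed
    \<comment> \<open>\<open>Q\<close> lives on \<open>r\<close>-tuples from the saturation of
      \<open>Z\<close>, a larger set than the saturation of \<open>W\<close>. Its finiteness is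
      inherited from one factor, which is why layers are compared with it and not summed
      directly.\<close>
    define Q where "Q = PiM {..<r} (\<lambda>_. X.spread lam \<nu>0)"
    have sets_Q: "sets Q = sets S" unfolding Q_def S_def by (intro sets_PiM_cong) simp_all
    interpret Q: finite_measure Q unfolding Q_def by (rule finite_measure_PiM_power[OF fin_spread]) simp
    have "(\<Sum>n. emeasure N0 (R.layer lam n)) \<le> emeasure Q (space Q)"
    proof (rule R.sum_layers_le[OF sets_Q sets_N0])
      fix n A assume A: "A \<in> sets S"
      let ?Q = "{z. act (- lam n) z \<in> Z}"
      have Qm: "?Q \<in> sets borel"
        using measurable_sets_borel[OF act1 Z(1), of "- lam n"] by (simp add: vimage_def)
      have "emeasure N0 {x \<in> {..<r} \<rightarrow>\<^sub>E Z. (\<lambda>i\<in>{..<r}. act (lam n) (x i)) \<in> A} =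
          emeasure Q (A \<inter> ({..<r} \<rightarrow>\<^sub>E ?Q))"
        unfolding N0_def Q_def
      proof (rule PiM_power_translate[OF fin_\<nu>0 sets_\<nu>0 fin_spread X.sets_spread _ Z(1) Qm act1])
        fix B :: "'x set" assume B: "B \<in> sets borel"
        show "emeasure \<nu>0 {x \<in> Z. act (lam n) x \<in> B} = emeasure (X.spread lam \<nu>0) (B \<inter> ?Q)"
          unfolding X.spread_translate[OF fin_\<nu>0 pinv_X sets_\<nu>0 B] by (simp add: Int_def)
      next
        show "A \<in> sets (borel_power r)" using A by (simp add: S_def)
      qed simp
      moreover have "A \<inter> ({..<r} \<rightarrow>\<^sub>E ?Q) = {y \<in> A. diag_act r act (- lam n) y \<in> W}"
        using sets.sets_into_space[OF A] by (auto simp: diag_W space_S PiE_iff)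
      ultimately show "emeasure N0 {w \<in> W. diag_act r act (lam n) w \<in> A} =
          emeasure Q {y \<in> A. diag_act r act (- lam n) y \<in> W}"
        by (simp add: W_def[symmetric] diag_eq[symmetric])
    qed
    then have sumN: "(\<Sum>n. emeasure N0 (R.layer lam n)) \<noteq> \<top>"
      using Q.emeasure_finite by (auto simp: top_unique)
    obtain K where K: "compact K" "K + L = UNIV"
      using lattice by (auto simp: uniform_approximate_lattice_def)
    have Kb: "K \<in> sets borel" using compact_imp_closed[OF K(1)] by simp
    have "emeasure M0 (space M0) \<le> emeasure m K * (\<Sum>n. emeasure N0 (R.layer lam n))"
    proof (rule R.transversal_mass_le[OF tr_M0 _ fin_N0 sets_N0 _ Kb])
      fix g
      have "g \<in> K + L" using K(2) by simp
      then show "\<exists>k\<in>K. \<exists>l\<in>L. g = k + l" by (auto simp: set_plus_def)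
    qed (simp_all add: M0_def lam)
    also have "\<dots> < \<top>"
    proof -
      have "emeasure m K < \<top>" using assms(2) K(1) by (simp add: haar_measure_def)
      then show ?thesis using sumN by (simp add: ennreal_mult_less_top less_top)
    qed
    finally show "emeasure M0 (space M0) \<noteq> \<infinity>" by simp
  qed

  \<comment> \<open>Existence and uniqueness\<close>
  have char: "intersection_measure m act Z \<nu> r M \<longleftrightarrow>
    sets M = sets (restrict_space S R.orbits) \<and> finite_measure M \<and>
    invariant_measure (diag_act r act) M \<and> transverse_measure m (diag_act r act) W M N" for M
    by (simp add: intersection_measure_def S_def W_def N_def orbits_R[unfolded S_def W_def])
  have M0: "intersection_measure m act Z \<nu> r M0"
    unfolding char
  proof (intro conjI sets_M0 \<open>finite_measure M0\<close>)
    show "invariant_measure (diag_act r act) M0"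
      by (rule R.transversal_invariant[OF tr_M0 sets_M0 fin_N0 sets_N0])
    show "transverse_measure m (diag_act r act) W M0 N"
      by (rule R.transverse_measureI[OF fin_N sets_N])
        (simp_all add: sets_N restrict_M[OF sets_M0] formula distr_N)
  qed
  have tr_M: "R.transversal M N0" if "intersection_measure m act Z \<nu> r M" for M
  proof -
    have M: "sets M = sets (restrict_space S R.orbits)" "transverse_measure m (diag_act r act) W M N"
      using that by (simp_all add: char)
    have "space M \<subseteq> space S"
      using sets_eq_imp_space_eq[OF M(1)] by (auto simp: space_restrict_space)
    then show ?thesis
      using R.transversal_of_transverse_measure[OF M(2) sets_N] by (simp add: distr_N)
  qed
  have "\<exists>!M. intersection_measure m act Z \<nu> r M"
  proof (rule ex1I[of _ M0])
    fix M assume M: "intersection_measure m act Z \<nu> r M"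
    then show "M = M0"
      using R.transversal_unique[OF tr_M[OF M] _ tr_M0 sets_M0] by (simp add: char)
  qed (rule M0)

  \<comment> \<open>The self-joining in the ergodic case\<close>
  moreover have "\<exists>c::real. c > 0 \<and>
      self_joining r act \<mu> (scale_measure (ennreal c) (distr M (borel_power r) (\<lambda>x. x)))"
    if erg: "ergodic_measure act \<mu>" and M: "intersection_measure m act Z \<nu> r M" for M
  proof -
    have sets_M: "sets M = sets (restrict_space S R.orbits)" and fin_M: "finite_measure M"
      and inv_M: "invariant_measure (diag_act r act) M"
      using M by (simp_all add: char)
    interpret M: finite_measure M by (rule fin_M)
    have space_M: "space M = R.orbits"
      using sets_eq_imp_space_eq[OF sets_M] R.orbits_space by (auto simp: space_restrict_space)
    have id_M: "(\<lambda>x. x) \<in> M \<rightarrow>\<^sub>M S"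
      using measurable_restrict_space1[of "\<lambda>x. x" S S R.orbits]
      by (simp cong: measurable_cong_sets add: sets_M)
    define J where "J = distr M S (\<lambda>x. x)"
    have sets_J: "sets J = sets S" and space_J: "space J = space S" by (simp_all add: J_def)
    have em_J: "emeasure J A = emeasure M (A \<inter> R.orbits)" if "A \<in> sets S" for A
      using that id_M by (simp add: J_def emeasure_distr space_M)
    interpret J: finite_measure J unfolding J_def by (rule M.finite_measure_distr[OF id_M])
    have diag_meas: "diag_act r act g \<in> S \<rightarrow>\<^sub>M S" for g
      using R.measurable_act[of "\<lambda>_. g" S "\<lambda>x. x"] by simp
    have inv_J: "emeasure J (diag_act r act g -` A \<inter> space S) = emeasure J A" if A: "A \<in> sets S" for g A
    proof -
      have AO: "A \<inter> R.orbits \<in> sets M" using A by (auto simp: sets_M sets_restrict_space)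
      have gM: "diag_act r act g \<in> M \<rightarrow>\<^sub>M M" "distr M M (diag_act r act g) = M"
        using inv_M by (auto simp: invariant_measure_def)
      have "emeasure J (diag_act r act g -` A \<inter> space S) =
          emeasure M (diag_act r act g -` (A \<inter> R.orbits) \<inter> space M)"
        using R.orbits_space R.act_orbits
        by (subst em_J[OF measurable_sets[OF diag_meas A]]) (auto simp: space_M intro!: arg_cong[where f = "emeasure M"])
      also have "\<dots> = emeasure (distr M M (diag_act r act g)) (A \<inter> R.orbits)"
        using gM(1) AO by (simp add: emeasure_distr)
      also have "\<dots> = emeasure J A" unfolding gM(2) em_J[OF A] ..
      finally show ?thesis .
    qed
    define \<kappa> where "\<kappa> = emeasure J (space S)"
    have "\<kappa> \<noteq> \<top>" using J.emeasure_finite by (simp add: \<kappa>_def)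
    have marg: "emeasure J ((\<lambda>x. x j) -` A \<inter> space S) = \<kappa> * emeasure \<mu> A"
      if j: "j < r" and A: "A \<in> sets borel" for j A
    proof -
      define \<eta> where "\<eta> = distr J borel (\<lambda>x. x j)"
      have compJ: "(\<lambda>x. x j) \<in> J \<rightarrow>\<^sub>M borel"
        using comp[OF j] by (simp cong: measurable_cong_sets add: sets_J)
      have em_\<eta>: "emeasure \<eta> B = emeasure J ((\<lambda>x. x j) -` B \<inter> space S)" if "B \<in> sets borel" for B
        using that compJ by (simp add: \<eta>_def emeasure_distr space_J)
      have "emeasure \<eta> A = emeasure \<eta> (space borel) * emeasure \<mu> A"
      proof (rule X.ergodic_absolutely_continuous[OF assms(8,7) erg m_nonzero _ _ _ _ _ A])
        show "distr \<mu> \<mu> (act g) = \<mu>" for g using assms(9) by (simp add: invariant_measure_def)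
        show "finite_measure \<eta>" unfolding \<eta>_def by (rule J.finite_measure_distr[OF compJ])
        show "sets \<eta> = sets borel" by (simp add: \<eta>_def)
        show "emeasure \<eta> (act g -` B \<inter> space borel) = emeasure \<eta> B" if B: "B \<in> sets borel" for g B
        proof -
          have gB: "act g -` B \<in> sets borel" by (rule measurable_sets_borel[OF act1 B])
          have BS: "(\<lambda>x. x j) -` B \<inter> space S \<in> sets S" by (rule measurable_sets[OF comp[OF j] B])
          have "(\<lambda>x. x j) -` (act g -` B) \<inter> space S =
              diag_act r act g -` ((\<lambda>x. x j) -` B \<inter> space S) \<inter> space S"
            using j R.act_space by (auto simp: diag_act_def)
          then show ?thesis using inv_J[OF BS, of g] by (simp add: em_\<eta>[OF gB] em_\<eta>[OF B])
        qed
        show "absolutely_continuous \<mu> \<eta>"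
          unfolding absolutely_continuous_def
        proof
          fix B assume B: "B \<in> null_sets \<mu>"
          then have Bb: "B \<in> sets borel" using assms(7) by auto
          have BS: "(\<lambda>x. x j) -` B \<inter> space S \<in> sets S" by (rule measurable_sets[OF comp[OF j] Bb])
          have "AE x in \<mu>. x \<notin> B" using B by (rule AE_not_in)
          \<comment> \<open>For a \<open>\<mu>\<close>-null set \<open>B\<close>, almost every
            translate of almost every point of \<open>W\<close> has its coordinate \<open>j\<close>
            outside \<open>B\<close>; integrating this over the fundamental domain gives the
            marginal of \<open>B\<close>.\<close>
          note null = proj[OF Bb this j]
          have "emeasure \<eta> B = (\<integral>\<^sup>+g. \<integral>\<^sup>+w. indicator R.fundamental (g, w) *
              indicator ((\<lambda>x. x j) -` B \<inter> space S) (diag_act r act g w) \<partial>N0 \<partial>m)"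
            unfolding em_\<eta>[OF Bb] em_J[OF BS] by (rule R.transversal_emeasure[OF tr_M[OF M] sets_M BS])
          also have "\<dots> = (\<integral>\<^sup>+g. \<integral>\<^sup>+w. 0 \<partial>N0 \<partial>m)"
          proof (intro nn_integral_cong_AE, use null in eventually_elim, intro nn_integral_cong_AE,
              elim eventually_mono)
            fix g w assume "w \<in> W \<longrightarrow> act g (w j) \<notin> B"
            then show "indicator R.fundamental (g, w) *
                indicator ((\<lambda>x. x j) -` B \<inter> space S) (diag_act r act g w) = (0 :: ennreal)"
              using R.fundamental_W[of "(g, w)"] j by (auto simp: diag_act_def split: split_indicator)
          qed
          finally show "B \<in> null_sets \<eta>" using Bb by (simp add: null_sets_def \<eta>_def)
        qed
      qed
      then show ?thesis using A by (simp add: em_\<eta> \<kappa>_def)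
    qed
    \<comment> \<open>Mass zero would descend to the section: testing the formula on
      \<open>UNIV \<times> W\<close> gives \<open>N0\<close> of \<open>W\<close> equal to zero,
      hence \<open>\<nu>0\<close> of \<open>Z\<close> is zero, and the formula on \<open>X\<close>
      then gives \<open>\<mu>\<close> total mass zero.\<close>
    have "\<kappa> \<noteq> 0"
    proof
      assume "\<kappa> = 0"
      have "emeasure M (space M) = 0"
        using \<open>\<kappa> = 0\<close> em_J[of "space S"] R.orbits_space by (simp add: \<kappa>_def space_M Int_absorb1)
      then have "(\<integral>\<^sup>+y. R.periodization (indicator (UNIV \<times> W)) y \<partial>M) = (\<integral>\<^sup>+y. 0 \<partial>M)"
        by (intro nn_integral_cong_AE AE_I[where N = "space M"]) auto
      moreover have "UNIV \<times> W \<in> sets (borel \<Otimes>\<^sub>M S)" using W_sets by simp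
      ultimately have "(\<integral>\<^sup>+g. \<integral>\<^sup>+w. indicator (UNIV \<times> W) (g, w) * indicator W w \<partial>N0 \<partial>m) = 0"
        using tr_M[OF M] by (simp add: R.transversal_def)
      also have "(\<integral>\<^sup>+g. \<integral>\<^sup>+w. indicator (UNIV \<times> W) (g, w) * indicator W w \<partial>N0 \<partial>m) =
          (\<integral>\<^sup>+(g::'g). \<integral>\<^sup>+w. indicator W w \<partial>N0 \<partial>m)"
        by (intro nn_integral_cong) (auto split: split_indicator)
      also have "\<dots> = emeasure N0 W * emeasure m UNIV"
        using W_sets by (simp add: sets_N0)
      finally have "emeasure N0 W = 0" using m_nonzero by simp
      moreover have "emeasure N0 W = (\<Prod>i<r. emeasure \<nu>0 Z)"
        unfolding N0_def W_def using Z(1) by (intro emeasure_PiM_power fin_\<nu>0) (simp_all add: sets_\<nu>0)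
      ultimately have \<nu>Z: "emeasure \<nu>0 Z = 0" by simp
      have "(\<integral>\<^sup>+y. 1 \<partial>\<mu>) = (\<integral>\<^sup>+y. X.periodization (indicator X.fundamental) y \<partial>\<mu>)"
        by (intro nn_integral_cong) (simp add: X.periodization_indicator_fundamental orbits_X)
      also have "\<dots> = (\<integral>\<^sup>+g. \<integral>\<^sup>+w. indicator X.fundamental (g, w) * indicator Z w \<partial>\<nu>0 \<partial>m)"
        using tr_X X.fundamental_sets unfolding X.transversal_def by blast
      also have "\<dots> \<le> (\<integral>\<^sup>+(g::'g). \<integral>\<^sup>+w. indicator Z w \<partial>\<nu>0 \<partial>m)"
        by (intro nn_integral_mono) (auto split: split_indicator)
      also have "\<dots> = 0" using \<nu>Z Z(1) by (simp add: sets_\<nu>0)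
      finally show False by (simp add: mu.emeasure_space_1)
    qed
    define c where "c = 1 / enn2real \<kappa>"
    have c: "c > 0" "ennreal c * \<kappa> = 1"
    proof -
      have k: "enn2real \<kappa> > 0" "\<kappa> = ennreal (enn2real \<kappa>)"
        using \<open>\<kappa> \<noteq> 0\<close> \<open>\<kappa> \<noteq> \<top>\<close> by (auto simp: enn2real_positive_iff less_top zero_less_iff_neq_zero)
      then show "c > 0" by (simp add: c_def)
      have "ennreal c * \<kappa> = ennreal (c * enn2real \<kappa>)"
        using k \<open>c > 0\<close> by (metis ennreal_mult' less_imp_le)
      also have "\<dots> = 1" using k(1) by (simp add: c_def)
      finally show "ennreal c * \<kappa> = 1" .
    qed
    define P where "P = scale_measure (ennreal c) J"
    have sets_P: "sets P = sets S" by (simp add: P_def sets_J)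
    note space_P = sets_eq_imp_space_eq[OF sets_P]
    have em_P: "emeasure P A = ennreal c * emeasure J A" for A by (simp add: P_def)
    have "self_joining r act \<mu> P"
      unfolding self_joining_def
    proof (intro conjI allI impI)
      show "prob_space P"
        by (rule prob_spaceI) (simp add: em_P space_P \<kappa>_def[symmetric] c)
      show "sets P = sets (borel_power r)" by (simp add: sets_P S_def)
      show "invariant_measure (diag_act r act) P"
        unfolding invariant_measure_def
      proof (intro allI conjI)
        fix g
        show gP: "diag_act r act g \<in> P \<rightarrow>\<^sub>M P"
          using diag_meas[of g] by (simp cong: measurable_cong_sets add: sets_P)
        show "distr P P (diag_act r act g) = P"
        proof (rule measure_eqI)
          fix A assume "A \<in> sets (distr P P (diag_act r act g))"
          then have "A \<in> sets S" by (simp add: sets_P)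
          then show "emeasure (distr P P (diag_act r act g)) A = emeasure P A"
            using gP inv_J by (simp add: emeasure_distr sets_P space_P em_P)
        qed simp
      qed
      fix j assume j: "j < r"
      have compP: "(\<lambda>x. x j) \<in> P \<rightarrow>\<^sub>M borel"
        using comp[OF j] by (simp cong: measurable_cong_sets add: sets_P)
      show "distr P borel (\<lambda>x. x j) = \<mu>"
      proof (rule measure_eqI)
        fix A assume "A \<in> sets (distr P borel (\<lambda>x. x j))"
        then have A: "A \<in> sets borel" by simp
        have "emeasure (distr P borel (\<lambda>x. x j)) A = ennreal c * (\<kappa> * emeasure \<mu> A)"
          using compP A by (simp add: emeasure_distr em_P space_P marg[OF j A])
        also have "\<dots> = emeasure \<mu> A" by (simp add: mult.assoc[symmetric] c)
        finally show "emeasure (distr P borel (\<lambda>x. x j)) A = emeasure \<mu> A" .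
      qed (simp add: assms(7))
    qed
    then show ?thesis using c(1) unfolding P_def J_def S_def by blast
  qed
  ultimately show ?thesis by blast
qed

end
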